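(* Let $M$ be a separably categorical metric structure, $G=\operatorname{Aut}(M)$ its automorphism group, and let $a\in M^n$ ($n\le\omega$) be a tuple such that the orbit $Ga$ (for the diagonal action of $G$ on $M^n$) is closed. Then the action $G\curvearrowright Ga$ is uniformly micro-transitive.
   Context: Metric structures (continuous logic): a metric structure $M$ is a complete bounded metric space $(M,d)$ with a family of distinguished bounded, uniformly continuous real-valued predicates on finite powers of $M$ (interpretations of the symbols of a relational language). $\operatorname{Aut}(M)$ is the group of invertible isometries of $M$ preserving the distinguished predicates, with the topology of pointwise convergence on $M$. $M$ is separably categorical if it is, up to isomorphism, the unique separable model of its (continuous) first-order theory; the language is then assumed countable (possibly up to interdefinability). The power $M^n$ carries a $G$-invariant metric compatible with the product uniformity, e.g. $d(x,y)=\sum_{i<n}2^{-i}d(x_i,y_i)$. A continuous action of a topological group $G$ on a metric space $(X,d)$ is uniformly micro-transitive if for every neighborhood $U$ of the identity in $G$ there is $\delta>0$ such that $B_\delta(x)\cap Gx\subseteq Ux$ for all $x\in X$, where $B_\delta(x)=\{y\in X:d(x,y)<\delta\}$. *)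

theory Defs
  imports "HOL-Analysis.Analysis" "HOL-Algebra.Group_Action" "HOL-Library.Extended_Nat"
begin

section \<open>Metric structures\<close>

record 'r language =
  symbols :: "'r set"
  arity :: "'r \<Rightarrow> nat"

record ('a, 'r) mstructure =
  universe :: "'a metric"
  interp :: "'r \<Rightarrow> 'a list \<Rightarrow> real"

definition tuples :: "'a metric \<Rightarrow> nat \<Rightarrow> 'a list set" where
  "tuples X k = {xs. length xs = k \<and> set xs \<subseteq> mspace X}"

text \<open>Bounded and uniformly continuous, for the maximum metric on the finite power.\<close>

definition predicate_on :: "'a metric \<Rightarrow> nat \<Rightarrow> ('a list \<Rightarrow> real) \<Rightarrow> bool" where
  "predicate_on X k P \<longleftrightarrow>
     bounded (P ` tuples X k) \<and>
     (\<forall>\<epsilon>>0. \<exists>\<delta>>0. \<forall>xs\<in>tuples X k. \<forall>ys\<in>tuples X k.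
        (\<forall>i<k. mdist X (xs ! i) (ys ! i) < \<delta>) \<longrightarrow> \<bar>P xs - P ys\<bar> < \<epsilon>)"

text \<open>
  Boundedness constants and moduli of continuity are not part of the language.  This does not
  affect the class of models of a complete theory: both are expressed by sentences.
\<close>

definition metric_structure :: "'r language \<Rightarrow> ('a, 'r) mstructure \<Rightarrow> bool" where
  "metric_structure L A \<longleftrightarrow>
     mspace (universe A) \<noteq> {} \<and>
     mcomplete_of (universe A) \<and>
     (\<exists>B. \<forall>x\<in>mspace (universe A). \<forall>y\<in>mspace (universe A). mdist (universe A) x y \<le> B) \<and>
     (\<forall>P\<in>symbols L. predicate_on (universe A) (arity L P) (interp A P))"

definition isomorphism ::
    "'r language \<Rightarrow> ('a, 'r) mstructure \<Rightarrow> ('b, 'r) mstructure \<Rightarrow> ('a \<Rightarrow> 'b) \<Rightarrow> bool" where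
  "isomorphism L A B f \<longleftrightarrow>
     bij_betw f (mspace (universe A)) (mspace (universe B)) \<and>
     (\<forall>x\<in>mspace (universe A). \<forall>y\<in>mspace (universe A).
        mdist (universe B) (f x) (f y) = mdist (universe A) x y) \<and>
     (\<forall>P\<in>symbols L. \<forall>xs\<in>tuples (universe A) (arity L P).
        interp B P (map f xs) = interp A P xs)"

definition isomorphic ::
    "'r language \<Rightarrow> ('a, 'r) mstructure \<Rightarrow> ('b, 'r) mstructure \<Rightarrow> bool" where
  "isomorphic L A B \<longleftrightarrow> (\<exists>f. isomorphism L A B f)"


section \<open>Continuous first-order logic\<close>

text \<open>
  The connective \<open>Conn u [\<phi>\<^sub>0, \<dots>, \<phi>\<^sub>m]\<close> stands for \<open>u(\<phi>\<^sub>0, \<dots>, \<phi>\<^sub>m, 0, 0, \<dots>)\<close>, with \<open>u\<close> a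
  function on \<open>nat \<Rightarrow> real\<close> that is continuous for the product topology.  Restricting \<open>u\<close> to
  the first coordinates shows that these are exactly the continuous real functions of finitely
  many real arguments.
\<close>

datatype 'r formula =
    Dist nat nat
  | Pred 'r "nat list"
  | Conn "(nat \<Rightarrow> real) \<Rightarrow> real" "'r formula list"
  | SupF nat "'r formula"
  | InfF nat "'r formula"

primrec eval :: "('a, 'r) mstructure \<Rightarrow> 'r formula \<Rightarrow> (nat \<Rightarrow> 'a) \<Rightarrow> real" where
  "eval A (Dist i j) s = mdist (universe A) (s i) (s j)"
| "eval A (Pred P vs) s = interp A P (map s vs)"
| "eval A (Conn u \<phi>s) s =
     u (\<lambda>i. if i < length \<phi>s then (map (eval A) \<phi>s ! i) s else 0)"
| "eval A (SupF i \<phi>) s = (SUP x\<in>mspace (universe A). eval A \<phi> (s(i := x)))"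
| "eval A (InfF i \<phi>) s = (INF x\<in>mspace (universe A). eval A \<phi> (s(i := x)))"

primrec free_vars :: "'r formula \<Rightarrow> nat set" where
  "free_vars (Dist i j) = {i, j}"
| "free_vars (Pred P vs) = set vs"
| "free_vars (Conn u \<phi>s) = \<Union> (set (map free_vars \<phi>s))"
| "free_vars (SupF i \<phi>) = free_vars \<phi> - {i}"
| "free_vars (InfF i \<phi>) = free_vars \<phi> - {i}"

primrec is_formula :: "'r language \<Rightarrow> 'r formula \<Rightarrow> bool" where
  "is_formula L (Dist i j) \<longleftrightarrow> True"
| "is_formula L (Pred P vs) \<longleftrightarrow> P \<in> symbols L \<and> length vs = arity L P"
| "is_formula L (Conn u \<phi>s) \<longleftrightarrow> continuous_on UNIV u \<and> list_all id (map (is_formula L) \<phi>s)"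
| "is_formula L (SupF i \<phi>) \<longleftrightarrow> is_formula L \<phi>"
| "is_formula L (InfF i \<phi>) \<longleftrightarrow> is_formula L \<phi>"

definition sentences :: "'r language \<Rightarrow> 'r formula set" where
  "sentences L = {\<sigma>. is_formula L \<sigma> \<and> free_vars \<sigma> = {}}"

text \<open>
  The theory of a structure is the set of conditions \<open>\<sigma> = 0\<close> that hold in it.  As \<open>\<sigma> - r\<close> is a
  sentence for every real \<open>r\<close>, it determines the value of every sentence.
\<close>

definition satisfies :: "('a, 'r) mstructure \<Rightarrow> 'r formula \<Rightarrow> bool" where
  "satisfies A \<sigma> \<longleftrightarrow> (\<forall>s. range s \<subseteq> mspace (universe A) \<longrightarrow> eval A \<sigma> s = 0)"

definition theory_of :: "'r language \<Rightarrow> ('a, 'r) mstructure \<Rightarrow> 'r formula set" where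
  "theory_of L A = {\<sigma>\<in>sentences L. satisfies A \<sigma>}"

definition model_of :: "'r language \<Rightarrow> 'r formula set \<Rightarrow> ('a, 'r) mstructure \<Rightarrow> bool" where
  "model_of L T A \<longleftrightarrow> metric_structure L A \<and> (\<forall>\<sigma>\<in>T. satisfies A \<sigma>)"

definition separable_structure :: "('a, 'r) mstructure \<Rightarrow> bool" where
  "separable_structure A \<longleftrightarrow> separable_space (mtopology_of (universe A))"

text \<open>
  Models are taken with universe a set of reals.  A separable metric space has at most
  continuum many points, so this loses nothing: see \<open>separably_categorical_any_type\<close> below.
\<close>

definition separably_categorical :: "'r language \<Rightarrow> ('a, 'r) mstructure \<Rightarrow> bool" where
  "separably_categorical L A \<longleftrightarrow>
     metric_structure L A \<and> separable_structure A \<and>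
     (\<forall>B :: (real, 'r) mstructure.
        model_of L (theory_of L A) B \<and> separable_structure B \<longrightarrow> isomorphic L B A)"


lemma separable_inj_real:
  fixes X :: "'a metric"
  assumes "separable_space (mtopology_of X)"
  obtains f :: "'a \<Rightarrow> real" where "inj_on f (mspace X)"
proof -
  interpret Metric_space "mspace X" "mdist X" by simp
  obtain C where C: "countable C" "C \<subseteq> mspace X" "mtopology closure_of C = mspace X"
    using assms unfolding separable_space_def mtopology_of_def by auto
  define e where "e = from_nat_into C"
  define h where "h x = {p :: nat. mdist X x (e (fst (prod_decode p))) < 1 / Suc (snd (prod_decode p))}" for x
  have "inj_on h (mspace X)"
  proof (rule inj_onI, rule ccontr)
    fix x y assume xy: "x \<in> mspace X" "y \<in> mspace X" "h x = h y" "x \<noteq> y"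
    then have pos: "mdist X x y > 0" by simp
    then obtain m :: nat where m: "1 / Suc m < mdist X x y / 2"
      by (meson half_gt_zero nat_approx_posE)
    have "x \<in> mtopology closure_of C" using C xy by simp
    moreover have "0 < 1 / real (Suc m)" by simp
    ultimately have "\<exists>c\<in>C. c \<in> mball x (1 / real (Suc m))"
      unfolding metric_closure_of by blast
    then obtain c where c: "c \<in> C" "mdist X x c < 1 / Suc m" by auto
    have "range e = C" using c C(1) unfolding e_def by (metis empty_iff range_from_nat_into)
    then obtain k where k: "c = e k" using c by blast
    have "prod_encode (k, m) \<in> h x" using c k by (simp add: h_def)
    then have "prod_encode (k, m) \<in> h y" using xy by simp
    then have "mdist X y c < 1 / Suc m" using k by (simp add: h_def)
    moreover have "mdist X x y \<le> mdist X x c + mdist X y c"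
      using triangle[of x c y] commute[of y c] xy c C by auto
    ultimately show False using m c by linarith
  qed
  moreover obtain j :: "nat set \<Rightarrow> real" where "inj j"
    using nat_sets_eqpoll_reals unfolding eqpoll_def bij_betw_def by auto
  ultimately have "inj_on (j \<circ> h) (mspace X)"
    by (meson comp_inj_on inj_on_subset subset_UNIV)
  with that show ?thesis by blast
qed

lemma eval_isomorphism:
  assumes iso: "isomorphism L A B f" and "is_formula L \<phi>" "range s \<subseteq> mspace (universe A)"
  shows "eval B \<phi> (f \<circ> s) = eval A \<phi> s"
  using assms(2,3)
proof (induction \<phi> arbitrary: s)
  case (Dist i j)
  then have "s i \<in> mspace (universe A)" "s j \<in> mspace (universe A)" by auto
  then show ?case using iso by (simp add: isomorphism_def)
next
  case (Pred P vs)
  then have "map s vs \<in> tuples (universe A) (arity L P)" by (auto simp: tuples_def)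
  then have "interp B P (map f (map s vs)) = interp A P (map s vs)"
    using iso Pred unfolding isomorphism_def is_formula.simps by blast
  then show ?case by (simp add: o_def)
next
  case (Conn u \<phi>s)
  have "(map (eval B) \<phi>s ! i) (f \<circ> s) = (map (eval A) \<phi>s ! i) s" if "i < length \<phi>s" for i
    using that Conn.IH[of "\<phi>s ! i" s] Conn.prems by (simp add: list_all_length o_def)
  then have "(\<lambda>i. if i < length \<phi>s then (map (eval B) \<phi>s ! i) (f \<circ> s) else 0) =
      (\<lambda>i. if i < length \<phi>s then (map (eval A) \<phi>s ! i) s else 0)" by auto
  then show ?case by (simp only: eval.simps)
next
  case (SupF i \<phi>)
  have im: "mspace (universe B) = f ` mspace (universe A)"
    using iso by (auto simp: isomorphism_def bij_betw_def)
  have "eval B \<phi> ((f \<circ> s)(i := f x)) = eval A \<phi> (s(i := x))" if "x \<in> mspace (universe A)" for x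
  proof -
    have "range (s(i := x)) \<subseteq> mspace (universe A)" using SupF.prems that by auto
    moreover have "f \<circ> s(i := x) = (f \<circ> s)(i := f x)" by (auto simp: fun_eq_iff)
    ultimately show ?thesis using SupF.IH SupF.prems by (metis is_formula.simps)
  qed
  then show ?case
    unfolding eval.simps im image_image by (intro arg_cong[where f = Sup] image_cong refl)
next
  case (InfF i \<phi>)
  have im: "mspace (universe B) = f ` mspace (universe A)"
    using iso by (auto simp: isomorphism_def bij_betw_def)
  have "eval B \<phi> ((f \<circ> s)(i := f x)) = eval A \<phi> (s(i := x))" if "x \<in> mspace (universe A)" for x
  proof -
    have "range (s(i := x)) \<subseteq> mspace (universe A)" using InfF.prems that by auto
    moreover have "f \<circ> s(i := x) = (f \<circ> s)(i := f x)" by (auto simp: fun_eq_iff)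
    ultimately show ?thesis using InfF.IH InfF.prems by (metis is_formula.simps)
  qed
  then show ?case
    unfolding eval.simps im image_image by (intro arg_cong[where f = Inf] image_cong refl)
qed

lemma isomorphism_comp:
  assumes "isomorphism L A B f" "isomorphism L B C g"
  shows "isomorphism L A C (g \<circ> f)"
proof -
  have fm: "f x \<in> mspace (universe B)" if "x \<in> mspace (universe A)" for x
    using assms(1) that by (auto simp: isomorphism_def bij_betw_def)
  then have "map f xs \<in> tuples (universe B) k" if "xs \<in> tuples (universe A) k" for xs k
    using that by (auto simp: tuples_def)
  moreover have "bij_betw (g \<circ> f) (mspace (universe A)) (mspace (universe C))"
    using assms by (meson isomorphism_def bij_betw_trans)
  ultimately show ?thesis using assms fm unfolding isomorphism_def
    by (auto simp flip: map_map)
qed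

lemma transport_structure:
  fixes A :: "('a, 'r) mstructure" and f :: "'a \<Rightarrow> 'b"
  assumes "metric_structure L A" "separable_structure A" "inj_on f (mspace (universe A))"
  obtains B :: "('b, 'r) mstructure" where
    "metric_structure L B" "separable_structure B" "isomorphism L A B f"
proof -
  let ?S = "mspace (universe A)"
  let ?d = "mdist (universe A)"
  define h where "h = inv_into ?S f"
  have h: "h (f x) = x" if "x \<in> ?S" for x using that assms(3) by (simp add: h_def)
  have MS: "Metric_space (f ` ?S) (\<lambda>x y. ?d (h x) (h y))"
    by unfold_locales (auto simp: h mdist_commute intro: mdist_triangle)
  define Y where "Y = metric (f ` ?S, \<lambda>x y. ?d (h x) (h y))"
  have Y: "mspace Y = f ` ?S" "mdist Y = (\<lambda>x y. ?d (h x) (h y))"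
    using MS by (simp_all add: Y_def Metric_space.mspace_metric Metric_space.mdist_metric)
  define B :: "('b, 'r) mstructure" where
    "B = \<lparr>universe = Y, interp = (\<lambda>P xs. interp A P (map h xs))\<rparr>"
  have B: "universe B = Y" "\<And>P xs. interp B P xs = interp A P (map h xs)" by (simp_all add: B_def)
  have mh: "map h xs \<in> tuples (universe A) k" if "xs \<in> tuples Y k" for xs k
    using that h by (auto simp: tuples_def Y)
  have mf: "map h (map f xs) = xs" if "xs \<in> tuples (universe A) k" for xs k
    using that h by (auto simp: tuples_def intro!: map_idI)
  have iso: "isomorphism L A B f"
    using assms(3) h mf by (fastforce simp: isomorphism_def B Y bij_betw_def simp del: map_map)
  have pred: "predicate_on Y k (\<lambda>xs. P (map h xs))" if P: "predicate_on (universe A) k P" for k P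
    unfolding predicate_on_def
  proof (intro conjI allI impI)
    have "(\<lambda>xs. P (map h xs)) ` tuples Y k \<subseteq> P ` tuples (universe A) k" using mh by auto
    then show "bounded ((\<lambda>xs. P (map h xs)) ` tuples Y k)"
      using P unfolding predicate_on_def by (meson bounded_subset)
    fix \<epsilon> :: real assume "\<epsilon> > 0"
    then obtain \<delta> where \<delta>: "\<delta> > 0" "\<And>xs ys. xs \<in> tuples (universe A) k \<Longrightarrow> ys \<in> tuples (universe A) k \<Longrightarrow>
        (\<forall>i<k. ?d (xs ! i) (ys ! i) < \<delta>) \<Longrightarrow> \<bar>P xs - P ys\<bar> < \<epsilon>"
      using P unfolding predicate_on_def by meson
    show "\<exists>\<delta>>0. \<forall>xs\<in>tuples Y k. \<forall>ys\<in>tuples Y k. (\<forall>i<k. mdist Y (xs ! i) (ys ! i) < \<delta>) \<longrightarrow>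
        \<bar>P (map h xs) - P (map h ys)\<bar> < \<epsilon>"
    proof (intro exI[of _ \<delta>] conjI ballI impI \<delta>)
      fix xs ys assume "xs \<in> tuples Y k" "ys \<in> tuples Y k" "\<forall>i<k. mdist Y (xs ! i) (ys ! i) < \<delta>"
      then show "map h xs \<in> tuples (universe A) k" "map h ys \<in> tuples (universe A) k"
        "\<forall>i<k. ?d (map h xs ! i) (map h ys ! i) < \<delta>"
        using mh by (auto simp: Y tuples_def)
    qed
  qed
  interpret MA: Metric_space ?S ?d by simp
  interpret MB: Metric_space "f ` ?S" "\<lambda>x y. ?d (h x) (h y)" by (rule MS)
  have comp: "mcomplete_of Y"
  proof -
    have "MB.mcomplete" unfolding MB.mcomplete_def
    proof (intro allI impI)
      fix \<sigma> assume c: "MB.MCauchy \<sigma>"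
      have "MA.MCauchy (h \<circ> \<sigma>)" using c h unfolding MA.MCauchy_def MB.MCauchy_def
        by (auto simp: image_subset_iff o_def) (metis imageE rangeI)
      then obtain x where x: "limitin MA.mtopology (h \<circ> \<sigma>) x sequentially"
        using assms(1) unfolding metric_structure_def mcomplete_of_def MA.mcomplete_def by blast
      have "limitin MB.mtopology \<sigma> (f x) sequentially"
        using x c h unfolding MA.limitin_metric MB.limitin_metric MB.MCauchy_def
        by (fastforce elim: eventually_mono simp: image_subset_iff)
      then show "\<exists>x. limitin MB.mtopology \<sigma> x sequentially" by blast
    qed
    then show ?thesis by (simp add: mcomplete_of_def Y)
  qed
  have "separable_space (mtopology_of Y)"
  proof -
    obtain C where C: "countable C" "C \<subseteq> ?S" "MA.mtopology closure_of C = ?S"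
      using assms(2) unfolding separable_structure_def separable_space_def mtopology_of_def by auto
    have "f x \<in> MB.mtopology closure_of (f ` C)" if "x \<in> ?S" for x
    proof -
      have "x \<in> MA.mtopology closure_of C" using C that by simp
      then have *: "\<forall>r>0. \<exists>y\<in>C. ?d x y < r" unfolding MA.metric_closure_of by fastforce
      then show ?thesis using C(2) that h unfolding MB.metric_closure_of
        by (force simp: subset_iff)
    qed
    then have "MB.mtopology closure_of (f ` C) = f ` ?S"
      using closure_of_subset_topspace[of MB.mtopology "f ` C"] by auto
    then show ?thesis using C unfolding separable_space_def mtopology_of_def Y
      by (intro exI[of _ "f ` C"]) auto
  qed
  then have "separable_structure B" by (simp add: separable_structure_def B)
  moreover have "metric_structure L B"
  proof -
    have "predicate_on Y (arity L P) (interp B P)" if "P \<in> symbols L" for P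
      using pred assms(1) that by (simp add: B_def metric_structure_def)
    then show ?thesis
      using assms(1) comp h unfolding metric_structure_def by (simp add: B(1) Y)
  qed
  ultimately show ?thesis using that iso by blast
qed

lemma isomorphism_inv:
  assumes "isomorphism L A B f"
  shows "isomorphism L B A (inv_into (mspace (universe A)) f)"
proof -
  let ?h = "inv_into (mspace (universe A)) f"
  have b: "bij_betw f (mspace (universe A)) (mspace (universe B))"
    using assms by (simp add: isomorphism_def)
  have hm: "?h y \<in> mspace (universe A)" "f (?h y) = y" if "y \<in> mspace (universe B)" for y
    using b that by (auto simp: bij_betw_def inv_into_into f_inv_into_f)
  have "interp A P (map ?h ys) = interp B P ys"
    if "P \<in> symbols L" "ys \<in> tuples (universe B) (arity L P)" for P ys
  proof -
    have "map ?h ys \<in> tuples (universe A) (arity L P)" "map f (map ?h ys) = ys"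
      using that hm by (auto simp: tuples_def intro!: map_idI)
    then show ?thesis using assms that unfolding isomorphism_def by metis
  qed
  moreover have "mdist (universe A) (?h x) (?h y) = mdist (universe B) x y"
    if "x \<in> mspace (universe B)" "y \<in> mspace (universe B)" for x y
    using assms that hm unfolding isomorphism_def by metis
  ultimately show ?thesis using b by (simp add: isomorphism_def bij_betw_inv_into)
qed

theorem separably_categorical_any_type:
  fixes A :: "('a, 'r) mstructure" and B :: "('b, 'r) mstructure"
  assumes "separably_categorical L A" "model_of L (theory_of L A) B" "separable_structure B"
  shows "isomorphic L B A"
proof -
  obtain f :: "'b \<Rightarrow> real" where "inj_on f (mspace (universe B))"
    using separable_inj_real assms(3) unfolding separable_structure_def by blast
  then obtain C :: "(real, 'r) mstructure" where
    C: "metric_structure L C" "separable_structure C" "isomorphism L B C f"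
    using transport_structure assms unfolding model_of_def by metis
  have "model_of L (theory_of L A) C" unfolding model_of_def satisfies_def
  proof (intro conjI ballI allI impI C(1))
    fix \<sigma> and s :: "nat \<Rightarrow> real"
    assume \<sigma>: "\<sigma> \<in> theory_of L A" and s: "range s \<subseteq> mspace (universe C)"
    let ?h = "inv_into (mspace (universe B)) f"
    have iso: "isomorphism L C B ?h" using C(3) by (rule isomorphism_inv)
    have "eval B \<sigma> (?h \<circ> s) = eval C \<sigma> s"
      using \<sigma> s by (intro eval_isomorphism[OF iso]) (auto simp: theory_of_def sentences_def)
    moreover have "range (?h \<circ> s) \<subseteq> mspace (universe B)"
      using iso s by (fastforce simp: isomorphism_def bij_betw_def)
    ultimately show "eval C \<sigma> s = 0"
      using assms(2) \<sigma> unfolding model_of_def satisfies_def by metis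
  qed
  then obtain g where "isomorphism L C A g"
    using assms(1) C(2) unfolding separably_categorical_def isomorphic_def by blast
  then show ?thesis using isomorphism_comp[OF C(3)] unfolding isomorphic_def by blast
qed


subsection \<open>Interdefinability\<close>

text \<open>A definable predicate (without parameters) is a uniform limit of formulas.\<close>

definition definable_predicate ::
    "'r language \<Rightarrow> ('a, 'r) mstructure \<Rightarrow> nat \<Rightarrow> ('a list \<Rightarrow> real) \<Rightarrow> bool" where
  "definable_predicate L A k P \<longleftrightarrow>
     (\<forall>\<epsilon>>0. \<exists>\<phi>. is_formula L \<phi> \<and> free_vars \<phi> \<subseteq> {..<k} \<and>
        (\<forall>xs\<in>tuples (universe A) k. \<bar>P xs - eval A \<phi> (\<lambda>i. xs ! i)\<bar> \<le> \<epsilon>))"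

definition interdefinable ::
    "'r language \<Rightarrow> ('a, 'r) mstructure \<Rightarrow> 's language \<Rightarrow> ('a, 's) mstructure \<Rightarrow> bool" where
  "interdefinable L A L' A' \<longleftrightarrow>
     universe A = universe A' \<and>
     (\<forall>P\<in>symbols L. definable_predicate L' A' (arity L P) (interp A P)) \<and>
     (\<forall>P\<in>symbols L'. definable_predicate L A (arity L' P) (interp A' P))"

definition countable_language_up_to_interdef ::
    "'r language \<Rightarrow> ('a, 'r) mstructure \<Rightarrow> bool" where
  "countable_language_up_to_interdef L A \<longleftrightarrow>
     (\<exists>(L' :: nat language) A'. metric_structure L' A' \<and> interdefinable L A L' A')"


section \<open>Topological groups and uniformly micro-transitive actions\<close>

definition topological_group :: "('g, 'm) monoid_scheme \<Rightarrow> 'g topology \<Rightarrow> bool" where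
  "topological_group G T \<longleftrightarrow>
     group G \<and> topspace T = carrier G \<and>
     continuous_map (prod_topology T T) T (\<lambda>(g, h). g \<otimes>\<^bsub>G\<^esub> h) \<and>
     continuous_map T T (\<lambda>g. inv\<^bsub>G\<^esub> g)"

definition continuous_action ::
    "('g, 'm) monoid_scheme \<Rightarrow> 'g topology \<Rightarrow> 'x metric \<Rightarrow> ('g \<Rightarrow> 'x \<Rightarrow> 'x) \<Rightarrow> bool" where
  "continuous_action G T X \<phi> \<longleftrightarrow>
     topological_group G T \<and> group_action G (mspace X) \<phi> \<and>
     continuous_map (prod_topology T (mtopology_of X)) (mtopology_of X) (\<lambda>(g, x). \<phi> g x)"

definition nbhd_of_identity :: "('g, 'm) monoid_scheme \<Rightarrow> 'g topology \<Rightarrow> 'g set \<Rightarrow> bool" where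
  "nbhd_of_identity G T U \<longleftrightarrow>
     U \<subseteq> carrier G \<and> (\<exists>V. openin T V \<and> \<one>\<^bsub>G\<^esub> \<in> V \<and> V \<subseteq> U)"

definition uniformly_micro_transitive ::
    "('g, 'm) monoid_scheme \<Rightarrow> 'g topology \<Rightarrow> 'x metric \<Rightarrow> ('g \<Rightarrow> 'x \<Rightarrow> 'x) \<Rightarrow> bool" where
  "uniformly_micro_transitive G T X \<phi> \<longleftrightarrow>
     continuous_action G T X \<phi> \<and>
     (\<forall>U. nbhd_of_identity G T U \<longrightarrow>
        (\<exists>\<delta>>0. \<forall>x\<in>mspace X. mball_of X x \<delta> \<inter> orbit G \<phi> x \<subseteq> {\<phi> g x | g. g \<in> U}))"


section \<open>The automorphism group and its diagonal actions\<close>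

definition Aut :: "'r language \<Rightarrow> ('a, 'r) mstructure \<Rightarrow> ('a \<Rightarrow> 'a) monoid" where
  "Aut L A =
     BijGroup (mspace (universe A))
       \<lparr>carrier := {g \<in> Bij (mspace (universe A)). isomorphism L A A g}\<rparr>"

definition Aut_topology :: "'r language \<Rightarrow> ('a, 'r) mstructure \<Rightarrow> ('a \<Rightarrow> 'a) topology" where
  "Aut_topology L A =
     subtopology
       (product_topology (\<lambda>_. mtopology_of (universe A)) (mspace (universe A)))
       (carrier (Aut L A))"

text \<open>Powers with exponent at most \<open>\<omega>\<close>; the exponent \<open>\<infinity> :: enat\<close> gives the power \<open>\<omega>\<close>.\<close>

definition indices :: "enat \<Rightarrow> nat set" where
  "indices n = {i. enat i < n}"

definition power_space :: "'a metric \<Rightarrow> enat \<Rightarrow> (nat \<Rightarrow> 'a) set" where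
  "power_space X n = (\<Pi>\<^sub>E i\<in>indices n. mspace X)"

definition diag_action :: "'a metric \<Rightarrow> enat \<Rightarrow> ('a \<Rightarrow> 'a) \<Rightarrow> (nat \<Rightarrow> 'a) \<Rightarrow> (nat \<Rightarrow> 'a)" where
  "diag_action X n g = (\<lambda>x\<in>power_space X n. \<lambda>i\<in>indices n. g (x i))"

text \<open>The metric \<open>D\<close> on the power induces the product uniformity.\<close>

definition compatible_power_metric :: "'a metric \<Rightarrow> enat \<Rightarrow> (nat \<Rightarrow> 'a) metric \<Rightarrow> bool" where
  "compatible_power_metric X n D \<longleftrightarrow>
     mspace D = power_space X n \<and>
     (\<forall>i\<in>indices n. \<forall>\<epsilon>>0. \<exists>\<delta>>0. \<forall>x\<in>power_space X n. \<forall>y\<in>power_space X n.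
        mdist D x y < \<delta> \<longrightarrow> mdist X (x i) (y i) < \<epsilon>) \<and>
     (\<forall>\<epsilon>>0. \<exists>F \<delta>. finite F \<and> F \<subseteq> indices n \<and> \<delta> > 0 \<and>
        (\<forall>x\<in>power_space X n. \<forall>y\<in>power_space X n.
           (\<forall>i\<in>F. mdist X (x i) (y i) < \<delta>) \<longrightarrow> mdist D x y < \<epsilon>))"

definition invariant_metric ::
    "('g, 'm) monoid_scheme \<Rightarrow> ('g \<Rightarrow> 'x \<Rightarrow> 'x) \<Rightarrow> 'x metric \<Rightarrow> bool" where
  "invariant_metric G \<phi> D \<longleftrightarrow>
     (\<forall>g\<in>carrier G. \<forall>x\<in>mspace D. \<forall>y\<in>mspace D. mdist D (\<phi> g x) (\<phi> g y) = mdist D x y)"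

text \<open>
  The standard example \<open>\<Sum>\<^sub>i 2\<^sup>-\<^sup>i d(x\<^sub>i, y\<^sub>i)\<close>.
\<close>

definition weighted_dist :: "'a metric \<Rightarrow> enat \<Rightarrow> (nat \<Rightarrow> 'a) \<Rightarrow> (nat \<Rightarrow> 'a) \<Rightarrow> real" where
  "weighted_dist X n x y =
     (if x \<in> power_space X n \<and> y \<in> power_space X n
      then \<Sum>i. if i \<in> indices n then (1/2)^i * mdist X (x i) (y i) else 0 else 0)"

definition weighted_metric :: "'a metric \<Rightarrow> enat \<Rightarrow> (nat \<Rightarrow> 'a) metric" where
  "weighted_metric X n = metric (power_space X n, weighted_dist X n)"

lemma weighted_metric_compatible:
  assumes bdd: "\<And>x y. x \<in> mspace X \<Longrightarrow> y \<in> mspace X \<Longrightarrow> mdist X x y \<le> B"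
  shows "mspace (weighted_metric X n) = power_space X n"
    and "mdist (weighted_metric X n) = weighted_dist X n"
    and "compatible_power_metric X n (weighted_metric X n)"
proof -
  let ?P = "power_space X n" and ?I = "indices n"
  let ?t = "\<lambda>x y i. if i \<in> ?I then (1/2)^i * mdist X (x i) (y i) else (0::real)"
  have mem: "x i \<in> mspace X" if "x \<in> ?P" "i \<in> ?I" for x i
    using that by (auto simp: power_space_def)
  have B: "\<bar>?t x y i\<bar> \<le> (1/2)^i * \<bar>B\<bar>" if "x \<in> ?P" "y \<in> ?P" for x y i
    using bdd[OF mem mem, of x i y i] that by (auto intro!: mult_left_mono)
  have summ: "summable (?t x y)" if "x \<in> ?P" "y \<in> ?P" for x y
    by (rule summable_comparison_test'[of "\<lambda>i. (1/2)^i * \<bar>B\<bar>" 0])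
       (use B that in \<open>auto intro!: summable_mult2 summable_geometric\<close>)
  have w: "weighted_dist X n x y = suminf (?t x y)" if "x \<in> ?P" "y \<in> ?P" for x y
    using that by (simp add: weighted_dist_def)
  have le: "(1/2)^i * mdist X (x i) (y i) \<le> weighted_dist X n x y"
    if "x \<in> ?P" "y \<in> ?P" "i \<in> ?I" for x y i
    using sum_le_suminf[OF summ[OF that(1,2)], of "{i}"] that by (simp add: w)
  have MS: "Metric_space ?P (weighted_dist X n)"
  proof
    fix x y show "0 \<le> weighted_dist X n x y"
      using summ by (auto simp: weighted_dist_def intro!: suminf_nonneg)
    show "weighted_dist X n x y = weighted_dist X n y x"
      by (simp add: weighted_dist_def mdist_commute[of X "x _" "y _"] conj_commute cong: if_cong)
  next
    fix x y assume xy: "x \<in> ?P" "y \<in> ?P"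
    show "weighted_dist X n x y = 0 \<longleftrightarrow> x = y"
    proof
      assume z: "weighted_dist X n x y = 0"
      have "x i = y i" if i: "i \<in> ?I" for i
      proof -
        have "(1/2)^i * mdist X (x i) (y i) \<le> 0" using le[OF xy i] z by simp
        then have "mdist X (x i) (y i) \<le> 0" by (metis mult_le_cancel_left_pos mult_zero_right zero_less_divide_1_iff zero_less_numeral zero_less_power)
        then have "mdist X (x i) (y i) = 0" using mdist_nonneg by (metis antisym)
        then show ?thesis using mdist_zero mem xy i by metis
      qed
      then show "x = y" using xy unfolding power_space_def by (meson PiE_ext)
    next
      assume "x = y"
      then have "?t x y = (\<lambda>i. 0)" using xy mem mdist_zero by fastforce
      then show "weighted_dist X n x y = 0" using xy by (simp add: w)
    qed
  next
    fix x y z assume xyz: "x \<in> ?P" "y \<in> ?P" "z \<in> ?P"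
    have "suminf (?t x z) \<le> (\<Sum>i. ?t x y i + ?t y z i)"
    proof (rule suminf_le)
      show "?t x z i \<le> ?t x y i + ?t y z i" for i
        using mdist_triangle[of "x i" X "y i" "z i"] mem xyz
        by (auto simp flip: distrib_left)
    qed (use summ xyz in \<open>auto intro!: summable_add\<close>)
    also have "\<dots> = suminf (?t x y) + suminf (?t y z)"
      by (rule suminf_add[symmetric]) (use summ xyz in auto)
    finally show "weighted_dist X n x z \<le> weighted_dist X n x y + weighted_dist X n y z"
      using xyz by (simp add: w)
  qed
  show ms: "mspace (weighted_metric X n) = ?P" and md: "mdist (weighted_metric X n) = weighted_dist X n"
    using MS by (simp_all add: weighted_metric_def Metric_space.mspace_metric Metric_space.mdist_metric)
  show "compatible_power_metric X n (weighted_metric X n)"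
    unfolding compatible_power_metric_def ms md
  proof (intro conjI ballI allI impI refl)
    fix i and \<epsilon> :: real assume i: "i \<in> ?I" and \<epsilon>: "\<epsilon> > 0"
    show "\<exists>\<delta>>0. \<forall>x\<in>?P. \<forall>y\<in>?P. weighted_dist X n x y < \<delta> \<longrightarrow> mdist X (x i) (y i) < \<epsilon>"
    proof (intro exI[of _ "(1/2)^i * \<epsilon>"] conjI ballI impI)
      fix x y assume xy: "x \<in> ?P" "y \<in> ?P" "weighted_dist X n x y < (1/2)^i * \<epsilon>"
      then have "(1/2)^i * mdist X (x i) (y i) < (1/2)^i * \<epsilon>" using le[OF xy(1,2) i] by linarith
      then show "mdist X (x i) (y i) < \<epsilon>" by simp
    qed (use \<epsilon> in simp)
  next
    fix \<epsilon> :: real assume \<epsilon>: "\<epsilon> > 0"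
    have "(\<lambda>N. (1/2)^N * (2 * \<bar>B\<bar>)) \<longlonglongrightarrow> 0 * (2 * \<bar>B\<bar>)"
      by (intro tendsto_intros) (auto intro: LIMSEQ_realpow_zero)
    then have "eventually (\<lambda>N. (1/2)^N * (2 * \<bar>B\<bar>) < \<epsilon>/2) sequentially"
      using \<epsilon> by (intro order_tendstoD(2)) auto
    then obtain N where N: "(1/2)^N * (2 * \<bar>B\<bar>) < \<epsilon>/2" by (auto simp: eventually_sequentially)
    define \<delta> where "\<delta> = \<epsilon> / (2 * (real N + 1))"
    have \<delta>: "\<delta> > 0" using \<epsilon> by (simp add: \<delta>_def)
    have N\<delta>: "real N * \<delta> \<le> \<epsilon>/2" using \<epsilon> by (simp add: \<delta>_def field_simps)
    have "weighted_dist X n x y < \<epsilon>"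
      if xy: "x \<in> ?P" "y \<in> ?P" and c: "\<forall>i\<in>?I \<inter> {..<N}. mdist X (x i) (y i) < \<delta>" for x y
    proof -
      have "suminf (?t x y) = (\<Sum>i. ?t x y (i + N)) + (\<Sum>i<N. ?t x y i)"
        by (rule suminf_split_initial_segment[OF summ[OF xy]])
      moreover have "(\<Sum>i<N. ?t x y i) \<le> (\<Sum>i<N. \<delta>)"
      proof (rule sum_mono)
        fix i assume "i \<in> {..<N}"
        then have "mdist X (x i) (y i) \<le> \<delta>" if "i \<in> ?I" using c that by force
        moreover have "(1/2)^i * mdist X (x i) (y i) \<le> 1 * mdist X (x i) (y i)"
          by (intro mult_right_mono) (auto simp: power_le_one)
        ultimately show "?t x y i \<le> \<delta>" using \<delta> by auto
      qed
      moreover have "(\<Sum>i. ?t x y (i + N)) \<le> (\<Sum>i. (1/2)^i * ((1/2)^N * \<bar>B\<bar>))"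
      proof (rule suminf_le)
        show "?t x y (i + N) \<le> (1/2)^i * ((1/2)^N * \<bar>B\<bar>)" for i
          using B[OF xy, of "i + N"] unfolding power_add by (smt (verit) mult.assoc)
        show "summable (\<lambda>i. ?t x y (i + N))"
          using summ[OF xy] summable_iff_shift[of "?t x y" N] by simp
      qed (intro summable_mult2 summable_geometric, simp)
      moreover have "(\<Sum>i. (1/2)^i * ((1/2)^N * \<bar>B\<bar>)) = (1/2)^N * (2 * \<bar>B\<bar>)"
        by (subst suminf_mult2[symmetric]) (auto simp: suminf_geometric summable_geometric)
      ultimately show ?thesis using N N\<delta> w[OF xy] by simp
    qed
    then show "\<exists>F \<delta>. finite F \<and> F \<subseteq> ?I \<and> \<delta> > 0 \<and>
        (\<forall>x\<in>?P. \<forall>y\<in>?P. (\<forall>i\<in>F. mdist X (x i) (y i) < \<delta>) \<longrightarrow> weighted_dist X n x y < \<epsilon>)"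
      using \<delta> by (intro exI[of _ "?I \<inter> {..<N}"] exI[of _ \<delta>]) auto
  qed
qed

lemma weighted_metric_invariant:
  assumes "metric_structure L A"
  shows "invariant_metric (Aut L A) (diag_action (universe A) n) (weighted_metric (universe A) n)"
proof -
  let ?X = "universe A"
  obtain B where B: "\<And>x y. x \<in> mspace ?X \<Longrightarrow> y \<in> mspace ?X \<Longrightarrow> mdist ?X x y \<le> B"
    using assms unfolding metric_structure_def by blast
  have W: "mspace (weighted_metric ?X n) = power_space ?X n"
    "mdist (weighted_metric ?X n) = weighted_dist ?X n"
    by (rule weighted_metric_compatible(1,2)[where B = B], rule B, assumption+)+
  show ?thesis unfolding invariant_metric_def W
  proof (intro ballI)
    fix g x y
    assume g: "g \<in> carrier (Aut L A)" and xy: "x \<in> power_space ?X n" "y \<in> power_space ?X n"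
    have iso: "isomorphism L A A g" using g by (simp add: Aut_def)
    have mem: "z i \<in> mspace ?X" if "z \<in> power_space ?X n" "i \<in> indices n" for z i
      using that by (auto simp: power_space_def)
    have gm: "g z \<in> mspace ?X" if "z \<in> mspace ?X" for z
      using iso that by (auto simp: isomorphism_def bij_betw_def)
    have dm: "diag_action ?X n g z \<in> power_space ?X n" if "z \<in> power_space ?X n" for z
      using that gm mem by (auto simp: diag_action_def power_space_def)
    have "(if i \<in> indices n then (1/2)^i * mdist ?X (diag_action ?X n g x i) (diag_action ?X n g y i) else 0) =
        (if i \<in> indices n then (1/2)^i * mdist ?X (x i) (y i) else (0::real))" for i
      using iso xy mem by (simp add: diag_action_def isomorphism_def)
    then show "weighted_dist ?X n (diag_action ?X n g x) (diag_action ?X n g y) = weighted_dist ?X n x y"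
      using xy dm unfolding weighted_dist_def by simp
  qed
qed

end

theory Submission
  imports Defs
begin

text \<open>
  By the omitting types argument, separable categoricity makes every type of \<open>M\<close> isolated up to
  any prescribed metric error, and a back-and-forth construction then turns closeness of types
  into closeness of orbits. As all limits of types are realised in \<open>M\<close>, the orbit spaces
  \<open>M\<^sup>\<omega> // G\<close> are compact.

  For a closed orbit \<open>Ga\<close>, Effros' argument (Baire category, then successive approximation) gives
  micro-transitivity at every single point. If uniformity failed for pairs \<open>x\<^sub>j, y\<^sub>j\<close> and a
  neighbourhood of the identity given by a finite tuple \<open>b\<close>, then suitable translates
  \<open>g\<^sub>j (x\<^sub>j, b)\<close> would converge to some \<open>(x, c)\<close> with \<open>x\<close> in the orbit, and micro-transitivity at
  \<open>x\<close> for the neighbourhood given by \<open>c\<close>, conjugated back by \<open>g\<^sub>j\<close>, would yield a contradiction.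
\<close>

section \<open>Formulas\<close>

text \<open>The only way to produce points of \<open>M\<close> is categoricity, applied to a
  separable model, and separability forces all demands on such a model into a countable list. Hence
  the countable, uniformly dense set of formulas, and hence a construction in the style of forcing:
  a descending chain of open conditions decides all formulas and supplies witnesses, and the Henkin
  model of the limit type is carried into \<open>M\<close> by an isomorphism. The distance between
  two types need not be attained in \<open>M\<close>. All comparisons of types therefore allow an
  error, and the back-and-forth moves the points chosen before; halving the errors makes these moves
  summable. In the uniformity argument, micro-transitivity at the limit point has to be conjugated
  by \<open>g_j\<close>, which distorts neighbourhoods of the identity. This is why \<open>b\<close>
  is carried along: the neighbourhoods given by the tuples \<open>g_j b\<close> are all comparable
  with the one given by \<open>c\<close>. Closedness of the orbit is used twice, for Baire category
  and to place the limit point in the orbit.\<close>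

lemma finite_free_vars [simp]: "finite (free_vars \<phi>)"
  by (induction \<phi>) auto

lemma eval_cong: "(\<And>i. i \<in> free_vars \<phi> \<Longrightarrow> s i = s' i) \<Longrightarrow> eval A \<phi> s = eval A \<phi> s'"
proof (induction \<phi> arbitrary: s s')
  case (Pred P vs)
  then have "map s vs = map s' vs" by simp
  then show ?case by (simp only: eval.simps)
next
  case (Conn u \<phi>s)
  have "(map (eval A) \<phi>s ! i) s = (map (eval A) \<phi>s ! i) s'" if "i < length \<phi>s" for i
  proof -
    have "eval A (\<phi>s ! i) s = eval A (\<phi>s ! i) s'"
      using that Conn.prems by (intro Conn.IH) (auto intro: nth_mem)
    then show ?thesis using that by simp
  qed
  then have "(\<lambda>i. if i < length \<phi>s then (map (eval A) \<phi>s ! i) s else 0) =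
      (\<lambda>i. if i < length \<phi>s then (map (eval A) \<phi>s ! i) s' else 0)" by auto
  then show ?case by (simp only: eval.simps)
next
  case (SupF i \<phi>)
  then have "eval A \<phi> (s(i := x)) = eval A \<phi> (s'(i := x))" for x by (intro SupF.IH) auto
  then show ?case by simp
next
  case (InfF i \<phi>)
  then have "eval A \<phi> (s(i := x)) = eval A \<phi> (s'(i := x))" for x by (intro InfF.IH) auto
  then show ?case by simp
qed auto

lemma eval_Conn_cong:
  assumes "length \<phi>s = length \<psi>s"
    "\<And>i. i < length \<phi>s \<Longrightarrow> eval A (\<phi>s ! i) s = eval B (\<psi>s ! i) t"
  shows "eval A (Conn u \<phi>s) s = eval B (Conn u \<psi>s) t"
proof -
  have "(\<lambda>i. if i < length \<phi>s then (map (eval A) \<phi>s ! i) s else 0) =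
      (\<lambda>i. if i < length \<psi>s then (map (eval B) \<psi>s ! i) t else 0)" using assms by auto
  then show ?thesis by (simp only: eval.simps)
qed

lemma is_formula_Conn: "is_formula L (Conn u \<phi>s) \<longleftrightarrow> continuous_on UNIV u \<and> (\<forall>\<phi>\<in>set \<phi>s. is_formula L \<phi>)"
  by (simp add: list_all_iff)

text \<open>The map \<open>\<pi>\<close> may identify variables. Under a quantifier, the bound
  variable is sent to some \<open>j\<close> outside the image of the free variables, so that nothing
  is captured.\<close>

lemma formula_rename:
  fixes A :: "('a, 'r) mstructure"
  assumes "is_formula L \<phi>"
  shows "\<exists>\<phi>'. is_formula L \<phi>' \<and> (\<forall>s. eval A \<phi>' s = eval A \<phi> (s \<circ> \<pi>))"
  using assms
proof (induction \<phi> arbitrary: \<pi>)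
  case (Dist i j)
  show ?case by (rule exI[of _ "Dist (\<pi> i) (\<pi> j)"]) simp
next
  case (Pred P vs)
  then show ?case by (intro exI[of _ "Pred P (map \<pi> vs)"]) (simp add: o_def)
next
  case (Conn u \<phi>s)
  then have "\<forall>\<phi>\<in>set \<phi>s. \<exists>\<phi>'. is_formula L \<phi>' \<and> (\<forall>s. eval A \<phi>' s = eval A \<phi> (s \<circ> \<pi>))"
    unfolding is_formula_Conn by blast
  then obtain h where h: "\<forall>\<phi>\<in>set \<phi>s. is_formula L (h \<phi>) \<and> (\<forall>s. eval A (h \<phi>) s = eval A \<phi> (s \<circ> \<pi>))"
    by metis
  show ?case
  proof (intro exI[of _ "Conn u (map h \<phi>s)"] conjI allI)
    show "is_formula L (Conn u (map h \<phi>s))" using h Conn.prems unfolding is_formula_Conn by auto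
    show "eval A (Conn u (map h \<phi>s)) s = eval A (Conn u \<phi>s) (s \<circ> \<pi>)" for s
      by (rule eval_Conn_cong) (use h in auto)
  qed
next
  case (SupF i \<phi>)
  obtain j where j: "j \<notin> \<pi> ` free_vars \<phi>" using ex_new_if_finite[of "\<pi> ` free_vars \<phi>"] by auto
  obtain \<phi>' where \<phi>': "is_formula L \<phi>'" "\<And>s. eval A \<phi>' s = eval A \<phi> (s \<circ> \<pi>(i := j))"
    using SupF.IH[of "\<pi>(i := j)"] SupF.prems by (metis is_formula.simps(4))
  have "eval A \<phi>' (s(j := x)) = eval A \<phi> ((s \<circ> \<pi>)(i := x))" for s x
    unfolding \<phi>' by (rule eval_cong) (use j in auto)
  then show ?case using \<phi>'(1) by (intro exI[of _ "SupF j \<phi>'"]) (simp add: o_def)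
next
  case (InfF i \<phi>)
  obtain j where j: "j \<notin> \<pi> ` free_vars \<phi>" using ex_new_if_finite[of "\<pi> ` free_vars \<phi>"] by auto
  obtain \<phi>' where \<phi>': "is_formula L \<phi>'" "\<And>s. eval A \<phi>' s = eval A \<phi> (s \<circ> \<pi>(i := j))"
    using InfF.IH[of "\<pi>(i := j)"] InfF.prems by (metis is_formula.simps(5))
  have "eval A \<phi>' (s(j := x)) = eval A \<phi> ((s \<circ> \<pi>)(i := x))" for s x
    unfolding \<phi>' by (rule eval_cong) (use j in auto)
  then show ?case using \<phi>'(1) by (intro exI[of _ "InfF j \<phi>'"]) (simp add: o_def)
qed

section \<open>Connectives on compact boxes\<close>

definition conn_box :: "nat \<Rightarrow> real \<Rightarrow> (nat \<Rightarrow> real) set" where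
  "conn_box N B = {z. (\<forall>i<N. \<bar>z i\<bar> \<le> B) \<and> (\<forall>i\<ge>N. z i = 0)}"

lemma LIMSEQ_fun_iff:
  fixes f :: "nat \<Rightarrow> nat \<Rightarrow> real"
  shows "f \<longlonglongrightarrow> l \<longleftrightarrow> (\<forall>i. (\<lambda>n. f n i) \<longlonglongrightarrow> l i)"
  using limitin_componentwise[of "\<lambda>_::nat. euclidean :: real topology" UNIV f l sequentially]
  by (simp add: euclidean_product_topology)

lemma compact_box: "compact (conn_box N B)"
proof -
  have "conn_box N B = (\<Pi>\<^sub>E i\<in>UNIV. if i < N then {-B..B} else {0})"
    unfolding conn_box_def PiE_UNIV_domain by (auto simp: Pi_iff abs_le_iff minus_le_iff split: if_splits)
  moreover have "compactin (product_topology (\<lambda>_::nat. euclidean :: real topology) UNIV) \<dots>"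
    by (subst compactin_PiE) auto
  ultimately show ?thesis by (simp add: euclidean_product_topology)
qed

lemma connective_bounded:
  assumes "continuous_on UNIV u"
  obtains C :: real where "\<And>z. z \<in> conn_box N B \<Longrightarrow> \<bar>u z\<bar> \<le> C"
proof -
  have "bounded (u ` conn_box N B)"
    by (intro compact_imp_bounded compact_continuous_image compact_box continuous_on_subset[OF assms]) auto
  then show ?thesis using that unfolding bounded_iff by (metis image_eqI real_norm_def)
qed

text \<open>Continuity on \<open>nat \<Rightarrow> real\<close> becomes uniform on a compact box. In
  a failing sequence of pairs, the first components converge along a subsequence, and the second
  ones have the same limit, since from \<open>N\<close> on both vanish, like the default arguments
  of \<open>Conn\<close>.\<close>

lemma connective_unif_cont:
  fixes u :: "(nat \<Rightarrow> real) \<Rightarrow> real"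
  assumes u: "continuous_on UNIV u" and \<eta>: "\<eta> > 0"
  obtains \<delta> where "\<delta> > 0"
    "\<And>z z'. z \<in> conn_box N B \<Longrightarrow> z' \<in> conn_box N B \<Longrightarrow> (\<And>i. i < N \<Longrightarrow> \<bar>z i - z' i\<bar> < \<delta>) \<Longrightarrow> \<bar>u z - u z'\<bar> < \<eta>"
proof (rule ccontr)
  assume "\<not> thesis"
  then have "\<forall>\<delta>>0. \<exists>z z'. z \<in> conn_box N B \<and> z' \<in> conn_box N B \<and> (\<forall>i<N. \<bar>z i - z' i\<bar> < \<delta>) \<and> \<not> \<bar>u z - u z'\<bar> < \<eta>"
    using that by metis
  then have "\<forall>n::nat. \<exists>z z'. z \<in> conn_box N B \<and> z' \<in> conn_box N B \<and> (\<forall>i<N. \<bar>z i - z' i\<bar> < inverse (real (Suc n))) \<and> \<not> \<bar>u z - u z'\<bar> < \<eta>"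
    by simp
  then obtain z z' where z: "\<And>n::nat. z n \<in> conn_box N B" "\<And>n. z' n \<in> conn_box N B"
    "\<And>n i. i < N \<Longrightarrow> \<bar>z n i - z' n i\<bar> < inverse (real (Suc n))" "\<And>n. \<not> \<bar>u (z n) - u (z' n)\<bar> < \<eta>"
    by metis
  obtain l r where r: "strict_mono (r :: nat \<Rightarrow> nat)" "(z \<circ> r) \<longlonglongrightarrow> l"
    using compact_box[of N B] z(1) unfolding compact_eq_seq_compact_metric seq_compact_def by metis
  have "(\<lambda>n. z' (r n) i) \<longlonglongrightarrow> l i" for i
  proof (rule Lim_transform2[where f = "\<lambda>n. z (r n) i"])
    show "(\<lambda>n. z (r n) i) \<longlonglongrightarrow> l i" using r(2) by (simp add: LIMSEQ_fun_iff)
    have *: "\<bar>z n i - z' n i\<bar> \<le> inverse (real (Suc n))" for n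
    proof (cases "i < N")
      case True
      show ?thesis using z(3)[of i n, OF True] by (rule less_imp_le)
    next
      case False
      then have "z n i = 0" "z' n i = 0" using z(1,2)[of n] by (auto simp: conn_box_def)
      then show ?thesis by simp
    qed
    show "(\<lambda>n. z (r n) i - z' (r n) i) \<longlonglongrightarrow> 0"
    proof (rule tendsto_0_le[where K = 1])
      show "(\<lambda>n. inverse (real (Suc (r n)))) \<longlonglongrightarrow> 0"
        using LIMSEQ_subseq_LIMSEQ[OF LIMSEQ_inverse_real_of_nat r(1)] by (simp add: o_def)
    qed (use * in simp)
  qed
  then have r': "(z' \<circ> r) \<longlonglongrightarrow> l" by (simp add: LIMSEQ_fun_iff)
  have c: "isCont u l" using u by (simp add: continuous_on_eq_continuous_at)
  have "(\<lambda>n. u ((z \<circ> r) n) - u ((z' \<circ> r) n)) \<longlonglongrightarrow> u l - u l"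
    by (intro tendsto_diff isCont_tendsto_compose[OF c] r(2) r')
  then have "(\<lambda>n. u ((z \<circ> r) n) - u ((z' \<circ> r) n)) \<longlonglongrightarrow> 0" by simp
  then have "eventually (\<lambda>n. \<bar>u ((z \<circ> r) n) - u ((z' \<circ> r) n)\<bar> < \<eta>) sequentially"
    using \<eta> by (simp add: tendsto_iff)
  then show False using z(4) by (auto simp: eventually_sequentially)
qed

lemma mdist_self [simp]: "x \<in> mspace X \<Longrightarrow> mdist X x x = 0"
  using mdist_zero by metis

section \<open>Bounds and moduli of continuity of formulas\<close>

definition seqs :: "('a, 'r) mstructure \<Rightarrow> (nat \<Rightarrow> 'a) set" where
  "seqs A = {s. range s \<subseteq> mspace (universe A)}"

lemma seqs_D [simp]: "s \<in> seqs A \<Longrightarrow> s i \<in> mspace (universe A)"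
  by (auto simp: seqs_def)

lemma seqs_I: "(\<And>i. s i \<in> mspace (universe A)) \<Longrightarrow> s \<in> seqs A"
  by (auto simp: seqs_def)

lemma seqs_upd [simp]: "s \<in> seqs A \<Longrightarrow> x \<in> mspace (universe A) \<Longrightarrow> s(i := x) \<in> seqs A"
  by (rule seqs_I) simp

lemma seqs_comp [simp]: "s \<in> seqs A \<Longrightarrow> s \<circ> \<pi> \<in> seqs A"
  by (rule seqs_I) simp

lemma seqs_comp' [simp]: "s \<in> seqs A \<Longrightarrow> (\<lambda>i. s (\<pi> i)) \<in> seqs A"
  by (rule seqs_I) simp

definition conn_arg :: "('a, 'r) mstructure \<Rightarrow> 'r formula list \<Rightarrow> (nat \<Rightarrow> 'a) \<Rightarrow> nat \<Rightarrow> real" where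
  "conn_arg A \<phi>s s = (\<lambda>i. if i < length \<phi>s then eval A (\<phi>s ! i) s else 0)"

lemma eval_Conn: "eval A (Conn u \<phi>s) s = u (conn_arg A \<phi>s s)"
proof -
  have "(\<lambda>i. if i < length \<phi>s then (map (eval A) \<phi>s ! i) s else 0) = conn_arg A \<phi>s s"
    by (auto simp: conn_arg_def)
  then show ?thesis by (simp only: eval.simps)
qed

lemma list_bound:
  fixes f :: "'b \<Rightarrow> 'c \<Rightarrow> real"
  assumes "\<And>x. x \<in> set xs \<Longrightarrow> \<exists>B. \<forall>y\<in>Y. \<bar>f x y\<bar> \<le> B"
  obtains B where "\<And>x y. x \<in> set xs \<Longrightarrow> y \<in> Y \<Longrightarrow> \<bar>f x y\<bar> \<le> B"
proof -
  have "\<exists>B. \<forall>x\<in>set xs. \<forall>y\<in>Y. \<bar>f x y\<bar> \<le> B" using assms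
  proof (induction xs)
    case (Cons x xs)
    then obtain B where B: "\<forall>x\<in>set xs. \<forall>y\<in>Y. \<bar>f x y\<bar> \<le> B" by auto
    obtain C where "\<forall>y\<in>Y. \<bar>f x y\<bar> \<le> C" using Cons.prems by auto
    with B show ?case by (intro exI[of _ "max B C"]) (auto simp: le_max_iff_disj)
  qed auto
  then show ?thesis using that by blast
qed

lemma abs_cSUP_le:
  fixes f :: "'b \<Rightarrow> real"
  assumes "X \<noteq> {}" "\<And>x. x \<in> X \<Longrightarrow> \<bar>f x\<bar> \<le> B"
  shows "\<bar>SUP x\<in>X. f x\<bar> \<le> B" "\<bar>INF x\<in>X. f x\<bar> \<le> B"
  using assms by (auto intro!: cSup_abs_le cInf_abs_ge)

text \<open>Real suprema and infima behave well for bounded families, which is why the bound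
  \<open>B\<close> accompanies the error \<open>e\<close>.\<close>

lemma abs_diff_cSUP_le:
  fixes f :: "'b \<Rightarrow> real"
  assumes X: "X \<noteq> {}" and B: "\<And>x. x \<in> X \<Longrightarrow> \<bar>f x\<bar> \<le> B" "\<And>x. x \<in> X \<Longrightarrow> \<bar>g x\<bar> \<le> B"
    and e: "\<And>x. x \<in> X \<Longrightarrow> \<bar>f x - g x\<bar> \<le> e"
  shows "\<bar>(SUP x\<in>X. f x) - (SUP x\<in>X. g x)\<bar> \<le> e" "\<bar>(INF x\<in>X. f x) - (INF x\<in>X. g x)\<bar> \<le> e"
proof -
  have bd: "bdd_above (f ` X)" "bdd_above (g ` X)" "bdd_below (f ` X)" "bdd_below (g ` X)"
    using B by (auto intro!: bdd_aboveI2[where M = B] bdd_belowI2[where m = "-B"] simp: abs_le_iff)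
      (smt (verit))+
  have "(SUP x\<in>X. f x) \<le> (SUP x\<in>X. g x) + e"
  proof (rule cSUP_least[OF X])
    fix x assume x: "x \<in> X"
    show "f x \<le> (SUP x\<in>X. g x) + e" using cSUP_upper[OF x bd(2)] e[OF x] by linarith
  qed
  moreover have "(SUP x\<in>X. g x) \<le> (SUP x\<in>X. f x) + e"
  proof (rule cSUP_least[OF X])
    fix x assume x: "x \<in> X"
    show "g x \<le> (SUP x\<in>X. f x) + e" using cSUP_upper[OF x bd(1)] e[OF x] by linarith
  qed
  ultimately show "\<bar>(SUP x\<in>X. f x) - (SUP x\<in>X. g x)\<bar> \<le> e" by linarith
  have "(INF x\<in>X. f x) - e \<le> (INF x\<in>X. g x)"
  proof (rule cINF_greatest[OF X])
    fix x assume x: "x \<in> X"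
    show "(INF x\<in>X. f x) - e \<le> g x" using cINF_lower[OF bd(3) x] e[OF x] by linarith
  qed
  moreover have "(INF x\<in>X. g x) - e \<le> (INF x\<in>X. f x)"
  proof (rule cINF_greatest[OF X])
    fix x assume x: "x \<in> X"
    show "(INF x\<in>X. g x) - e \<le> f x" using cINF_lower[OF bd(4) x] e[OF x] by linarith
  qed
  ultimately show "\<bar>(INF x\<in>X. f x) - (INF x\<in>X. g x)\<bar> \<le> e" by linarith
qed

text \<open>This makes the suprema and infima in \<open>eval\<close> genuine. For a connective, the
  bounds of the arguments confine them to a compact box, where \<open>u\<close> is bounded.\<close>

lemma formula_bounded:
  assumes A: "metric_structure L A" and "is_formula L \<phi>"
  shows "\<exists>B. \<forall>s\<in>seqs A. \<bar>eval A \<phi> s\<bar> \<le> B"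
  using assms(2)
proof (induction \<phi>)
  case (Dist i j)
  obtain B where "\<forall>x\<in>mspace (universe A). \<forall>y\<in>mspace (universe A). mdist (universe A) x y \<le> B"
    using A unfolding metric_structure_def by blast
  then show ?case by (intro exI[of _ B]) simp
next
  case (Pred P vs)
  then have "bounded (interp A P ` tuples (universe A) (arity L P))"
    using A unfolding metric_structure_def predicate_on_def by auto
  then obtain B where "\<forall>xs\<in>tuples (universe A) (arity L P). \<bar>interp A P xs\<bar> \<le> B"
    unfolding bounded_iff by auto
  moreover have "map s vs \<in> tuples (universe A) (arity L P)" if "s \<in> seqs A" for s
    using that Pred by (auto simp: tuples_def)
  ultimately show ?case by (intro exI[of _ B]) simp
next
  case (Conn u \<phi>s)
  then have "continuous_on UNIV u" "\<And>\<phi>. \<phi> \<in> set \<phi>s \<Longrightarrow> \<exists>B. \<forall>s\<in>seqs A. \<bar>eval A \<phi> s\<bar> \<le> B"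
    unfolding is_formula_Conn by auto
  then obtain B where B: "\<And>\<phi> s. \<phi> \<in> set \<phi>s \<Longrightarrow> s \<in> seqs A \<Longrightarrow> \<bar>eval A \<phi> s\<bar> \<le> B"
    using list_bound[of \<phi>s "seqs A" "eval A"] by blast
  obtain C where "\<And>z. z \<in> conn_box (length \<phi>s) B \<Longrightarrow> \<bar>u z\<bar> \<le> C"
    using connective_bounded \<open>continuous_on UNIV u\<close> by blast
  moreover have "conn_arg A \<phi>s s \<in> conn_box (length \<phi>s) B" if "s \<in> seqs A" for s
    using B that by (auto simp: conn_box_def conn_arg_def)
  ultimately show ?case unfolding eval_Conn by blast
next
  case (SupF i \<phi>)
  then obtain B where B: "\<forall>s\<in>seqs A. \<bar>eval A \<phi> s\<bar> \<le> B" by auto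
  have "mspace (universe A) \<noteq> {}" using A by (simp add: metric_structure_def)
  then show ?case using B by (intro exI[of _ B]) (auto intro!: abs_cSUP_le)
next
  case (InfF i \<phi>)
  then obtain B where B: "\<forall>s\<in>seqs A. \<bar>eval A \<phi> s\<bar> \<le> B" by auto
  have "mspace (universe A) \<noteq> {}" using A by (simp add: metric_structure_def)
  then show ?case using B by (intro exI[of _ B]) (auto intro!: abs_cSUP_le)
qed

lemma formulas_bounded:
  assumes "metric_structure L A" "\<forall>\<phi>\<in>set \<phi>s. is_formula L \<phi>"
  obtains B where "\<And>s. s \<in> seqs A \<Longrightarrow> conn_arg A \<phi>s s \<in> conn_box (length \<phi>s) B"
proof -
  obtain B where B: "\<And>\<phi> s. \<phi> \<in> set \<phi>s \<Longrightarrow> s \<in> seqs A \<Longrightarrow> \<bar>eval A \<phi> s\<bar> \<le> B"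
    using list_bound[of \<phi>s "seqs A" "eval A"] formula_bounded assms by metis
  then have "conn_arg A \<phi>s s \<in> conn_box (length \<phi>s) B" if "s \<in> seqs A" for s
    using that by (auto simp: conn_box_def conn_arg_def)
  then show ?thesis using that by blast
qed

lemma list_common_delta:
  fixes Q :: "'b \<Rightarrow> real \<Rightarrow> bool"
  assumes "\<And>x. x \<in> set xs \<Longrightarrow> \<exists>\<delta>>0. Q x \<delta>" "\<And>x \<delta> \<delta>'. Q x \<delta> \<Longrightarrow> 0 < \<delta>' \<Longrightarrow> \<delta>' \<le> \<delta> \<Longrightarrow> Q x \<delta>'"
  shows "\<exists>\<delta>>0. \<forall>x\<in>set xs. Q x \<delta>"
  using assms(1)
proof (induction xs)
  case Nil
  then show ?case by (auto intro: exI[of _ 1])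
next
  case (Cons x xs)
  then obtain \<delta> where "\<delta> > 0" "\<forall>x\<in>set xs. Q x \<delta>" by auto
  moreover obtain \<delta>' where "\<delta>' > 0" "Q x \<delta>'" using Cons.prems by auto
  ultimately show ?case
    by (intro exI[of _ "min \<delta> \<delta>'"])
      (auto intro: assms(2)[of _ \<delta> "min \<delta> \<delta>'"] assms(2)[of _ \<delta>' "min \<delta> \<delta>'"])
qed

text \<open>A supremum of strict inequalities is only a weak one; the induction below therefore
  applies this with half of the desired error. The bound variable takes the same value on both sides
  and costs nothing.\<close>

lemma quantifier_unif_cont:
  assumes A: "metric_structure L A" and fm: "is_formula L \<phi>" and \<delta>: "\<delta> > 0" "\<forall>s\<in>seqs A. \<forall>s'\<in>seqs A.
      (\<forall>i\<in>free_vars \<phi>. mdist (universe A) (s i) (s' i) < \<delta>) \<longrightarrow> \<bar>eval A \<phi> s - eval A \<phi> s'\<bar> < \<eta>"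
    and s: "s \<in> seqs A" "s' \<in> seqs A" "\<forall>j\<in>free_vars \<phi> - {i}. mdist (universe A) (s j) (s' j) < \<delta>"
  shows "\<bar>eval A (SupF i \<phi>) s - eval A (SupF i \<phi>) s'\<bar> \<le> \<eta>"
    and "\<bar>eval A (InfF i \<phi>) s - eval A (InfF i \<phi>) s'\<bar> \<le> \<eta>"
proof -
  obtain B where B: "\<forall>s\<in>seqs A. \<bar>eval A \<phi> s\<bar> \<le> B" using formula_bounded[OF A fm] by blast
  have ne: "mspace (universe A) \<noteq> {}" using A by (simp add: metric_structure_def)
  have close: "\<bar>eval A \<phi> (s(i := x)) - eval A \<phi> (s'(i := x))\<bar> \<le> \<eta>" if x: "x \<in> mspace (universe A)" for x
  proof -
    have "\<forall>j\<in>free_vars \<phi>. mdist (universe A) ((s(i := x)) j) ((s'(i := x)) j) < \<delta>"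
      using s(3) \<delta>(1) x by auto
    then show ?thesis using \<delta>(2) s x by (meson less_imp_le seqs_upd)
  qed
  have bound: "\<bar>eval A \<phi> (s(i := x))\<bar> \<le> B" "\<bar>eval A \<phi> (s'(i := x))\<bar> \<le> B"
    if "x \<in> mspace (universe A)" for x
    using B s(1,2) that by simp_all
  show "\<bar>eval A (SupF i \<phi>) s - eval A (SupF i \<phi>) s'\<bar> \<le> \<eta>"
    unfolding eval.simps by (rule abs_diff_cSUP_le(1)[OF ne bound close])
  show "\<bar>eval A (InfF i \<phi>) s - eval A (InfF i \<phi>) s'\<bar> \<le> \<eta>"
    unfolding eval.simps by (rule abs_diff_cSUP_le(2)[OF ne bound close])
qed

lemma formula_unif_cont:
  assumes A: "metric_structure L A" and "is_formula L \<phi>" and "\<eta> > 0"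
  shows "\<exists>\<delta>>0. \<forall>s\<in>seqs A. \<forall>s'\<in>seqs A.
    (\<forall>i\<in>free_vars \<phi>. mdist (universe A) (s i) (s' i) < \<delta>) \<longrightarrow> \<bar>eval A \<phi> s - eval A \<phi> s'\<bar> < \<eta>"
  using assms(2,3)
proof (induction \<phi> arbitrary: \<eta>)
  case (Dist i j)
  have "\<bar>mdist (universe A) (s i) (s j) - mdist (universe A) (s' i) (s' j)\<bar> < \<eta>"
    if s: "s \<in> seqs A" "s' \<in> seqs A"
      and "mdist (universe A) (s i) (s' i) < \<eta>/2" "mdist (universe A) (s j) (s' j) < \<eta>/2" for s s'
  proof -
    have "mdist (universe A) (s i) (s j) \<le> mdist (universe A) (s i) (s' i) + mdist (universe A) (s' i) (s j)"
      "mdist (universe A) (s' i) (s j) \<le> mdist (universe A) (s' i) (s' j) + mdist (universe A) (s' j) (s j)"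
      "mdist (universe A) (s' i) (s' j) \<le> mdist (universe A) (s' i) (s i) + mdist (universe A) (s i) (s' j)"
      "mdist (universe A) (s i) (s' j) \<le> mdist (universe A) (s i) (s j) + mdist (universe A) (s j) (s' j)"
      using s by (auto intro!: mdist_triangle)
    then show ?thesis using that(3,4) mdist_commute[of "universe A"] by (smt (verit) field_sum_of_halves)
  qed
  then show ?case using Dist by (intro exI[of _ "\<eta>/2"]) auto
next
  case (Pred P vs)
  then have P: "predicate_on (universe A) (arity L P) (interp A P)" "length vs = arity L P"
    using A by (auto simp: metric_structure_def)
  obtain \<delta> where \<delta>: "\<delta> > 0" "\<forall>xs\<in>tuples (universe A) (arity L P). \<forall>ys\<in>tuples (universe A) (arity L P).
        (\<forall>i<arity L P. mdist (universe A) (xs ! i) (ys ! i) < \<delta>) \<longrightarrow> \<bar>interp A P xs - interp A P ys\<bar> < \<eta>"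
    using P(1) Pred.prems(2) unfolding predicate_on_def by meson
  have "map s vs \<in> tuples (universe A) (arity L P)" if "s \<in> seqs A" for s
    using that P by (auto simp: tuples_def)
  then show ?case using \<delta> P(2) by (intro exI[of _ \<delta>]) (auto simp: nth_mem)
next
  case (Conn u \<phi>s)
  then have u: "continuous_on UNIV u" and fm: "\<forall>\<phi>\<in>set \<phi>s. is_formula L \<phi>"
    unfolding is_formula_Conn by auto
  obtain B where B: "\<And>s. s \<in> seqs A \<Longrightarrow> conn_arg A \<phi>s s \<in> conn_box (length \<phi>s) B"
    using formulas_bounded[OF A fm] by blast
  obtain \<epsilon> where \<epsilon>: "\<epsilon> > 0" "\<And>z z'. z \<in> conn_box (length \<phi>s) B \<Longrightarrow> z' \<in> conn_box (length \<phi>s) B \<Longrightarrow>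
      (\<And>i. i < length \<phi>s \<Longrightarrow> \<bar>z i - z' i\<bar> < \<epsilon>) \<Longrightarrow> \<bar>u z - u z'\<bar> < \<eta>"
    using connective_unif_cont[OF u Conn.prems(2)] by metis
  let ?Q = "\<lambda>\<phi> \<delta>. \<forall>s\<in>seqs A. \<forall>s'\<in>seqs A.
    (\<forall>i\<in>free_vars \<phi>. mdist (universe A) (s i) (s' i) < \<delta>) \<longrightarrow> \<bar>eval A \<phi> s - eval A \<phi> s'\<bar> < \<epsilon>"
  have "\<exists>\<delta>>0. \<forall>\<phi>\<in>set \<phi>s. ?Q \<phi> \<delta>"
  proof (rule list_common_delta)
    show "\<exists>\<delta>>0. ?Q \<phi> \<delta>" if "\<phi> \<in> set \<phi>s" for \<phi> using Conn.IH that fm \<epsilon>(1) by blast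
    show "?Q \<phi> \<delta>'" if "?Q \<phi> \<delta>" "\<delta>' \<le> \<delta>" for \<phi> \<delta> \<delta>' using that by (meson less_le_trans)
  qed
  then obtain \<delta> where \<delta>: "\<delta> > 0" "\<And>\<phi>. \<phi> \<in> set \<phi>s \<Longrightarrow> ?Q \<phi> \<delta>" by blast
  show ?case
  proof (intro exI[of _ \<delta>] conjI ballI impI \<delta>(1))
    fix s s' assume s: "s \<in> seqs A" "s' \<in> seqs A"
      and d: "\<forall>i\<in>free_vars (Conn u \<phi>s). mdist (universe A) (s i) (s' i) < \<delta>"
    show "\<bar>eval A (Conn u \<phi>s) s - eval A (Conn u \<phi>s) s'\<bar> < \<eta>"
      unfolding eval_Conn
    proof (intro \<epsilon>(2) B s)
      fix i assume i: "i < length \<phi>s"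
      then have "\<phi>s ! i \<in> set \<phi>s" by simp
      then have "\<bar>eval A (\<phi>s ! i) s - eval A (\<phi>s ! i) s'\<bar> < \<epsilon>" using \<delta>(2) s d by fastforce
      then show "\<bar>conn_arg A \<phi>s s i - conn_arg A \<phi>s s' i\<bar> < \<epsilon>" using i by (simp add: conn_arg_def)
    qed
  qed
next
  case (SupF i \<phi>)
  then have fm: "is_formula L \<phi>" and h: "\<eta>/2 > 0" by auto
  obtain \<delta> where \<delta>: "\<delta> > 0" "\<forall>s\<in>seqs A. \<forall>s'\<in>seqs A.
    (\<forall>i\<in>free_vars \<phi>. mdist (universe A) (s i) (s' i) < \<delta>) \<longrightarrow> \<bar>eval A \<phi> s - eval A \<phi> s'\<bar> < \<eta>/2"
    using SupF.IH[OF fm h] by blast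
  show ?case
  proof (intro exI[of _ \<delta>] conjI ballI impI \<delta>(1))
    fix s s' assume s: "s \<in> seqs A" "s' \<in> seqs A"
      and "\<forall>j\<in>free_vars (SupF i \<phi>). mdist (universe A) (s j) (s' j) < \<delta>"
    then have "\<bar>eval A (SupF i \<phi>) s - eval A (SupF i \<phi>) s'\<bar> \<le> \<eta>/2"
      by (intro quantifier_unif_cont(1)[OF A fm \<delta>]) simp_all
    then show "\<bar>eval A (SupF i \<phi>) s - eval A (SupF i \<phi>) s'\<bar> < \<eta>" using SupF.prems(2) by linarith
  qed
next
  case (InfF i \<phi>)
  then have fm: "is_formula L \<phi>" and h: "\<eta>/2 > 0" by auto
  obtain \<delta> where \<delta>: "\<delta> > 0" "\<forall>s\<in>seqs A. \<forall>s'\<in>seqs A.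
    (\<forall>i\<in>free_vars \<phi>. mdist (universe A) (s i) (s' i) < \<delta>) \<longrightarrow> \<bar>eval A \<phi> s - eval A \<phi> s'\<bar> < \<eta>/2"
    using InfF.IH[OF fm h] by blast
  show ?case
  proof (intro exI[of _ \<delta>] conjI ballI impI \<delta>(1))
    fix s s' assume s: "s \<in> seqs A" "s' \<in> seqs A"
      and "\<forall>j\<in>free_vars (InfF i \<phi>). mdist (universe A) (s j) (s' j) < \<delta>"
    then have "\<bar>eval A (InfF i \<phi>) s - eval A (InfF i \<phi>) s'\<bar> \<le> \<eta>/2"
      by (intro quantifier_unif_cont(2)[OF A fm \<delta>]) simp_all
    then show "\<bar>eval A (InfF i \<phi>) s - eval A (InfF i \<phi>) s'\<bar> < \<eta>" using InfF.prems(2) by linarith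
  qed
qed

section \<open>Separability of the space of formulas\<close>

lemma separable_continuous_functions:
  fixes K :: "'a::second_countable_topology set"
  assumes "compact K"
  shows "\<exists>F :: ('a \<Rightarrow> real) set. countable F \<and> (\<forall>u\<in>F. continuous_on UNIV u) \<and>
    (\<forall>u \<eta>. continuous_on UNIV u \<and> \<eta> > 0 \<longrightarrow> (\<exists>v\<in>F. \<forall>z\<in>K. \<bar>u z - v z\<bar> \<le> \<eta>))"
proof -
  obtain \<B> :: "'a set set" where \<B>: "countable \<B>" "topological_basis \<B>"
    using ex_countable_basis by blast
  \<comment> \<open>A finite cover by basic sets, each with a rational value, describes a function on \<open>K\<close>
    up to a prescribed error; it suffices to pick one function for each description.\<close>
  define fits where "fits n T u \<longleftrightarrow> continuous_on UNIV u \<and> K \<subseteq> \<Union> (fst ` T) \<and>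
      (\<forall>(b, q)\<in>T. \<forall>z\<in>b. \<bar>u z - q\<bar> < 1 / Suc n)" for n and T :: "('a set \<times> real) set" and u
  define \<T> :: "('a set \<times> real) set set" where "\<T> = {T. finite T \<and> T \<subseteq> \<B> \<times> \<rat>}"
  define F where "F = (\<lambda>(n, T). SOME u. fits n T u) ` {(n :: nat, T). T \<in> \<T> \<and> (\<exists>u. fits n T u)}"
  have "countable \<T>" unfolding \<T>_def
    by (intro countable_Collect_finite_subset countable_SIGMA \<B>(1) countable_rat)
  then have "countable ((UNIV :: nat set) \<times> \<T>)" by (intro countable_SIGMA) auto
  then have "countable {(n :: nat, T). T \<in> \<T> \<and> (\<exists>u. fits n T u)}"
    by (rule countable_subset[rotated]) auto
  then have "countable F" unfolding F_def by (rule countable_image)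
  moreover have "continuous_on UNIV u" if uF: "u \<in> F" for u
  proof -
    obtain p where p: "u = (case p of (n, T) \<Rightarrow> SOME u. fits n T u)" "p \<in> {(n, T). T \<in> \<T> \<and> (\<exists>u. fits n T u)}"
      using uF unfolding F_def by (rule imageE)
    then have "fits (fst p) (snd p) u" by (cases p) (use p in \<open>auto, metis someI\<close>)
    then show ?thesis by (simp add: fits_def)
  qed
  moreover have "\<exists>v\<in>F. \<forall>z\<in>K. \<bar>u z - v z\<bar> \<le> \<eta>" if u: "continuous_on UNIV u" and \<eta>: "\<eta> > 0" for u \<eta>
  proof -
    obtain n where n: "1 / Suc n < \<eta>/2" using \<eta> by (meson half_gt_zero nat_approx_posE)
    have "\<exists>b q. b \<in> \<B> \<and> q \<in> \<rat> \<and> z \<in> b \<and> (\<forall>w\<in>b. \<bar>u w - q\<bar> < 1 / Suc n)" for z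
    proof -
      obtain q where q: "q \<in> \<rat>" "u z < q" "q < u z + 1 / Suc n"
        using Rats_dense_in_real[of "u z" "u z + 1 / Suc n"] by auto
      have "open (u -` {q - 1 / Suc n<..<q + 1 / Suc n})"
        using u by (intro open_vimage) auto
      moreover have "z \<in> u -` {q - 1 / Suc n<..<q + 1 / Suc n}" using q by auto
      ultimately obtain b where "b \<in> \<B>" "z \<in> b" "b \<subseteq> u -` {q - 1 / Suc n<..<q + 1 / Suc n}"
        using topological_basisE[OF \<B>(2)] by metis
      then show ?thesis using q(1) by (intro exI[of _ b] exI[of _ q]) (auto simp: abs_less_iff)
    qed
    then obtain b q where bq: "\<And>z. b z \<in> \<B>" "\<And>z. q z \<in> \<rat>" "\<And>z. z \<in> b z"
      "\<And>z w. w \<in> b z \<Longrightarrow> \<bar>u w - q z\<bar> < 1 / Suc n"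
      by metis
    have "open (b z)" for z using bq(1) \<B>(2) by (simp add: topological_basis_open)
    then obtain Z where Z: "Z \<subseteq> K" "finite Z" "K \<subseteq> (\<Union>z\<in>Z. b z)"
      using compactE_image[OF assms, of K b] bq(3) by (metis UN_iff subsetI)
    define T where "T = (\<lambda>z. (b z, q z)) ` Z"
    have "K \<subseteq> \<Union> (fst ` T)" using Z(3) by (simp add: T_def image_image)
    then have "fits n T u" using bq(4) u unfolding fits_def T_def by blast
    moreover have "T \<in> \<T>" using Z bq unfolding \<T>_def T_def by auto
    ultimately have "(n, T) \<in> {(n, T). T \<in> \<T> \<and> (\<exists>u. fits n T u)}" by blast
    then have "(\<lambda>(n, T). SOME u. fits n T u) (n, T) \<in> F" unfolding F_def by (rule imageI)
    then have v: "(SOME u. fits n T u) \<in> F" "fits n T (SOME u. fits n T u)"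
      using someI[of "fits n T", OF \<open>fits n T u\<close>] by simp_all
    show ?thesis
    proof (rule bexI[OF _ v(1)], rule ballI)
      fix z assume "z \<in> K"
      then obtain c p where "(c, p) \<in> T" "z \<in> c" using v(2) unfolding fits_def by auto
      \<comment> \<open>Functions with the same description differ by less than twice
        \<open>1 / Suc n\<close>, which was chosen below \<open>\<eta>/2\<close>.\<close>
      then have "\<bar>u z - p\<bar> < 1 / Suc n" "\<bar>(SOME u. fits n T u) z - p\<bar> < 1 / Suc n"
        using v(2) \<open>fits n T u\<close> unfolding fits_def by blast+
      then show "\<bar>u z - (SOME u. fits n T u) z\<bar> \<le> \<eta>" using n by linarith
    qed
  qed
  ultimately show ?thesis by blast
qed

text \<open>Two languages are allowed, because formulas of \<open>L\<close> are compared with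
  formulas of an interdefinable structure whose symbols are natural numbers; in use, the universes
  agree.\<close>

definition near :: "('a, 'r) mstructure \<Rightarrow> 'r formula \<Rightarrow> ('a, 's) mstructure \<Rightarrow> 's formula \<Rightarrow> real \<Rightarrow> bool" where
  "near A \<phi> B \<psi> \<epsilon> \<longleftrightarrow> (\<forall>s\<in>seqs A. \<bar>eval A \<phi> s - eval B \<psi> s\<bar> \<le> \<epsilon>)"

lemma near_SupF_InfF:
  assumes "metric_structure L A" "metric_structure L' B" "universe A = universe B"
    "is_formula L \<phi>" "is_formula L' \<psi>" "near A \<phi> B \<psi> \<epsilon>"
  shows "near A (SupF i \<phi>) B (SupF i \<psi>) \<epsilon>" "near A (InfF i \<phi>) B (InfF i \<psi>) \<epsilon>"
proof -
  obtain C where C: "\<forall>s\<in>seqs A. \<bar>eval A \<phi> s\<bar> \<le> C" using formula_bounded assms by blast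
  obtain D where D: "\<forall>s\<in>seqs B. \<bar>eval B \<psi> s\<bar> \<le> D" using formula_bounded assms by blast
  have AB: "seqs A = seqs B" using assms by (simp add: seqs_def)
  have ne: "mspace (universe B) \<noteq> {}" using assms by (simp add: metric_structure_def)
  have *: "\<bar>eval A \<phi> (s(i := x))\<bar> \<le> max C D" "\<bar>eval B \<psi> (s(i := x))\<bar> \<le> max C D"
    "\<bar>eval A \<phi> (s(i := x)) - eval B \<psi> (s(i := x))\<bar> \<le> \<epsilon>"
    if "s \<in> seqs B" "x \<in> mspace (universe B)" for s x
    using C D assms(6) that unfolding near_def AB by (auto simp: le_max_iff_disj)
  show "near A (SupF i \<phi>) B (SupF i \<psi>) \<epsilon>" "near A (InfF i \<phi>) B (InfF i \<psi>) \<epsilon>"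
    unfolding near_def AB eval.simps assms(3)
    by (intro ballI abs_diff_cSUP_le[OF ne, where B = "max C D"]; simp add: *)+
qed

text \<open>The predicate \<open>Q\<close> is left open to serve both the translation between
  languages and the countable dense set of formulas. The latter needs a box for the new arguments
  from a countable supply, hence the natural number \<open>C\<close>.\<close>

lemma near_Conn:
  assumes A: "metric_structure L A" and AB: "universe A = universe B"
    and u: "continuous_on UNIV u" and fm: "\<And>\<phi>. \<phi> \<in> set \<phi>s \<Longrightarrow> is_formula L \<phi>"
    and Q: "\<And>\<phi> \<epsilon>. \<phi> \<in> set \<phi>s \<Longrightarrow> \<epsilon> > 0 \<Longrightarrow> \<exists>\<psi>. Q \<psi> \<and> near A \<phi> B \<psi> \<epsilon>"
    and \<epsilon>: "\<epsilon> > 0"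
  obtains \<psi>s C where "\<forall>\<psi>\<in>set \<psi>s. Q \<psi>" "length \<psi>s = length \<phi>s" "near A (Conn u \<phi>s) B (Conn u \<psi>s) \<epsilon>"
    "\<And>s. s \<in> seqs A \<Longrightarrow> conn_arg B \<psi>s s \<in> conn_box (length \<phi>s) (real C)"
proof -
  obtain B0 where B0: "\<And>s. s \<in> seqs A \<Longrightarrow> conn_arg A \<phi>s s \<in> conn_box (length \<phi>s) B0"
    using formulas_bounded[OF A, of \<phi>s] fm by blast
  obtain C :: nat where C: "B0 + 1 \<le> real C" using real_arch_simple by blast
  obtain \<delta> where \<delta>: "\<delta> > 0" "\<And>z z'. z \<in> conn_box (length \<phi>s) C \<Longrightarrow> z' \<in> conn_box (length \<phi>s) C \<Longrightarrow>
      (\<And>i. i < length \<phi>s \<Longrightarrow> \<bar>z i - z' i\<bar> < \<delta>) \<Longrightarrow> \<bar>u z - u z'\<bar> < \<epsilon>"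
    using connective_unif_cont[OF u \<epsilon>] by metis
  \<comment> \<open>The half turns a weak bound by \<open>\<gamma>\<close> into a strict one by
    \<open>\<delta>\<close>; the 1 keeps the new arguments in the box of size
    \<open>B0 + 1 \<le> C\<close>.\<close>
  define \<gamma> where "\<gamma> = min (\<delta>/2) 1"
  have \<gamma>: "\<gamma> > 0" "\<gamma> < \<delta>" "\<gamma> \<le> 1" using \<delta>(1) by (auto simp: \<gamma>_def min_def)
  have "\<forall>\<phi>\<in>set \<phi>s. \<exists>\<psi>. Q \<psi> \<and> near A \<phi> B \<psi> \<gamma>" using Q \<gamma>(1) by blast
  then obtain h where h: "\<And>\<phi>. \<phi> \<in> set \<phi>s \<Longrightarrow> Q (h \<phi>) \<and> near A \<phi> B (h \<phi>) \<gamma>"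
    by (auto dest!: bchoice)
  have close: "\<bar>conn_arg A \<phi>s s i - conn_arg B (map h \<phi>s) s i\<bar> \<le> \<gamma>" if "s \<in> seqs A" for s i
    using h \<gamma>(1) that by (auto simp: conn_arg_def near_def)
  have arg: "conn_arg A \<phi>s s \<in> conn_box (length \<phi>s) C"
    "conn_arg B (map h \<phi>s) s \<in> conn_box (length \<phi>s) C" if "s \<in> seqs A" for s
  proof -
    have "\<bar>conn_arg B (map h \<phi>s) s i\<bar> \<le> C \<and> \<bar>conn_arg A \<phi>s s i\<bar> \<le> C" if "i < length \<phi>s" for i
    proof -
      have "\<bar>conn_arg A \<phi>s s i\<bar> \<le> B0" using B0[OF \<open>s \<in> seqs A\<close>] that by (simp add: conn_box_def)
      then show ?thesis using close[OF \<open>s \<in> seqs A\<close>, of i] C \<gamma>(3) by linarith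
    qed
    then show "conn_arg A \<phi>s s \<in> conn_box (length \<phi>s) C"
      "conn_arg B (map h \<phi>s) s \<in> conn_box (length \<phi>s) C"
      by (auto simp: conn_box_def conn_arg_def)
  qed
  show ?thesis
  proof (rule that[of "map h \<phi>s" C])
    show "near A (Conn u \<phi>s) B (Conn u (map h \<phi>s)) \<epsilon>"
      unfolding near_def eval_Conn
      by (intro ballI less_imp_le \<delta>(2) arg) (use close \<gamma>(2) in \<open>fastforce intro: le_less_trans\<close>)+
  qed (use h arg in auto)
qed

lemma definable_formulas:
  assumes A: "metric_structure L A" and B: "metric_structure L' B" and AB: "universe A = universe B"
    and def: "\<And>P. P \<in> symbols L \<Longrightarrow> definable_predicate L' B (arity L P) (interp A P)"
  shows "is_formula L \<phi> \<Longrightarrow> \<epsilon> > 0 \<Longrightarrow> \<exists>\<psi>. is_formula L' \<psi> \<and> near A \<phi> B \<psi> \<epsilon>"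
proof (induction \<phi> arbitrary: \<epsilon>)
  case (Dist i j)
  then show ?case using AB by (intro exI[of _ "Dist i j"]) (simp add: near_def)
next
  case (Pred P vs)
  then have P: "P \<in> symbols L" "length vs = arity L P" by auto
  obtain \<psi> where \<psi>: "is_formula L' \<psi>" "free_vars \<psi> \<subseteq> {..<arity L P}"
    "\<And>xs. xs \<in> tuples (universe B) (arity L P) \<Longrightarrow> \<bar>interp A P xs - eval B \<psi> (\<lambda>i. xs ! i)\<bar> \<le> \<epsilon>"
    using def[OF P(1)] Pred.prems(2) unfolding definable_predicate_def by metis
  obtain \<psi>' where \<psi>': "is_formula L' \<psi>'" "\<And>s. eval B \<psi>' s = eval B \<psi> (s \<circ> (\<lambda>i. vs ! i))"
    using formula_rename[OF \<psi>(1)] by metis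
  have "\<bar>eval A (Pred P vs) s - eval B \<psi>' s\<bar> \<le> \<epsilon>" if "s \<in> seqs A" for s
  proof -
    have "map s vs \<in> tuples (universe B) (arity L P)"
      using that P unfolding AB[symmetric] by (auto simp: tuples_def)
    moreover have "eval B \<psi> (\<lambda>i. map s vs ! i) = eval B \<psi>' s"
      unfolding \<psi>'(2) by (rule eval_cong) (use \<psi>(2) P(2) in auto)
    ultimately show ?thesis using \<psi>(3)[of "map s vs"] by simp
  qed
  then show ?case using \<psi>'(1) by (auto simp: near_def)
next
  case (Conn u \<phi>s)
  then have u: "continuous_on UNIV u" and fm: "\<And>\<phi>. \<phi> \<in> set \<phi>s \<Longrightarrow> is_formula L \<phi>"
    unfolding is_formula_Conn by auto
  obtain \<psi>s where "\<forall>\<psi>\<in>set \<psi>s. is_formula L' \<psi>" "near A (Conn u \<phi>s) B (Conn u \<psi>s) \<epsilon>"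
    using near_Conn[OF A AB u fm, where Q = "is_formula L'"] Conn.IH fm Conn.prems(2) by metis
  then show ?case using u by (intro exI[of _ "Conn u \<psi>s"] conjI) (auto simp: is_formula_Conn simp del: is_formula.simps)
next
  case (SupF i \<phi>)
  then obtain \<psi> where \<psi>: "is_formula L' \<psi>" "near A \<phi> B \<psi> \<epsilon>" by auto
  have "near A (SupF i \<phi>) B (SupF i \<psi>) \<epsilon>"
    by (rule near_SupF_InfF[OF A B AB]) (use \<psi> SupF.prems in auto)
  then show ?case using \<psi> by (intro exI[of _ "SupF i \<psi>"]) simp
next
  case (InfF i \<phi>)
  then obtain \<psi> where \<psi>: "is_formula L' \<psi>" "near A \<phi> B \<psi> \<epsilon>" by auto
  have "near A (InfF i \<phi>) B (InfF i \<psi>) \<epsilon>"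
    by (rule near_SupF_InfF[OF A B AB]) (use \<psi> InfF.prems in auto)
  then show ?case using \<psi> by (intro exI[of _ "InfF i \<psi>"]) simp
qed

text \<open>Stage \<open>k\<close> collects the formulas of nesting depth at most \<open>k\<close>
  with connectives from the families \<open>F N C\<close>, each meant to be countable and uniformly
  dense on the box with parameters \<open>N\<close> and \<open>C\<close>.\<close>

primrec formulas_upto :: "('r language) \<Rightarrow> (nat \<Rightarrow> nat \<Rightarrow> ((nat \<Rightarrow> real) \<Rightarrow> real) set) \<Rightarrow> nat \<Rightarrow> 'r formula set" where
  "formulas_upto L F 0 = range (\<lambda>(i, j). Dist i j) \<union> (\<lambda>(P, vs). Pred P vs) ` {(P, vs). P \<in> symbols L \<and> length vs = arity L P}"
| "formulas_upto L F (Suc k) = formulas_upto L F k \<union>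
     (\<lambda>(u, \<phi>s). Conn u \<phi>s) ` ((\<Union>N. \<Union>C. F N C) \<times> lists (formulas_upto L F k)) \<union>
     (\<lambda>(i, \<phi>). SupF i \<phi>) ` (UNIV \<times> formulas_upto L F k) \<union>
     (\<lambda>(i, \<phi>). InfF i \<phi>) ` (UNIV \<times> formulas_upto L F k)"

lemma countable_dense_formulas:
  fixes L :: "nat language"
  assumes A: "metric_structure L A"
  obtains \<F> where "countable \<F>" "\<And>\<phi>. \<phi> \<in> \<F> \<Longrightarrow> is_formula L \<phi>"
    "\<And>\<phi> \<epsilon>. is_formula L \<phi> \<Longrightarrow> \<epsilon> > 0 \<Longrightarrow> \<exists>\<psi>\<in>\<F>. near A \<phi> A \<psi> \<epsilon>"
proof -
  have "\<exists>F :: ((nat \<Rightarrow> real) \<Rightarrow> real) set. countable F \<and> (\<forall>u\<in>F. continuous_on UNIV u) \<and>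
      (\<forall>u \<eta>. continuous_on UNIV u \<and> \<eta> > 0 \<longrightarrow> (\<exists>v\<in>F. \<forall>z\<in>conn_box N (real C). \<bar>u z - v z\<bar> \<le> \<eta>))" for N C
    by (rule separable_continuous_functions[OF compact_box])
  then obtain F :: "nat \<Rightarrow> nat \<Rightarrow> ((nat \<Rightarrow> real) \<Rightarrow> real) set" where
    F: "\<And>N C. countable (F N C)" "\<And>N C u. u \<in> F N C \<Longrightarrow> continuous_on UNIV u"
    "\<And>N C u \<eta>. continuous_on UNIV u \<Longrightarrow> \<eta> > 0 \<Longrightarrow> \<exists>v\<in>F N C. \<forall>z\<in>conn_box N (real C). \<bar>u z - v z\<bar> \<le> \<eta>"
    by metis
  let ?U = "formulas_upto L F"
  have "countable (?U k)" for k
  proof (induction k)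
    case 0
    have "countable {(P :: nat, vs :: nat list). P \<in> symbols L \<and> length vs = arity L P}"
      by (rule countable_subset[OF subset_UNIV]) (rule countableI_type)
    then show ?case unfolding formulas_upto.simps
      by (intro countable_Un countable_image) (auto intro: countableI_type)
  next
    case (Suc k)
    then show ?case unfolding formulas_upto.simps
      by (intro countable_Un countable_image countable_SIGMA countable_UN countable_lists F(1)) auto
  qed
  then have 1: "countable (\<Union>k. ?U k)" by simp
  have fm: "\<phi> \<in> ?U k \<Longrightarrow> is_formula L \<phi>" for \<phi> k
    by (induction k arbitrary: \<phi>) (auto simp: list_all_iff dest: F(2))
  have mono: "?U k \<subseteq> ?U k'" if "k \<le> k'" for k k'
    using that by (rule lift_Suc_mono_le[rotated]) auto
  have 2: "\<exists>\<psi>\<in>(\<Union>k. ?U k). near A \<phi> A \<psi> \<epsilon>" if "is_formula L \<phi>" "\<epsilon> > 0" for \<phi> \<epsilon>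
    using that
  proof (induction \<phi> arbitrary: \<epsilon>)
    case (Dist i j)
    have "Dist i j \<in> ?U 0" by auto
    moreover have "near A (Dist i j) A (Dist i j) \<epsilon>" using Dist.prems by (simp add: near_def)
    ultimately show ?case by blast
  next
    case (Pred P vs)
    then have "Pred P vs \<in> ?U 0" by auto
    moreover have "near A (Pred P vs) A (Pred P vs) \<epsilon>" using Pred.prems by (simp add: near_def)
    ultimately show ?case by blast
  next
    case (Conn u \<phi>s)
    then have u: "continuous_on UNIV u" and f: "\<And>\<phi>. \<phi> \<in> set \<phi>s \<Longrightarrow> is_formula L \<phi>"
      unfolding is_formula_Conn by auto
    have e: "\<epsilon>/2 > 0" using Conn.prems by simp
    have IH: "\<exists>\<psi>. \<psi> \<in> (\<Union>k. ?U k) \<and> near A \<phi> A \<psi> \<gamma>" if "\<phi> \<in> set \<phi>s" "\<gamma> > 0" for \<phi> \<gamma>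
      using Conn.IH[OF that(1) f[OF that(1)] that(2)] by blast
    obtain \<psi>s C where \<psi>s: "\<forall>\<psi>\<in>set \<psi>s. \<psi> \<in> (\<Union>k. ?U k)" "length \<psi>s = length \<phi>s"
      "near A (Conn u \<phi>s) A (Conn u \<psi>s) (\<epsilon>/2)"
      "\<And>s. s \<in> seqs A \<Longrightarrow> conn_arg A \<psi>s s \<in> conn_box (length \<phi>s) (real C)"
      using near_Conn[OF A refl u f IH e] by metis
    \<comment> \<open>The box has to contain the arguments coming from \<open>\<psi>s\<close>, as
      these, not those of \<open>\<phi>s\<close>, are fed to \<open>v\<close>.\<close>
    obtain v where v: "v \<in> F (length \<phi>s) C" "\<forall>z\<in>conn_box (length \<phi>s) (real C). \<bar>u z - v z\<bar> \<le> \<epsilon>/2"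
      using F(3)[OF u e] by blast
    obtain h where h: "\<And>\<psi>. \<psi> \<in> set \<psi>s \<Longrightarrow> \<psi> \<in> ?U (h \<psi>)" using \<psi>s(1) by (metis UN_E)
    \<comment> \<open>For the empty list \<open>Max\<close> is an unspecified number, which is
      harmless.\<close>
    define k where "k = Max (h ` set \<psi>s)"
    have "set \<psi>s \<subseteq> ?U k"
    proof
      fix \<psi> assume p: "\<psi> \<in> set \<psi>s"
      then have "h \<psi> \<le> k" unfolding k_def by (intro Max_ge) auto
      then show "\<psi> \<in> ?U k" using mono h[OF p] by blast
    qed
    then have "(v, \<psi>s) \<in> (\<Union>N. \<Union>C. F N C) \<times> lists (?U k)" using v(1) by (auto simp: in_lists_conv_set)
    then have "Conn v \<psi>s \<in> ?U (Suc k)" unfolding formulas_upto.simps by force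
    moreover have "\<bar>eval A (Conn u \<phi>s) s - eval A (Conn v \<psi>s) s\<bar> \<le> \<epsilon>" if s: "s \<in> seqs A" for s
    proof -
      have "\<bar>eval A (Conn u \<phi>s) s - eval A (Conn u \<psi>s) s\<bar> \<le> \<epsilon>/2"
        using \<psi>s(3) s unfolding near_def by blast
      moreover have "\<bar>eval A (Conn u \<psi>s) s - eval A (Conn v \<psi>s) s\<bar> \<le> \<epsilon>/2"
        using v(2) \<psi>s(4)[OF s] unfolding eval_Conn by blast
      ultimately show ?thesis by linarith
    qed
    ultimately show ?case unfolding near_def by blast
  next
    case (SupF i \<phi>)
    have "\<exists>\<psi>\<in>(\<Union>k. ?U k). near A \<phi> A \<psi> \<epsilon>" using SupF.IH SupF.prems by simp
    then obtain \<psi> k where \<psi>: "\<psi> \<in> ?U k" "near A \<phi> A \<psi> \<epsilon>" by blast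
    have "near A (SupF i \<phi>) A (SupF i \<psi>) \<epsilon>"
      by (rule near_SupF_InfF[OF A A refl]) (use \<psi> SupF.prems fm in auto)
    moreover have "SupF i \<psi> \<in> ?U (Suc k)" using \<psi> by auto
    ultimately show ?case by blast
  next
    case (InfF i \<phi>)
    have "\<exists>\<psi>\<in>(\<Union>k. ?U k). near A \<phi> A \<psi> \<epsilon>" using InfF.IH InfF.prems by simp
    then obtain \<psi> k where \<psi>: "\<psi> \<in> ?U k" "near A \<phi> A \<psi> \<epsilon>" by blast
    have "near A (InfF i \<phi>) A (InfF i \<psi>) \<epsilon>"
      by (rule near_SupF_InfF[OF A A refl]) (use \<psi> InfF.prems fm in auto)
    moreover have "InfF i \<psi> \<in> ?U (Suc k)" using \<psi> by auto
    ultimately show ?case by blast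
  qed
  show ?thesis using that[OF 1] fm 2 by blast
qed

text \<open>\<open>L\<close> itself may have uncountably many symbols. For each formula in the
  countable dense set of the interdefinable language and each error \<open>1 / Suc n\<close>, one
  formula of \<open>L\<close> within that error is selected whenever there is one.\<close>

lemma countable_dense_formulas_interdef:
  assumes A: "metric_structure L A" and "countable_language_up_to_interdef L A"
  obtains \<F> where "countable \<F>" "\<And>\<phi>. \<phi> \<in> \<F> \<Longrightarrow> is_formula L \<phi>"
    "\<And>\<phi> \<epsilon>. is_formula L \<phi> \<Longrightarrow> \<epsilon> > 0 \<Longrightarrow> \<exists>\<psi>\<in>\<F>. near A \<phi> A \<psi> \<epsilon>"
proof -
  obtain L' :: "nat language" and A' where A': "metric_structure L' A'" "interdefinable L A L' A'"
    using assms(2) unfolding countable_language_up_to_interdef_def by blast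
  then have U: "universe A = universe A'" "seqs A = seqs A'" by (auto simp: interdefinable_def seqs_def)
  obtain \<G> where \<G>: "countable \<G>" "\<And>\<phi>. \<phi> \<in> \<G> \<Longrightarrow> is_formula L' \<phi>"
    "\<And>\<phi> \<epsilon>. is_formula L' \<phi> \<Longrightarrow> \<epsilon> > 0 \<Longrightarrow> \<exists>\<psi>\<in>\<G>. near A' \<phi> A' \<psi> \<epsilon>"
    using countable_dense_formulas[OF A'(1)] by blast
  define ok where "ok p \<phi> \<longleftrightarrow> is_formula L \<phi> \<and> near A \<phi> A' (fst p) (1 / Suc (snd p))" for p :: "nat formula \<times> nat" and \<phi>
  define \<F> where "\<F> = (\<lambda>p. SOME \<phi>. ok p \<phi>) ` {p \<in> \<G> \<times> UNIV. \<exists>\<phi>. ok p \<phi>}"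
  have "countable (\<G> \<times> (UNIV :: nat set))" using \<G>(1) by auto
  then have "countable {p \<in> \<G> \<times> UNIV. \<exists>\<phi>. ok p \<phi>}" by (rule countable_subset[rotated]) auto
  then have 1: "countable \<F>" unfolding \<F>_def by (rule countable_image)
  have ok: "ok p (SOME \<phi>. ok p \<phi>)" if "\<exists>\<phi>. ok p \<phi>" for p using that by (rule someI_ex)
  have 2: "is_formula L \<phi>" if "\<phi> \<in> \<F>" for \<phi> using that ok unfolding \<F>_def ok_def by blast
  have 3: "\<exists>\<psi>\<in>\<F>. near A \<phi> A \<psi> \<epsilon>" if \<phi>: "is_formula L \<phi>" and \<epsilon>: "\<epsilon> > 0" for \<phi> \<epsilon>
  proof -
    obtain n where n: "1 / Suc n < \<epsilon>/2" using \<epsilon> by (meson half_gt_zero nat_approx_posE)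
    \<comment> \<open>Half of the error is spent on passing from \<open>\<phi>\<close> to
      \<open>\<psi>\<close>, half on passing to \<open>\<psi>'\<close> in the dense set.\<close>
    define e where "e = 1 / real (Suc n) / 2"
    have n': "e > 0" and e2: "1 / real (Suc n) = e + e" by (auto simp: e_def field_simps)
    obtain \<psi> where \<psi>: "is_formula L' \<psi>" "near A \<phi> A' \<psi> e"
      using definable_formulas[OF A A'(1) U(1) _ \<phi> n'] A'(2) unfolding interdefinable_def by blast
    obtain \<psi>' where \<psi>': "\<psi>' \<in> \<G>" "near A' \<psi> A' \<psi>' e" using \<G>(3)[OF \<psi>(1) n'] by blast
    have n1: "near A \<phi> A' \<psi>' (1 / Suc n)"
      unfolding near_def
    proof
      fix s assume "s \<in> seqs A"
      then have "\<bar>eval A \<phi> s - eval A' \<psi> s\<bar> \<le> e" "\<bar>eval A' \<psi> s - eval A' \<psi>' s\<bar> \<le> e"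
        using \<psi>(2) \<psi>'(2) U(2) unfolding near_def by blast+
      then show "\<bar>eval A \<phi> s - eval A' \<psi>' s\<bar> \<le> 1 / Suc n" unfolding e2 by linarith
    qed
    then have ex: "ok (\<psi>', n) \<phi>" using \<phi> by (simp add: ok_def)
    define \<theta> where "\<theta> = (SOME \<phi>. ok (\<psi>', n) \<phi>)"
    have "\<theta> \<in> \<F>" unfolding \<F>_def \<theta>_def using \<psi>'(1) ex by blast
    moreover have "near A \<phi> A \<theta> \<epsilon>" unfolding near_def
    proof
      fix s assume "s \<in> seqs A"
      moreover have "ok (\<psi>', n) \<theta>" unfolding \<theta>_def using ok ex by blast
      ultimately have "\<bar>eval A \<phi> s - eval A' \<psi>' s\<bar> \<le> 1 / Suc n" "\<bar>eval A \<theta> s - eval A' \<psi>' s\<bar> \<le> 1 / Suc n"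
        using n1 unfolding near_def ok_def by auto
      then show "\<bar>eval A \<phi> s - eval A \<theta> s\<bar> \<le> \<epsilon>" using n by linarith
    qed
    ultimately show ?thesis by blast
  qed
  show ?thesis using that[OF 1 2 3] by blast
qed

section \<open>Models from Henkin sequences\<close>

definition neg :: "'r formula \<Rightarrow> 'r formula" where
  "neg \<phi> = Conn (\<lambda>z. - z 0) [\<phi>]"

lemma eval_neg [simp]: "eval A (neg \<phi>) s = - eval A \<phi> s"
  by (simp add: neg_def)

lemma free_vars_neg [simp]: "free_vars (neg \<phi>) = free_vars \<phi>"
  by (simp add: neg_def)

lemma is_formula_neg [simp]: "is_formula L (neg \<phi>) \<longleftrightarrow> is_formula L \<phi>"
  by (auto simp: neg_def intro!: continuous_intros)

text \<open>Valid without any boundedness, since the infimum of a set of reals is defined through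
  the supremum. It reduces \<open>InfF\<close> to \<open>SupF\<close> below.\<close>

lemma eval_InfF: "eval A (InfF i \<phi>) s = - eval A (SupF i (neg \<phi>)) s"
  by (simp add: Inf_real_def image_image)

lemma eval_SupF_upper:
  assumes "metric_structure L A" "is_formula L \<phi>" "s \<in> seqs A" "x \<in> mspace (universe A)"
  shows "eval A \<phi> (s(i := x)) \<le> eval A (SupF i \<phi>) s"
proof -
  obtain B where "\<forall>s\<in>seqs A. \<bar>eval A \<phi> s\<bar> \<le> B" using formula_bounded assms by blast
  then have "bdd_above ((\<lambda>x. eval A \<phi> (s(i := x))) ` mspace (universe A))"
    using assms(3) by (intro bdd_aboveI2[where M = B]) (simp add: abs_le_iff)
  then show ?thesis using assms(4) by (auto intro: cSUP_upper)
qed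

lemma bcontfun_Cauchy_convergent:
  fixes f :: "nat \<Rightarrow> 'a::topological_space \<Rightarrow>\<^sub>C 'b::complete_space"
  assumes "Cauchy f"
  shows "convergent f"
proof -
  have "\<forall>\<epsilon>>0. \<exists>N. \<forall>m n x. N \<le> m \<and> N \<le> n \<and> True \<longrightarrow> dist (f m x) (f n x) < \<epsilon>"
    using assms unfolding Cauchy_def by (metis dist_fun_lt_imp_dist_val_lt)
  then have "\<exists>g. \<forall>\<epsilon>>0. \<exists>N. \<forall>n x. N \<le> n \<and> True \<longrightarrow> dist (f n x) (g x) < \<epsilon>"
    using uniformly_convergent_eq_cauchy[of "\<lambda>_. True" "\<lambda>n. apply_bcontfun (f n)"] by blast
  then obtain g where "uniform_limit UNIV (\<lambda>n. apply_bcontfun (f n)) g sequentially"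
    unfolding uniform_limit_sequentially_iff by auto
  then obtain l where "f \<longlonglongrightarrow> l"
    by (rule uniform_limit_bcontfunE[OF _ sequentially_bot])
  then show ?thesis by (rule convergentI)
qed

text \<open>The assignments \<open>s j\<close> have a limit type. In the Henkin condition the index
  \<open>k\<close> is the same for all \<open>j\<close>, so that indices can serve as names for the
  points of a limit model.\<close>

locale henkin_sequence =
  fixes L :: "'r language" and M :: "('a, 'r) mstructure" and s :: "nat \<Rightarrow> nat \<Rightarrow> 'a"
  assumes ms: "metric_structure L M"
    and s: "s j \<in> seqs M"
    and convergent: "is_formula L \<phi> \<Longrightarrow> convergent (\<lambda>j. eval M \<phi> (s j))"
    and henkin: "is_formula L \<phi> \<Longrightarrow> \<eta> > 0 \<Longrightarrow>
      \<exists>k. lim (\<lambda>j. eval M (SupF i \<phi>) (s j)) - \<eta> \<le> lim (\<lambda>j. eval M \<phi> ((s j)(i := s j k)))"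
begin

abbreviation "d \<equiv> mdist (universe M)"

definition p :: "'r formula \<Rightarrow> (nat \<Rightarrow> nat) \<Rightarrow> real" where
  "p \<phi> \<pi> = lim (\<lambda>j. eval M \<phi> (s j \<circ> \<pi>))"

lemma p_lim: "is_formula L \<phi> \<Longrightarrow> (\<lambda>j. eval M \<phi> (s j \<circ> \<pi>)) \<longlonglongrightarrow> p \<phi> \<pi>"
  using formula_rename[of L \<phi> M \<pi>] convergent unfolding p_def by (metis (no_types, lifting) convergent_LIMSEQ_iff ext)

definition \<rho> :: "nat \<Rightarrow> nat \<Rightarrow> real" where
  "\<rho> i k = lim (\<lambda>j. d (s j i) (s j k))"

lemma \<rho>_lim: "(\<lambda>j. d (s j i) (s j k)) \<longlonglongrightarrow> \<rho> i k"
  using p_lim[of "Dist i k" id] unfolding p_def \<rho>_def by (simp add: o_def)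

lemma \<rho>_triangle: "\<rho> i k \<le> \<rho> i l + \<rho> l k"
  by (rule LIMSEQ_le[OF \<rho>_lim tendsto_add[OF \<rho>_lim \<rho>_lim]]) (auto intro!: mdist_triangle seqs_D s)

lemma \<rho>_sym: "\<rho> i k = \<rho> k i"
  unfolding \<rho>_def by (simp add: mdist_commute)

lemma \<rho>_self: "\<rho> i i = 0"
  using s unfolding \<rho>_def by simp

lemma \<rho>_nonneg: "0 \<le> \<rho> i k"
  by (rule LIMSEQ_le_const[OF \<rho>_lim]) simp

lemma \<rho>_bounded: "\<exists>B. \<forall>i k. \<rho> i k \<le> B"
proof -
  obtain B where B: "\<forall>x\<in>mspace (universe M). \<forall>y\<in>mspace (universe M). d x y \<le> B"
    using ms unfolding metric_structure_def by blast
  have "\<rho> i k \<le> B" for i k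
    by (rule LIMSEQ_le_const2[OF \<rho>_lim]) (use B s in auto)
  then show ?thesis by blast
qed

text \<open>The modulus of continuity in \<open>M\<close> is the same for all assignments
  \<open>s j\<close> and so survives the limit over \<open>j\<close>.\<close>

lemma p_unif_cont:
  assumes \<phi>: "is_formula L \<phi>" and \<eta>: "\<eta> > 0"
  obtains \<delta> where "\<delta> > 0" "\<And>\<pi> \<pi>'. (\<And>i. i \<in> free_vars \<phi> \<Longrightarrow> \<rho> (\<pi> i) (\<pi>' i) < \<delta>) \<Longrightarrow> \<bar>p \<phi> \<pi> - p \<phi> \<pi>'\<bar> \<le> \<eta>"
proof -
  obtain \<delta> where \<delta>: "\<delta> > 0" "\<forall>t\<in>seqs M. \<forall>t'\<in>seqs M.
    (\<forall>i\<in>free_vars \<phi>. d (t i) (t' i) < \<delta>) \<longrightarrow> \<bar>eval M \<phi> t - eval M \<phi> t'\<bar> < \<eta>"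
    using formula_unif_cont[OF ms \<phi> \<eta>] by blast
  have "\<bar>p \<phi> \<pi> - p \<phi> \<pi>'\<bar> \<le> \<eta>" if r: "\<And>i. i \<in> free_vars \<phi> \<Longrightarrow> \<rho> (\<pi> i) (\<pi>' i) < \<delta>" for \<pi> \<pi>'
  proof -
    have "eventually (\<lambda>j. \<forall>i\<in>free_vars \<phi>. d (s j (\<pi> i)) (s j (\<pi>' i)) < \<delta>) sequentially"
      by (intro eventually_ball_finite ballI order_tendstoD(2)[OF \<rho>_lim] r) auto
    then have ev: "eventually (\<lambda>j. \<bar>eval M \<phi> (s j \<circ> \<pi>) - eval M \<phi> (s j \<circ> \<pi>')\<bar> \<le> \<eta>) sequentially"
    proof (rule eventually_mono)
      fix j assume "\<forall>i\<in>free_vars \<phi>. d (s j (\<pi> i)) (s j (\<pi>' i)) < \<delta>"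
      then have "\<bar>eval M \<phi> (s j \<circ> \<pi>) - eval M \<phi> (s j \<circ> \<pi>')\<bar> < \<eta>"
        using \<delta>(2) s by (metis comp_apply seqs_comp)
      then show "\<bar>eval M \<phi> (s j \<circ> \<pi>) - eval M \<phi> (s j \<circ> \<pi>')\<bar> \<le> \<eta>" by simp
    qed
    show ?thesis
      by (rule tendsto_upperbound[OF tendsto_rabs[OF tendsto_diff[OF p_lim[OF \<phi>] p_lim[OF \<phi>]]] ev]) simp
  qed
  then show ?thesis using that \<delta>(1) by blast
qed

lemma p_SupF_upper:
  assumes \<phi>: "is_formula L \<phi>"
  shows "p \<phi> (\<pi>(i := k)) \<le> p (SupF i \<phi>) \<pi>"
proof (rule LIMSEQ_le[OF p_lim[OF \<phi>] p_lim])
  have "eval M \<phi> (s j \<circ> \<pi>(i := k)) \<le> eval M (SupF i \<phi>) (s j \<circ> \<pi>)" for j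
    using eval_SupF_upper[OF ms \<phi>, of "s j \<circ> \<pi>" "s j k" i] s by (simp add: fun_upd_comp)
  then show "\<exists>N. \<forall>n\<ge>N. eval M \<phi> (s n \<circ> \<pi>(i := k)) \<le> eval M (SupF i \<phi>) (s n \<circ> \<pi>)" by blast
qed (use \<phi> in simp)

text \<open>The locale assumption speaks of \<open>s j\<close>, not of
  \<open>s j \<circ> \<pi>\<close>. Renaming with a bound variable fresh for \<open>\<pi>\<close>
  reduces the general case to it.\<close>

lemma p_SupF_henkin:
  assumes \<phi>: "is_formula L \<phi>" and \<eta>: "\<eta> > 0"
  shows "\<exists>k. p (SupF i \<phi>) \<pi> - \<eta> \<le> p \<phi> (\<pi>(i := k))"
proof -
  obtain j where j: "j \<notin> \<pi> ` free_vars \<phi>" using ex_new_if_finite[of "\<pi> ` free_vars \<phi>"] by auto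
  obtain \<phi>' where \<phi>': "is_formula L \<phi>'" "\<And>s. eval M \<phi>' s = eval M \<phi> (s \<circ> \<pi>(i := j))"
    using formula_rename[OF \<phi>] by metis
  have *: "eval M \<phi>' (t(j := x)) = eval M \<phi> ((t \<circ> \<pi>)(i := x))" for t x
    unfolding \<phi>' by (rule eval_cong) (use j in auto)
  have "eval M (SupF j \<phi>') t = eval M (SupF i \<phi>) (t \<circ> \<pi>)" for t by (simp add: *)
  moreover have "eval M \<phi>' (t(j := t k)) = eval M \<phi> (t \<circ> \<pi>(i := k))" for t k
    by (simp add: * fun_upd_comp)
  moreover obtain k where "lim (\<lambda>l. eval M (SupF j \<phi>') (s l)) - \<eta> \<le> lim (\<lambda>l. eval M \<phi>' ((s l)(j := s l k)))"
    using henkin[OF \<phi>'(1) \<eta>] by blast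
  ultimately have "p (SupF i \<phi>) \<pi> - \<eta> \<le> p \<phi> (\<pi>(i := k))"
    unfolding p_def by (simp del: eval.simps)
  then show ?thesis ..
qed

text \<open>The model is the completion of the index set for the pseudometric \<open>\<rho>\<close>, constructed as the
  closure of its Kuratowski embedding into the bounded functions.\<close>

definition e :: "nat \<Rightarrow> nat \<Rightarrow>\<^sub>C real" where
  "e i = Bcontfun (\<rho> i)"

lemma e_apply: "apply_bcontfun (e i) k = \<rho> i k"
proof -
  obtain B where "\<And>i k. \<rho> i k \<le> B" using \<rho>_bounded by blast
  then have "\<rho> i \<in> bcontfun"
    by (intro bcontfun_normI[of _ B]) (auto simp: \<rho>_nonneg)
  then show ?thesis by (simp add: e_def Bcontfun_inverse)
qed

text \<open>The triangle inequality bounds the distance from above, evaluation at \<open>k\<close>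
  from below.\<close>

lemma dist_e: "dist (e i) (e k) = \<rho> i k"
proof (rule antisym)
  show "dist (e i) (e k) \<le> \<rho> i k"
  proof (rule dist_bound)
    fix l
    have "\<rho> i l \<le> \<rho> i k + \<rho> k l" "\<rho> k l \<le> \<rho> k i + \<rho> i l" by (rule \<rho>_triangle)+
    then show "dist (e i l) (e k l) \<le> \<rho> i k" using \<rho>_sym[of i k] by (simp add: e_apply dist_real_def abs_le_iff)
  qed
  have "dist (e i k) (e k k) \<le> dist (e i) (e k)" by (rule dist_bounded)
  then show "\<rho> i k \<le> dist (e i) (e k)" using \<rho>_nonneg by (simp add: e_apply \<rho>_self dist_real_def)
qed

definition X :: "(nat \<Rightarrow>\<^sub>C real) set" where "X = closure (range e)"

lemma e_in_X [simp]: "e i \<in> X" unfolding X_def by (rule subsetD[OF closure_subset]) simp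

definition approx :: "(nat \<Rightarrow>\<^sub>C real) \<Rightarrow> nat \<Rightarrow> nat" where
  "approx y n = (SOME k. dist (e k) y < 1 / Suc n)"

lemma approx: "y \<in> X \<Longrightarrow> dist (e (approx y n)) y < 1 / Suc n"
proof -
  assume "y \<in> X"
  then have "\<exists>z\<in>range e. dist z y < 1 / Suc n"
    unfolding X_def closure_approachable by (elim allE[of _ "1 / real (Suc n)"]) simp
  then have "\<exists>k. dist (e k) y < 1 / Suc n" by blast
  then show ?thesis unfolding approx_def by (rule someI_ex)
qed

lemma approx_lim: "y \<in> X \<Longrightarrow> (\<lambda>n. e (approx y n)) \<longlonglongrightarrow> y"
proof (rule metric_LIMSEQ_I)
  fix r :: real assume y: "y \<in> X" "0 < r"
  then obtain N where N: "1 / Suc N < r" by (meson nat_approx_posE)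
  have "dist (e (approx y n)) y < r" if "n \<ge> N" for n
  proof -
    have "1 / Suc n \<le> 1 / Suc N" using that by (simp add: frac_le)
    then show ?thesis using approx[OF y(1), of n] N by linarith
  qed
  then show "\<exists>N. \<forall>n\<ge>N. dist (e (approx y n)) y < r" by blast
qed

definition E :: "'r formula \<Rightarrow> (nat \<Rightarrow> nat \<Rightarrow>\<^sub>C real) \<Rightarrow> real" where
  "E \<phi> y = lim (\<lambda>n. p \<phi> (\<lambda>i. approx (y i) n))"

lemma eventually_approx:
  assumes "\<And>i. i \<in> free_vars \<phi> \<Longrightarrow> y i \<in> X" "\<delta> > 0"
  shows "eventually (\<lambda>n. \<forall>i\<in>free_vars \<phi>. dist (e (approx (y i) n)) (y i) < \<delta>) sequentially"
  by (intro eventually_ball_finite ballI tendstoD[OF approx_lim] assms) auto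

text \<open>Membership in \<open>X\<close> is asked at free variables only. This matters for
  predicates, where \<open>xs ! i\<close> is unspecified beyond the length of
  \<open>xs\<close>.\<close>

lemma E_lim:
  assumes \<phi>: "is_formula L \<phi>" and y: "\<And>i. i \<in> free_vars \<phi> \<Longrightarrow> y i \<in> X"
  shows "(\<lambda>n. p \<phi> (\<lambda>i. approx (y i) n)) \<longlonglongrightarrow> E \<phi> y"
proof -
  have "Cauchy (\<lambda>n. p \<phi> (\<lambda>i. approx (y i) n))"
  proof (rule metric_CauchyI)
    fix \<eta> :: real assume "\<eta> > 0"
    then have "\<eta>/2 > 0" by simp
    then obtain \<delta> where \<delta>: "\<delta> > 0" "\<And>\<pi> \<pi>'. (\<And>i. i \<in> free_vars \<phi> \<Longrightarrow> \<rho> (\<pi> i) (\<pi>' i) < \<delta>) \<Longrightarrow> \<bar>p \<phi> \<pi> - p \<phi> \<pi>'\<bar> \<le> \<eta>/2"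
      using p_unif_cont[OF \<phi>] by metis
    then have "\<delta>/2 > 0" by simp
    then obtain N where N: "\<And>n i. n \<ge> N \<Longrightarrow> i \<in> free_vars \<phi> \<Longrightarrow> dist (e (approx (y i) n)) (y i) < \<delta>/2"
      using eventually_approx[of \<phi> y "\<delta>/2"] y unfolding eventually_sequentially by metis
    have "dist (p \<phi> (\<lambda>i. approx (y i) m)) (p \<phi> (\<lambda>i. approx (y i) n)) < \<eta>" if "m \<ge> N" "n \<ge> N" for m n
    proof -
      have "\<rho> (approx (y i) m) (approx (y i) n) < \<delta>" if "i \<in> free_vars \<phi>" for i
        unfolding dist_e[symmetric]
        using N[OF \<open>m \<ge> N\<close> that] N[OF \<open>n \<ge> N\<close> that] by (rule dist_triangle_half_l)
      then have "\<bar>p \<phi> (\<lambda>i. approx (y i) m) - p \<phi> (\<lambda>i. approx (y i) n)\<bar> \<le> \<eta>/2" by (intro \<delta>(2))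
      then show ?thesis using \<open>\<eta> > 0\<close> by (simp add: dist_real_def)
    qed
    then show "\<exists>N. \<forall>m\<ge>N. \<forall>n\<ge>N. dist (p \<phi> (\<lambda>i. approx (y i) m)) (p \<phi> (\<lambda>i. approx (y i) n)) < \<eta>" by blast
  qed
  then show ?thesis unfolding E_def by (simp add: Cauchy_convergent_iff convergent_LIMSEQ_iff)
qed

text \<open>Frees \<open>E\<close> from the chosen approximations: all indices whose points are
  close enough to \<open>y\<close> compute its value up to \<open>\<eta>\<close>.\<close>

lemma E_near:
  assumes \<phi>: "is_formula L \<phi>" and \<eta>: "\<eta> > 0"
  obtains \<delta> where "\<delta> > 0" "\<And>y \<pi>. (\<And>i. i \<in> free_vars \<phi> \<Longrightarrow> y i \<in> X) \<Longrightarrow>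
    (\<And>i. i \<in> free_vars \<phi> \<Longrightarrow> dist (e (\<pi> i)) (y i) < \<delta>) \<Longrightarrow> \<bar>E \<phi> y - p \<phi> \<pi>\<bar> \<le> \<eta>"
proof -
  obtain \<delta> where \<delta>: "\<delta> > 0" "\<And>\<pi> \<pi>'. (\<And>i. i \<in> free_vars \<phi> \<Longrightarrow> \<rho> (\<pi> i) (\<pi>' i) < \<delta>) \<Longrightarrow> \<bar>p \<phi> \<pi> - p \<phi> \<pi>'\<bar> \<le> \<eta>"
    using p_unif_cont[OF \<phi> \<eta>] by metis
  then have d2: "\<delta>/2 > 0" by simp
  have "\<bar>E \<phi> y - p \<phi> \<pi>\<bar> \<le> \<eta>" if y: "\<And>i. i \<in> free_vars \<phi> \<Longrightarrow> y i \<in> X"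
    and \<pi>: "\<And>i. i \<in> free_vars \<phi> \<Longrightarrow> dist (e (\<pi> i)) (y i) < \<delta>/2" for y \<pi>
  proof -
    have ev: "eventually (\<lambda>n. \<bar>p \<phi> (\<lambda>i. approx (y i) n) - p \<phi> \<pi>\<bar> \<le> \<eta>) sequentially"
      using eventually_approx[OF y d2]
    proof (rule eventually_mono)
      fix n assume *: "\<forall>i\<in>free_vars \<phi>. dist (e (approx (y i) n)) (y i) < \<delta>/2"
      have "\<rho> (approx (y i) n) (\<pi> i) < \<delta>" if "i \<in> free_vars \<phi>" for i
        unfolding dist_e[symmetric]
        using *[rule_format, OF that] \<pi>[OF that] by (rule dist_triangle_half_l)
      then show "\<bar>p \<phi> (\<lambda>i. approx (y i) n) - p \<phi> \<pi>\<bar> \<le> \<eta>" by (intro \<delta>(2))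
    qed
    show ?thesis
      by (rule tendsto_upperbound[OF tendsto_rabs[OF tendsto_diff[OF E_lim[OF \<phi> y] tendsto_const]] ev]) auto
  qed
  then show ?thesis using that d2 by blast
qed

lemma E_e:
  assumes \<phi>: "is_formula L \<phi>"
  shows "E \<phi> (\<lambda>i. e (\<pi> i)) = p \<phi> \<pi>"
proof -
  have "\<bar>E \<phi> (\<lambda>i. e (\<pi> i)) - p \<phi> \<pi>\<bar> \<le> \<eta>" if "\<eta> > 0" for \<eta>
    by (rule E_near[OF \<phi> that]) simp
  then have "\<bar>E \<phi> (\<lambda>i. e (\<pi> i)) - p \<phi> \<pi>\<bar> \<le> 0" by (rule dense_ge)
  then show ?thesis by simp
qed

definition N :: "(nat \<Rightarrow>\<^sub>C real, 'r) mstructure" where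
  "N = \<lparr>universe = submetric euclidean_metric X,
        interp = (\<lambda>P xs. E (Pred P [0..<length xs]) (\<lambda>i. xs ! i))\<rparr>"

lemma N_simps [simp]: "mspace (universe N) = X" "mdist (universe N) = dist"
  "interp N P xs = E (Pred P [0..<length xs]) (\<lambda>i. xs ! i)"
  by (simp_all add: N_def)

lemma N_predicate:
  assumes P: "P \<in> symbols L"
  shows "predicate_on (universe N) (arity L P) (interp N P)"
proof -
  let ?\<phi> = "Pred P [0..<arity L P]"
  have \<phi>: "is_formula L ?\<phi>" using P by simp
  have fv: "free_vars ?\<phi> = {..<arity L P}" by auto
  have eq: "interp N P xs = E ?\<phi> (\<lambda>i. xs ! i)" if "xs \<in> tuples (universe N) (arity L P)" for xs
    using that by (simp add: tuples_def)
  have mem: "xs ! i \<in> X" if "xs \<in> tuples (universe N) (arity L P)" "i \<in> free_vars ?\<phi>" for xs i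
    using that unfolding fv by (auto simp: tuples_def)
  obtain B where B: "\<forall>t\<in>seqs M. \<bar>eval M ?\<phi> t\<bar> \<le> B" using formula_bounded[OF ms \<phi>] by blast
  have pB: "\<bar>p ?\<phi> \<pi>\<bar> \<le> B" for \<pi>
    by (rule tendsto_upperbound[OF tendsto_rabs[OF p_lim[OF \<phi>]] always_eventually]) (use B s in \<open>auto simp del: eval.simps\<close>)
  have "\<bar>interp N P xs\<bar> \<le> B" if xs: "xs \<in> tuples (universe N) (arity L P)" for xs
    unfolding eq[OF xs]
    by (rule tendsto_upperbound[OF tendsto_rabs[OF E_lim[OF \<phi> mem[OF xs]]] always_eventually]) (use pB in auto)
  then have "bounded (interp N P ` tuples (universe N) (arity L P))"
    unfolding bounded_iff by (intro exI[of _ B]) (auto simp del: N_simps)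
  moreover have "\<exists>\<delta>>0. \<forall>xs\<in>tuples (universe N) (arity L P). \<forall>ys\<in>tuples (universe N) (arity L P).
        (\<forall>i<arity L P. mdist (universe N) (xs ! i) (ys ! i) < \<delta>) \<longrightarrow> \<bar>interp N P xs - interp N P ys\<bar> < \<eta>"
    if \<eta>: "\<eta> > 0" for \<eta>
  proof -
    have "\<eta>/3 > 0" using \<eta> by simp
    then obtain \<delta> where \<delta>: "\<delta> > 0" "\<And>y \<pi>. (\<And>i. i \<in> free_vars ?\<phi> \<Longrightarrow> y i \<in> X) \<Longrightarrow>
      (\<And>i. i \<in> free_vars ?\<phi> \<Longrightarrow> dist (e (\<pi> i)) (y i) < \<delta>) \<Longrightarrow> \<bar>E ?\<phi> y - p ?\<phi> \<pi>\<bar> \<le> \<eta>/3"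
      using E_near[OF \<phi>] by metis
    have d2: "\<delta>/2 > 0" using \<delta>(1) by simp
    have "\<bar>interp N P xs - interp N P ys\<bar> < \<eta>"
      if xs: "xs \<in> tuples (universe N) (arity L P)" and ys: "ys \<in> tuples (universe N) (arity L P)"
        and near: "\<forall>i<arity L P. dist (xs ! i) (ys ! i) < \<delta>/2" for xs ys
    proof -
      \<comment> \<open>Indices chosen close to \<open>xs\<close> are also close to
        \<open>ys\<close>, so both values of \<open>E\<close> are compared with the same value of
        \<open>p\<close>.\<close>
      obtain n where n: "\<forall>i\<in>free_vars ?\<phi>. dist (e (approx (xs ! i) n)) (xs ! i) < \<delta>/2"
        using eventually_happens[OF eventually_approx[of ?\<phi> "\<lambda>i. xs ! i", OF mem[OF xs] d2]]
        by (auto simp del: free_vars.simps)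
      have "\<bar>E ?\<phi> (\<lambda>i. xs ! i) - p ?\<phi> (\<lambda>i. approx (xs ! i) n)\<bar> \<le> \<eta>/3"
      proof (rule \<delta>(2)[OF mem[OF xs]])
        fix i assume "i \<in> free_vars ?\<phi>"
        then have "dist (e (approx (xs ! i) n)) (xs ! i) < \<delta>/2" using n by blast
        then show "dist (e (approx (xs ! i) n)) (xs ! i) < \<delta>" using \<delta>(1) by linarith
      qed
      moreover have "\<bar>E ?\<phi> (\<lambda>i. ys ! i) - p ?\<phi> (\<lambda>i. approx (xs ! i) n)\<bar> \<le> \<eta>/3"
      proof (rule \<delta>(2)[OF mem[OF ys]])
        fix i assume i: "i \<in> free_vars ?\<phi>"
        then have "dist (e (approx (xs ! i) n)) (xs ! i) < \<delta>/2" using n by blast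
        moreover have "dist (ys ! i) (xs ! i) < \<delta>/2" using near i unfolding fv by (simp add: dist_commute)
        ultimately show "dist (e (approx (xs ! i) n)) (ys ! i) < \<delta>" by (rule dist_triangle_half_l)
      qed
      ultimately show ?thesis using \<eta> unfolding eq[OF xs] eq[OF ys] by linarith
    qed
    then show ?thesis using d2 by (intro exI[of _ "\<delta>/2"]) (simp del: N_simps(3))
  qed
  ultimately show ?thesis unfolding predicate_on_def by blast
qed

lemma N_complete: "mcomplete_of (universe N)"
proof -
  interpret Metric_space X dist using Metric_space_mspace_mdist[of "universe N"] by simp
  have "mcomplete" unfolding mcomplete_def
  proof (intro allI impI)
    fix \<sigma> assume c: "MCauchy \<sigma>"
    from c have \<sigma>: "\<And>n. \<sigma> n \<in> X" and "Cauchy \<sigma>"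
      unfolding MCauchy_def Cauchy_def by auto
    have "convergent \<sigma>" using \<open>Cauchy \<sigma>\<close> by (rule bcontfun_Cauchy_convergent)
    then obtain x where x: "\<sigma> \<longlonglongrightarrow> x" unfolding convergent_def by blast
    have "x \<in> closure (range e)"
      by (rule closed_sequentially[OF closed_closure _ x]) (use \<sigma> in \<open>simp add: X_def\<close>)
    then have "x \<in> X" by (simp add: X_def)
    then have "limitin mtopology \<sigma> x sequentially"
      unfolding limitin_metric using x \<sigma> by (simp add: tendsto_iff)
    then show "\<exists>x. limitin mtopology \<sigma> x sequentially" ..
  qed
  then show ?thesis by (simp add: mcomplete_of_def)
qed

lemma N_bounded: "\<exists>B. \<forall>x\<in>X. \<forall>y\<in>X. dist x y \<le> B"
proof -
  obtain B where B: "\<And>i k. \<rho> i k \<le> B" using \<rho>_bounded by blast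
  have "dist x y \<le> B" if "x \<in> X" "y \<in> X" for x y
    by (rule tendsto_upperbound[OF tendsto_dist[OF approx_lim[OF that(1)] approx_lim[OF that(2)]] always_eventually])
      (use B in \<open>auto simp: dist_e\<close>)
  then show ?thesis by blast
qed

lemma X_nonempty: "X \<noteq> {}"
  using e_in_X by (metis empty_iff)

lemma N_metric_structure: "metric_structure L N"
  unfolding metric_structure_def using N_complete N_bounded N_predicate X_nonempty by simp

lemma N_separable: "separable_structure N"
proof -
  have top: "mtopology_of (universe N) = subtopology euclidean X"
    by (simp add: N_def mtopology_of_submetric)
  have "subtopology euclidean X closure_of range e = X"
    by (simp add: closure_of_subtopology image_subset_iff inf.absorb2 X_def[symmetric])
  moreover have "countable (range e)" "range e \<subseteq> X" by (auto intro: e_in_X)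
  ultimately show ?thesis unfolding separable_structure_def separable_space_def top
    by (metis topspace_euclidean_subtopology)
qed

lemma E_bounded:
  assumes \<phi>: "is_formula L \<phi>"
  obtains B where "\<And>y. (\<And>i. i \<in> free_vars \<phi> \<Longrightarrow> y i \<in> X) \<Longrightarrow> \<bar>E \<phi> y\<bar> \<le> B"
proof -
  obtain B where B: "\<forall>t\<in>seqs M. \<bar>eval M \<phi> t\<bar> \<le> B" using formula_bounded[OF ms \<phi>] by blast
  have pB: "\<bar>p \<phi> \<pi>\<bar> \<le> B" for \<pi>
    by (rule tendsto_upperbound[OF tendsto_rabs[OF p_lim[OF \<phi>]] always_eventually]) (use B s in auto)
  have "\<bar>E \<phi> y\<bar> \<le> B" if "\<And>i. i \<in> free_vars \<phi> \<Longrightarrow> y i \<in> X" for y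
    by (rule tendsto_upperbound[OF tendsto_rabs[OF E_lim[OF \<phi> that]] always_eventually]) (use pB in auto)
  then show ?thesis using that by blast
qed

lemma seqs_N: "y \<in> seqs N \<Longrightarrow> y i \<in> X"
  using seqs_D[of y N i] by simp

text \<open>Tarski's clause in the completion. One inequality is inherited from the indices by
  taking limits; for the other, the Henkin condition yields an index \<open>k\<close> whose point
  \<open>e k\<close> is almost optimal.\<close>

lemma E_SupF:
  assumes \<phi>: "is_formula L \<phi>" and y: "y \<in> seqs N"
  shows "E (SupF i \<phi>) y = (SUP x\<in>X. E \<phi> (y(i := x)))"
proof (rule antisym)
  have S: "is_formula L (SupF i \<phi>)" using \<phi> by simp
  have yX: "y j \<in> X" for j using y by (rule seqs_N)
  then have yx: "(y(i := x)) j \<in> X" if "x \<in> X" for x j using that by simp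
  obtain B where B: "\<And>y. (\<And>i. i \<in> free_vars \<phi> \<Longrightarrow> y i \<in> X) \<Longrightarrow> \<bar>E \<phi> y\<bar> \<le> B"
    using E_bounded[OF \<phi>] by blast
  have bdd: "bdd_above ((\<lambda>x. E \<phi> (y(i := x))) ` X)"
    by (rule bdd_aboveI2[where M = B]) (use B yx in \<open>meson abs_le_D1\<close>)
  show "(SUP x\<in>X. E \<phi> (y(i := x))) \<le> E (SupF i \<phi>) y"
  proof (rule cSUP_least[OF X_nonempty])
    fix x assume x: "x \<in> X"
    have "p \<phi> (\<lambda>j. approx ((y(i := x)) j) n) \<le> p (SupF i \<phi>) (\<lambda>j. approx (y j) n)" for n
    proof -
      have "(\<lambda>j. approx ((y(i := x)) j) n) = (\<lambda>j. approx (y j) n)(i := approx x n)" by auto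
      then show ?thesis using p_SupF_upper[OF \<phi>] by metis
    qed
    then show "E \<phi> (y(i := x)) \<le> E (SupF i \<phi>) y"
      by (intro LIMSEQ_le[OF E_lim[OF \<phi>] E_lim[OF S]] yX yx x) blast
  qed
  show "E (SupF i \<phi>) y \<le> (SUP x\<in>X. E \<phi> (y(i := x)))"
  proof (rule field_le_epsilon)
    fix \<eta> :: real assume "\<eta> > 0"
    then have h: "\<eta>/3 > 0" by simp
    obtain \<delta>1 where \<delta>1: "\<delta>1 > 0" "\<And>y \<pi>. (\<And>j. j \<in> free_vars \<phi> \<Longrightarrow> y j \<in> X) \<Longrightarrow>
      (\<And>j. j \<in> free_vars \<phi> \<Longrightarrow> dist (e (\<pi> j)) (y j) < \<delta>1) \<Longrightarrow> \<bar>E \<phi> y - p \<phi> \<pi>\<bar> \<le> \<eta>/3"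
      using E_near[OF \<phi> h] by metis
    obtain \<delta>2 where \<delta>2: "\<delta>2 > 0" "\<And>y \<pi>. (\<And>j. j \<in> free_vars (SupF i \<phi>) \<Longrightarrow> y j \<in> X) \<Longrightarrow>
      (\<And>j. j \<in> free_vars (SupF i \<phi>) \<Longrightarrow> dist (e (\<pi> j)) (y j) < \<delta>2) \<Longrightarrow> \<bar>E (SupF i \<phi>) y - p (SupF i \<phi>) \<pi>\<bar> \<le> \<eta>/3"
      using E_near[OF S h] by metis
    obtain n where n: "1 / Suc n < min \<delta>1 \<delta>2" using \<delta>1(1) \<delta>2(1) by (metis min_less_iff_conj nat_approx_posE)
    define \<pi> where "\<pi> = (\<lambda>j. approx (y j) n)"
    have \<pi>: "dist (e (\<pi> j)) (y j) < \<delta>1" "dist (e (\<pi> j)) (y j) < \<delta>2" for j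
      using approx[OF yX, of j n] n unfolding \<pi>_def by linarith+
    obtain k where k: "p (SupF i \<phi>) \<pi> - \<eta>/3 \<le> p \<phi> (\<pi>(i := k))" using p_SupF_henkin[OF \<phi> h] by blast
    have "\<bar>E (SupF i \<phi>) y - p (SupF i \<phi>) \<pi>\<bar> \<le> \<eta>/3" by (rule \<delta>2(2)) (use yX \<pi> in auto)
    moreover have "\<bar>E \<phi> (y(i := e k)) - p \<phi> (\<pi>(i := k))\<bar> \<le> \<eta>/3"
      by (rule \<delta>1(2)) (use yX \<pi> \<delta>1(1) in auto)
    moreover have "E \<phi> (y(i := e k)) \<le> (SUP x\<in>X. E \<phi> (y(i := x)))"
      using bdd by (rule cSUP_upper[rotated]) simp
    ultimately show "E (SupF i \<phi>) y \<le> (SUP x\<in>X. E \<phi> (y(i := x))) + \<eta>" using k by linarith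
  qed
qed

lemma p_Conn:
  assumes u: "continuous_on UNIV u" and \<phi>s: "\<forall>\<phi>\<in>set \<phi>s. is_formula L \<phi>"
  shows "p (Conn u \<phi>s) \<pi> = u (\<lambda>i. if i < length \<phi>s then p (\<phi>s ! i) \<pi> else 0)"
proof -
  have "(\<lambda>j. conn_arg M \<phi>s (s j \<circ> \<pi>)) \<longlonglongrightarrow> (\<lambda>i. if i < length \<phi>s then p (\<phi>s ! i) \<pi> else 0)"
    unfolding LIMSEQ_fun_iff conn_arg_def by (auto intro!: p_lim \<phi>s[rule_format] nth_mem)
  then have "(\<lambda>j. u (conn_arg M \<phi>s (s j \<circ> \<pi>))) \<longlonglongrightarrow> u (\<lambda>i. if i < length \<phi>s then p (\<phi>s ! i) \<pi> else 0)"
    using u by (intro isCont_tendsto_compose[of _ u]) (auto simp: continuous_on_eq_continuous_at)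
  then show ?thesis unfolding p_def eval_Conn by (rule limI)
qed

lemma E_Conn:
  assumes u: "continuous_on UNIV u" and \<phi>s: "\<forall>\<phi>\<in>set \<phi>s. is_formula L \<phi>" and y: "y \<in> seqs N"
  shows "E (Conn u \<phi>s) y = u (\<lambda>i. if i < length \<phi>s then E (\<phi>s ! i) y else 0)"
proof -
  have "(\<lambda>n i. if i < length \<phi>s then p (\<phi>s ! i) (\<lambda>j. approx (y j) n) else 0) \<longlonglongrightarrow>
      (\<lambda>i. if i < length \<phi>s then E (\<phi>s ! i) y else 0)"
    unfolding LIMSEQ_fun_iff by (auto intro!: E_lim \<phi>s[rule_format] seqs_N[OF y] nth_mem)
  then have "(\<lambda>n. u (\<lambda>i. if i < length \<phi>s then p (\<phi>s ! i) (\<lambda>j. approx (y j) n) else 0)) \<longlonglongrightarrow>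
      u (\<lambda>i. if i < length \<phi>s then E (\<phi>s ! i) y else 0)"
    using u by (intro isCont_tendsto_compose[of _ u]) (auto simp: continuous_on_eq_continuous_at)
  then show ?thesis unfolding E_def[of "Conn u \<phi>s"] p_Conn[OF u \<phi>s] by (rule limI)
qed

lemma E_neg: "is_formula L \<phi> \<Longrightarrow> y \<in> seqs N \<Longrightarrow> E (neg \<phi>) y = - E \<phi> y"
  using E_Conn[of "\<lambda>z. - z 0" "[\<phi>]" y] unfolding neg_def
  by (simp add: continuous_on_minus continuous_on_product_coordinates)

lemma E_InfF: "E (InfF i \<phi>) y = - E (SupF i (neg \<phi>)) y" if \<phi>: "is_formula L \<phi>" and y: "y \<in> seqs N"
proof -
  have S: "is_formula L (SupF i (neg \<phi>))" using \<phi> by simp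
  have "p (InfF i \<phi>) \<pi> = - p (SupF i (neg \<phi>)) \<pi>" for \<pi>
    using tendsto_minus[OF p_lim[OF S]] unfolding p_def[of "InfF i \<phi>"] eval_InfF by (rule limI)
  then show ?thesis
    using tendsto_minus[OF E_lim[OF S]] unfolding E_def[of "InfF i \<phi>"] using seqs_N[OF y] by (auto intro: limI)
qed

text \<open>The counterpart of the theorem of Los: the limit model evaluates a formula as the limit
  of its values in \<open>M\<close>.\<close>

lemma eval_N: "is_formula L \<phi> \<Longrightarrow> y \<in> seqs N \<Longrightarrow> eval N \<phi> y = E \<phi> y"
proof (induction \<phi> arbitrary: y)
  case (Dist i j)
  have "(\<lambda>n. p (Dist i j) (\<lambda>i. approx (y i) n)) \<longlonglongrightarrow> dist (y i) (y j)"
    using tendsto_dist[OF approx_lim[OF seqs_N] approx_lim[OF seqs_N], OF Dist(2) Dist(2), of i j]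
    by (simp add: dist_e p_def \<rho>_def)
  then show ?case unfolding E_def by (simp add: limI)
next
  case (Pred P vs)
  have "p (Pred P [0..<length vs]) (\<lambda>i. approx (map y vs ! i) n) = p (Pred P vs) (\<lambda>i. approx (y i) n)" for n
  proof -
    have "map (s j \<circ> (\<lambda>i. approx (map y vs ! i) n)) [0..<length vs] = map (s j \<circ> (\<lambda>i. approx (y i) n)) vs" for j
      by (rule nth_equalityI) auto
    then show ?thesis unfolding p_def eval.simps by metis
  qed
  then show ?case unfolding E_def by (simp add: E_def)
next
  case (Conn u \<phi>s)
  then have u: "continuous_on UNIV u" and \<phi>s: "\<And>\<phi>. \<phi> \<in> set \<phi>s \<Longrightarrow> is_formula L \<phi>"
    unfolding is_formula_Conn by auto
  have "conn_arg N \<phi>s y = (\<lambda>i. if i < length \<phi>s then E (\<phi>s ! i) y else 0)"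
    unfolding conn_arg_def using Conn.IH \<phi>s Conn.prems(2) by auto
  then show ?case using E_Conn[of u \<phi>s y] u \<phi>s Conn.prems(2) by (simp add: eval_Conn del: eval.simps)
next
  case (SupF i \<phi>)
  have "E \<phi> (y(i := x)) = eval N \<phi> (y(i := x))" if "x \<in> X" for x
    using SupF.prems that by (intro SupF.IH[symmetric]) (simp_all del: fun_upd_apply)
  then show ?case using SupF.prems E_SupF[of \<phi> y i] by simp
next
  case (InfF i \<phi>)
  then have \<phi>: "is_formula L \<phi>" "is_formula L (neg \<phi>)" by auto
  \<comment> \<open>The induction hypothesis concerns \<open>\<phi>\<close>, not
    \<open>neg \<phi>\<close>; the sign passes through both evaluations.\<close>
  have "E (neg \<phi>) (y(i := x)) = eval N (neg \<phi>) (y(i := x))" if x: "x \<in> X" for x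
  proof -
    have yx: "y(i := x) \<in> seqs N" using InfF.prems x by simp
    show ?thesis unfolding eval_neg InfF.IH[OF \<phi>(1) yx] E_neg[OF \<phi>(1) yx] ..
  qed
  then have "eval N (SupF i (neg \<phi>)) y = E (SupF i (neg \<phi>)) y"
    using E_SupF[OF \<phi>(2) InfF.prems(2)] by simp
  then show ?case using E_InfF[OF \<phi>(1) InfF.prems(2)] unfolding eval_InfF by simp
qed

lemma N_model: "model_of L (theory_of L M) N"
  unfolding model_of_def satisfies_def
proof (intro conjI ballI allI impI N_metric_structure)
  fix \<sigma> and y :: "nat \<Rightarrow> nat \<Rightarrow>\<^sub>C real"
  assume \<sigma>: "\<sigma> \<in> theory_of L M" and "range y \<subseteq> mspace (universe N)"
  then have y: "y \<in> seqs N" and f: "is_formula L \<sigma>" by (auto simp: seqs_def theory_of_def sentences_def)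
  have "eval M \<sigma> (s j \<circ> \<pi>) = 0" for j \<pi>
    using \<sigma> seqs_comp[OF s, of j \<pi>] unfolding theory_of_def satisfies_def seqs_def by blast
  then have "p \<sigma> \<pi> = 0" for \<pi> unfolding p_def by simp
  then show "eval N \<sigma> y = 0" unfolding eval_N[OF f y] E_def by simp
qed

text \<open>The place where uniqueness of the separable model enters. The points of \<open>N\<close>
  are functions and not reals, hence the use of \<open>separably_categorical_any_type\<close>; the
  isomorphism onto \<open>M\<close> carries the dense sequence \<open>e\<close> to a realisation of
  the limit type.\<close>

theorem realized:
  assumes cat: "separably_categorical L M"
  obtains t where "t \<in> seqs M" "\<And>x \<eta>. x \<in> mspace (universe M) \<Longrightarrow> \<eta> > 0 \<Longrightarrow> \<exists>k. d (t k) x < \<eta>"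
    "\<And>\<phi>. is_formula L \<phi> \<Longrightarrow> (\<lambda>j. eval M \<phi> (s j)) \<longlonglongrightarrow> eval M \<phi> t"
proof -
  obtain f where f: "isomorphism L N M f"
    using separably_categorical_any_type[OF cat N_model N_separable] unfolding isomorphic_def by blast
  have im: "f ` X = mspace (universe M)" using f by (simp add: isomorphism_def bij_betw_def)
  have eN: "e \<in> seqs N" by (rule seqs_I) simp
  show ?thesis
  proof (rule that[of "f \<circ> e"])
    show "f \<circ> e \<in> seqs M" using im by (auto intro!: seqs_I)
    show "\<exists>k. d ((f \<circ> e) k) x < \<eta>" if x: "x \<in> mspace (universe M)" and "\<eta> > 0" for x \<eta>
    proof -
      obtain y where y: "y \<in> X" "x = f y" using x im by blast
      obtain n where "1 / Suc n < \<eta>" using \<open>\<eta> > 0\<close> by (meson nat_approx_posE)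
      then have "dist (e (approx y n)) y < \<eta>" using approx[OF y(1), of n] by linarith
      moreover have "d (f (e (approx y n))) (f y) = dist (e (approx y n)) y"
        using f y(1) by (simp add: isomorphism_def)
      ultimately show ?thesis using y(2) by (intro exI[of _ "approx y n"]) simp
    qed
    fix \<phi> assume \<phi>: "is_formula L \<phi>"
    have "eval M \<phi> (f \<circ> e) = E \<phi> e"
      using eval_isomorphism[OF f \<phi>, of e] eval_N[OF \<phi> eN] eN by (simp add: seqs_def)
    also have "\<dots> = p \<phi> id" using E_e[OF \<phi>, of id] by simp
    finally show "(\<lambda>j. eval M \<phi> (s j)) \<longlonglongrightarrow> eval M \<phi> (f \<circ> e)"
      using p_lim[OF \<phi>, of id] by simp
  qed
qed

end

section \<open>The logic topology\<close>

locale sep_cat =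
  fixes L :: "'r language" and M :: "('a, 'r) mstructure"
  assumes cat: "separably_categorical L M"
    and countable_language: "countable_language_up_to_interdef L M"
begin

abbreviation "S \<equiv> mspace (universe M)"
abbreviation "d \<equiv> mdist (universe M)"
abbreviation "ev \<equiv> eval M"

lemma ms: "metric_structure L M" and separable: "separable_structure M"
  using cat unfolding separably_categorical_def by auto

lemma S_nonempty: "S \<noteq> {}"
  using ms by (simp add: metric_structure_def)

text \<open>Up to equality of types these are the basic open sets of the logic topology on types in
  countably many variables.\<close>

definition opn :: "(nat \<Rightarrow> 'a) set \<Rightarrow> bool" where
  "opn U \<longleftrightarrow> (\<exists>\<phi>. is_formula L \<phi> \<and> U = {s \<in> seqs M. 0 < ev \<phi> s})"

lemma formula_affine:
  assumes "is_formula L \<phi>"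
  obtains \<psi> where "is_formula L \<psi>" "\<And>s. ev \<psi> s = c * ev \<phi> s + r"
proof
  show "is_formula L (Conn (\<lambda>z. c * z 0 + r) [\<phi>])"
    using assms by (auto intro!: continuous_intros continuous_on_product_coordinates)
qed simp

lemma formula_min:
  assumes "is_formula L \<phi>" "is_formula L \<psi>"
  obtains \<theta> where "is_formula L \<theta>" "\<And>s. ev \<theta> s = min (ev \<phi> s) (ev \<psi> s)"
proof
  show "is_formula L (Conn (\<lambda>z. min (z 0) (z 1)) [\<phi>, \<psi>])"
    using assms by (auto intro!: continuous_on_min continuous_on_product_coordinates)
qed simp

lemma opn_subset: "opn U \<Longrightarrow> U \<subseteq> seqs M"
  by (auto simp: opn_def)

lemma opn_less:
  assumes "is_formula L \<phi>"
  shows "opn {s \<in> seqs M. r < ev \<phi> s}" "opn {s \<in> seqs M. ev \<phi> s < r}"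
proof -
  obtain \<psi> where "is_formula L \<psi>" "\<And>s. ev \<psi> s = 1 * ev \<phi> s + - r" using formula_affine[OF assms] by metis
  then show "opn {s \<in> seqs M. r < ev \<phi> s}" unfolding opn_def by (intro exI[of _ \<psi>]) auto
  obtain \<psi> where "is_formula L \<psi>" "\<And>s. ev \<psi> s = (-1) * ev \<phi> s + r" using formula_affine[OF assms] by metis
  then show "opn {s \<in> seqs M. ev \<phi> s < r}" unfolding opn_def by (intro exI[of _ \<psi>]) auto
qed

lemma opn_seqs: "opn (seqs M)"
  unfolding opn_def by (intro exI[of _ "Conn (\<lambda>_. 1) []"]) simp

lemma opn_Int:
  assumes "opn U" "opn V"
  shows "opn (U \<inter> V)"
proof -
  obtain \<phi> \<psi> where f: "is_formula L \<phi>" "is_formula L \<psi>" and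
    UV: "U = {s \<in> seqs M. 0 < ev \<phi> s}" "V = {s \<in> seqs M. 0 < ev \<psi> s}"
    using assms unfolding opn_def by auto
  obtain \<theta> where "is_formula L \<theta>" "\<And>s. ev \<theta> s = min (ev \<phi> s) (ev \<psi> s)"
    using formula_min[OF f] by metis
  then show ?thesis unfolding opn_def UV by (intro exI[of _ \<theta>]) auto
qed

lemma opn_comp:
  assumes "opn U"
  shows "opn {s \<in> seqs M. s \<circ> \<pi> \<in> U}"
proof -
  obtain \<phi> where f: "is_formula L \<phi>" and U: "U = {s \<in> seqs M. 0 < ev \<phi> s}"
    using assms unfolding opn_def by auto
  obtain \<psi> where "is_formula L \<psi>" "\<And>s. ev \<psi> s = ev \<phi> (s \<circ> \<pi>)" using formula_rename[OF f] by metis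
  then show ?thesis unfolding opn_def U by (intro exI[of _ \<psi>]) auto
qed

lemma opn_support:
  assumes "opn U"
  obtains K where "\<And>s t. s \<in> U \<Longrightarrow> t \<in> seqs M \<Longrightarrow> (\<And>i. i < K \<Longrightarrow> s i = t i) \<Longrightarrow> t \<in> U"
proof -
  obtain \<phi> where U: "U = {s \<in> seqs M. 0 < ev \<phi> s}"
    using assms unfolding opn_def by auto
  obtain K where K: "free_vars \<phi> \<subseteq> {..<K}" using finite_nat_iff_bounded[of "free_vars \<phi>"] by auto
  have "t \<in> U" if "s \<in> U" "t \<in> seqs M" "\<And>i. i < K \<Longrightarrow> s i = t i" for s t
  proof -
    have "ev \<phi> s = ev \<phi> t" by (rule eval_cong) (use K that in auto)
    then show ?thesis using that U by auto
  qed
  then show ?thesis using that by blast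
qed

text \<open>Subtracting half of the value at \<open>y\<close> leaves room between an open condition
  and a closed one. Closed conditions survive limits of types.\<close>

lemma opn_regular:
  assumes "opn U" "y \<in> U"
  obtains \<phi> where "is_formula L \<phi>" "0 < ev \<phi> y" "\<And>v. v \<in> seqs M \<Longrightarrow> 0 \<le> ev \<phi> v \<Longrightarrow> v \<in> U"
proof -
  obtain \<psi> where f: "is_formula L \<psi>" and U: "U = {s \<in> seqs M. 0 < ev \<psi> s}"
    using assms unfolding opn_def by auto
  obtain \<phi> where \<phi>: "is_formula L \<phi>" "\<And>s. ev \<phi> s = 1 * ev \<psi> s + - (ev \<psi> y / 2)"
    using formula_affine[OF f] by metis
  show ?thesis by (rule that[OF \<phi>(1)]) (use assms(2) in \<open>auto simp: U \<phi>(2)\<close>)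
qed

section \<open>Projections and thickenings of open sets\<close>

lemma less_eval_SupF:
  assumes "is_formula L \<phi>" "s \<in> seqs M"
  shows "r < ev (SupF i \<phi>) s \<longleftrightarrow> (\<exists>x\<in>S. r < ev \<phi> (s(i := x)))"
proof -
  obtain B where "\<forall>s\<in>seqs M. \<bar>ev \<phi> s\<bar> \<le> B" using formula_bounded[OF ms assms(1)] by blast
  then have "bdd_above ((\<lambda>x. ev \<phi> (s(i := x))) ` S)"
    using assms(2) by (intro bdd_aboveI2[where M = B]) (simp add: abs_le_iff)
  then show ?thesis by (simp add: less_cSUP_iff S_nonempty)
qed

text \<open>Phrased through \<open>r < ev \<psi> s\<close> for all \<open>r\<close>, because strict
  lower bounds turn suprema into existential quantifiers even when suprema are not attained.\<close>

lemma formula_sups: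
  assumes "finite F" "is_formula L \<phi>"
  shows "\<exists>\<psi>. is_formula L \<psi> \<and> (\<forall>s\<in>seqs M. \<forall>r. r < ev \<psi> s \<longleftrightarrow>
    (\<exists>t\<in>seqs M. (\<forall>i. i \<notin> F \<longrightarrow> t i = s i) \<and> r < ev \<phi> t))"
  using assms(1)
proof (induction F)
  case empty
  have "(\<exists>t\<in>seqs M. (\<forall>i. t i = s i) \<and> r < ev \<phi> t) \<longleftrightarrow> r < ev \<phi> s" if "s \<in> seqs M" for s r
    using that by (metis ext)
  then show ?case using assms(2) by (intro exI[of _ \<phi>]) simp
next
  case (insert k F)
  then obtain \<psi> where \<psi>: "is_formula L \<psi>" "\<And>s r. s \<in> seqs M \<Longrightarrow> r < ev \<psi> s \<longleftrightarrow>
    (\<exists>t\<in>seqs M. (\<forall>i. i \<notin> F \<longrightarrow> t i = s i) \<and> r < ev \<phi> t)" by blast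
  have "(\<exists>x\<in>S. \<exists>t\<in>seqs M. (\<forall>i. i \<notin> F \<longrightarrow> t i = (s(k := x)) i) \<and> r < ev \<phi> t) \<longleftrightarrow>
    (\<exists>t\<in>seqs M. (\<forall>i. i \<notin> insert k F \<longrightarrow> t i = s i) \<and> r < ev \<phi> t)" (is "?l \<longleftrightarrow> ?r") for s r
  proof
    assume ?r
    then obtain t where t: "t \<in> seqs M" "\<forall>i. i \<notin> insert k F \<longrightarrow> t i = s i" "r < ev \<phi> t" by blast
    then have "\<forall>i. i \<notin> F \<longrightarrow> t i = (s(k := t k)) i" by auto
    then show ?l using t by (meson seqs_D)
  next
    assume ?l
    then obtain x t where "t \<in> seqs M" "\<forall>i. i \<notin> F \<longrightarrow> t i = (s(k := x)) i" "r < ev \<phi> t" by blast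
    then show ?r by (intro bexI[of _ t]) auto
  qed
  then show ?case using \<psi>
    by (intro exI[of _ "SupF k \<psi>"]) (simp add: less_eval_SupF del: eval.simps(4) fun_upd_apply)
qed

text \<open>The formula is the minimum of \<open>\<phi>\<close> and of all
  \<open>\<epsilon> - d (s (K + i)) (s i)\<close>; it compares a tuple stored from \<open>K\<close>
  on with the one stored at the beginning.\<close>

lemma formula_min_dist:
  fixes m :: nat
  assumes "is_formula L \<phi>"
  shows "\<exists>\<psi>. is_formula L \<psi> \<and> (\<forall>s r. r < ev \<psi> s \<longleftrightarrow> r < ev \<phi> s \<and> (\<forall>i<m. d (s (K + i)) (s i) < \<epsilon> - r))"
proof (induction m)
  case 0
  then show ?case using assms by auto
next
  case (Suc m)
  then obtain \<psi> where \<psi>: "is_formula L \<psi>" "\<And>s r. r < ev \<psi> s \<longleftrightarrow> r < ev \<phi> s \<and> (\<forall>i<m. d (s (K + i)) (s i) < \<epsilon> - r)"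
    by blast
  obtain \<psi>' where \<psi>': "is_formula L \<psi>'" "\<And>s. ev \<psi>' s = (-1) * ev (Dist (K + m) m) s + \<epsilon>"
    using formula_affine[of "Dist (K + m) m" "-1" \<epsilon>] by auto
  obtain \<theta> where \<theta>: "is_formula L \<theta>" "\<And>s. ev \<theta> s = min (ev \<psi> s) (ev \<psi>' s)"
    using formula_min[OF \<psi>(1) \<psi>'(1)] by metis
  have "r < ev \<theta> s \<longleftrightarrow> r < ev \<phi> s \<and> (\<forall>i<Suc m. d (s (K + i)) (s i) < \<epsilon> - r)" for r s
    unfolding \<theta>(2) less_Suc_eq using \<psi>(2)[of r s] \<psi>'(2)[of s] by auto
  then show ?case using \<theta>(1) by blast
qed

text \<open>\<open>\<psi>\<close> is the supremum over \<open>u\<close> of the minimum of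
  \<open>ev \<phi> u\<close> and all \<open>\<epsilon> - d (u i) (v i)\<close>. Level 0 describes
  the thickening of an open set; the other levels measure how deep inside \<open>v\<close> lies, as
  needed in \<open>opn_separate\<close>.\<close>

lemma formula_thicken:
  assumes "is_formula L \<phi>"
  obtains \<psi> where "is_formula L \<psi>" "\<And>v r. v \<in> seqs M \<Longrightarrow>
    r < ev \<psi> v \<longleftrightarrow> (\<exists>u\<in>seqs M. r < ev \<phi> u \<and> (\<forall>i<m. d (u i) (v i) < \<epsilon> - r))"
proof -
  obtain K0 where K0: "free_vars \<phi> \<subseteq> {..<K0}" using finite_nat_iff_bounded[of "free_vars \<phi>"] by auto
  \<comment> \<open>Beyond all relevant variables, so that the copy of \<open>u\<close> in
    \<open>{K..<2*K}\<close> does not interfere with \<open>v\<close>.\<close>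
  define K where "K = max K0 m"
  have K: "i < K" if "i \<in> free_vars \<phi> \<or> i < m" for i using that K0 by (auto simp: K_def)
  obtain \<phi>' where \<phi>': "is_formula L \<phi>'" "\<And>s. ev \<phi>' s = ev \<phi> (s \<circ> (\<lambda>i. K + i))"
    using formula_rename[OF assms] by metis
  obtain \<theta> where \<theta>: "is_formula L \<theta>"
    "\<And>s r. r < ev \<theta> s \<longleftrightarrow> r < ev \<phi>' s \<and> (\<forall>i<m. d (s (K + i)) (s i) < \<epsilon> - r)"
    using formula_min_dist[OF \<phi>'(1), of m K \<epsilon>] by blast
  have "finite {K..<2*K}" by simp
  then obtain \<psi> where \<psi>: "is_formula L \<psi>" "\<And>s r. s \<in> seqs M \<Longrightarrow> r < ev \<psi> s \<longleftrightarrow>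
    (\<exists>t\<in>seqs M. (\<forall>i. i \<notin> {K..<2*K} \<longrightarrow> t i = s i) \<and> r < ev \<theta> t)"
    using formula_sups[OF _ \<theta>(1), of "{K..<2*K}"] by blast
  have "r < ev \<psi> v \<longleftrightarrow> (\<exists>u\<in>seqs M. r < ev \<phi> u \<and> (\<forall>i<m. d (u i) (v i) < \<epsilon> - r))" (is "?l \<longleftrightarrow> ?r")
    if v: "v \<in> seqs M" for v r
  proof
    assume ?l
    then obtain t where t: "t \<in> seqs M" "\<forall>i. i \<notin> {K..<2*K} \<longrightarrow> t i = v i" "r < ev \<theta> t" using \<psi>(2)[OF v] by blast
    have "d ((t \<circ> (\<lambda>i. K + i)) i) (v i) < \<epsilon> - r" if "i < m" for i
    proof -
      have "t i = v i" using t(2) K[of i] that by auto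
      then show ?thesis using t(3) that unfolding \<theta>(2) by (metis comp_apply)
    qed
    moreover have "r < ev \<phi> (t \<circ> (\<lambda>i. K + i))" using t(3) unfolding \<theta>(2) \<phi>'(2) by blast
    ultimately show ?r using t(1) by (meson seqs_comp)
  next
    assume ?r
    then obtain u where u: "u \<in> seqs M" "r < ev \<phi> u" "\<And>i. i < m \<Longrightarrow> d (u i) (v i) < \<epsilon> - r" by blast
    define t where "t i = (if i \<in> {K..<2*K} then u (i - K) else v i)" for i
    have t: "t \<in> seqs M" using u(1) v by (intro seqs_I) (simp add: t_def)
    have tK: "t (K + i) = u i" "t i = v i" if "i < K" for i using that by (auto simp: t_def)
    have "ev \<phi>' t = ev \<phi> u" unfolding \<phi>'(2) by (rule eval_cong) (use K tK in auto)
    moreover have "d (t (K + i)) (t i) < \<epsilon> - r" if "i < m" for i using u(3)[OF that] tK[OF K] that by simp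
    ultimately have "r < ev \<theta> t" unfolding \<theta>(2) using u(2) by simp
    then show ?l unfolding \<psi>(2)[OF v] using t by (intro bexI[of _ t]) (auto simp: t_def)
  qed
  then show ?thesis using that \<psi>(1) by blast
qed

definition close :: "nat \<Rightarrow> real \<Rightarrow> (nat \<Rightarrow> 'a) \<Rightarrow> (nat \<Rightarrow> 'a) \<Rightarrow> bool" where
  "close m \<epsilon> u v \<longleftrightarrow> (\<forall>i<m. d (u i) (v i) < \<epsilon>)"

lemma close_triangle:
  assumes "close m \<epsilon> u v" "close m \<epsilon>' v w" "u \<in> seqs M" "v \<in> seqs M" "w \<in> seqs M"
  shows "close m (\<epsilon> + \<epsilon>') u w"
  unfolding close_def
proof (intro allI impI)
  fix i assume "i < m"
  then have "d (u i) (v i) < \<epsilon>" "d (v i) (w i) < \<epsilon>'" using assms by (auto simp: close_def)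
  moreover have "d (u i) (w i) \<le> d (u i) (v i) + d (v i) (w i)" using assms by (intro mdist_triangle) auto
  ultimately show "d (u i) (w i) < \<epsilon> + \<epsilon>'" by linarith
qed

lemma close_mono: "close m \<epsilon> u v \<Longrightarrow> \<epsilon> \<le> \<epsilon>' \<Longrightarrow> m' \<le> m \<Longrightarrow> close m' \<epsilon>' u v"
  unfolding close_def by (meson order_less_le_trans)

lemma opn_thicken:
  assumes "opn U"
  shows "opn {v \<in> seqs M. \<exists>u\<in>U. close m \<epsilon> u v}"
proof -
  obtain \<phi> where \<phi>: "is_formula L \<phi>" and U: "U = {s \<in> seqs M. 0 < ev \<phi> s}"
    using assms unfolding opn_def by auto
  obtain \<psi> where \<psi>: "is_formula L \<psi>" "\<And>v r. v \<in> seqs M \<Longrightarrow>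
    r < ev \<psi> v \<longleftrightarrow> (\<exists>u\<in>seqs M. r < ev \<phi> u \<and> (\<forall>i<m. d (u i) (v i) < \<epsilon> - r))"
    using formula_thicken[OF \<phi>, of m \<epsilon>] by blast
  have "0 < ev \<psi> v \<longleftrightarrow> (\<exists>u\<in>U. close m \<epsilon> u v)" if "v \<in> seqs M" for v
    using \<psi>(2)[OF that, of 0] unfolding U close_def by auto
  then show ?thesis unfolding opn_def using \<psi>(1) by (intro exI[of _ \<psi>]) auto
qed

text \<open>The complement of a thickening need not be open, but two radii leave room: the
  thickening formula is at most 0 outside the larger thickening and at least \<open>r0\<close> close
  to \<open>z\<close>, so \<open>Q\<close> is the set where it is below \<open>r0\<close>.\<close>

lemma opn_separate:
  assumes "opn U" "z \<in> U" "\<epsilon> < \<epsilon>'"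
  obtains Q where "opn Q" "\<And>v. v \<in> seqs M \<Longrightarrow> \<not> (\<exists>u\<in>U. close m \<epsilon>' u v) \<Longrightarrow> v \<in> Q"
    "\<And>v. v \<in> Q \<Longrightarrow> \<not> close m \<epsilon> v z"
proof -
  obtain \<phi> where \<phi>: "is_formula L \<phi>" and U: "U = {s \<in> seqs M. 0 < ev \<phi> s}"
    using assms(1) unfolding opn_def by auto
  obtain \<psi> where \<psi>: "is_formula L \<psi>" "\<And>v r. v \<in> seqs M \<Longrightarrow>
    r < ev \<psi> v \<longleftrightarrow> (\<exists>u\<in>seqs M. r < ev \<phi> u \<and> (\<forall>i<m. d (u i) (v i) < \<epsilon>' - r))"
    using formula_thicken[OF \<phi>, of m \<epsilon>'] by blast
  define r0 where "r0 = min (ev \<phi> z) (\<epsilon>' - \<epsilon>)"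
  have r0: "r0 > 0" "r0 \<le> ev \<phi> z" "\<epsilon> \<le> \<epsilon>' - r0" using assms by (auto simp: r0_def U)
  show ?thesis
  proof (rule that[of "{v \<in> seqs M. ev \<psi> v < r0}"])
    show "opn {v \<in> seqs M. ev \<psi> v < r0}" by (rule opn_less[OF \<psi>(1)])
    show "v \<in> {v \<in> seqs M. ev \<psi> v < r0}" if v: "v \<in> seqs M" "\<not> (\<exists>u\<in>U. close m \<epsilon>' u v)" for v
    proof -
      have "\<not> 0 < ev \<psi> v" using \<psi>(2)[OF v(1), of 0] v(2) by (auto simp: U close_def)
      then show ?thesis using v(1) r0(1) by simp
    qed
    show "\<not> close m \<epsilon> v z" if "v \<in> {v \<in> seqs M. ev \<psi> v < r0}" for v
    proof
      assume c: "close m \<epsilon> v z"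
      have v: "v \<in> seqs M" "ev \<psi> v < r0" using that by auto
      have "z \<in> seqs M" "ev \<psi> v < ev \<phi> z" using assms(2) U v r0 by auto
      moreover have "d (z i) (v i) < \<epsilon>' - ev \<psi> v" if "i < m" for i
      proof -
        have "d (z i) (v i) < \<epsilon>" using c that mdist_commute[of "universe M"] by (simp add: close_def)
        then show ?thesis using r0(3) v(2) by linarith
      qed
      \<comment> \<open>The characterisation of \<open>\<psi>\<close> is applied at the level
        \<open>ev \<psi> v\<close> itself, with \<open>z\<close> as witness.\<close>
      ultimately have "ev \<psi> v < ev \<psi> v" unfolding \<psi>(2)[OF v(1)] by blast
      then show False by simp
    qed
  qed
qed

end

section \<open>Generic models\<close>

context sep_cat
begin

text \<open>Open sets serve as forcing conditions. With \<open>A j\<close> the set of all sequences, the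
  construction omits types; with \<open>A j\<close> prescribing the even coordinates, it realises limits of types.
  The odd coordinates are kept free for Henkin witnesses.\<close>

definition large :: "(nat \<Rightarrow> (nat \<Rightarrow> 'a) set) \<Rightarrow> (nat \<Rightarrow> 'a) set \<Rightarrow> bool" where
  "large A U \<longleftrightarrow> (\<exists>\<^sub>\<infinity>j. U \<inter> A j \<noteq> {})"

definition dense_task :: "(nat \<Rightarrow> (nat \<Rightarrow> 'a) set) \<Rightarrow> ((nat \<Rightarrow> 'a) set \<Rightarrow> bool) \<Rightarrow> bool" where
  "dense_task A \<tau> \<longleftrightarrow> (\<forall>U. opn U \<and> large A U \<longrightarrow> (\<exists>V\<subseteq>U. opn V \<and> large A V \<and> \<tau> V))"

text \<open>A descending chain of conditions meets all tasks. Its intersection may be empty in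
  \<open>M\<close>; therefore a point is taken from each condition, and largeness lets these points
  come from \<open>A j\<close> for increasing \<open>j\<close>.\<close>

lemma generic_sequence:
  assumes A: "\<And>j. A j \<subseteq> seqs M" "\<And>j. A j \<noteq> {}"
    and T: "countable T" "\<And>\<tau>. \<tau> \<in> T \<Longrightarrow> dense_task A \<tau>"
  obtains r s where "strict_mono (r :: nat \<Rightarrow> nat)" "\<And>j. s j \<in> A (r j)"
    "\<And>\<tau>. \<tau> \<in> T \<Longrightarrow> \<exists>U. \<tau> U \<and> eventually (\<lambda>j. s j \<in> U) sequentially"
proof -
  \<comment> \<open>The trivial task makes the set non-empty, so that it is the range of an
    enumeration.\<close>
  define \<tau> where "\<tau> = from_nat_into (insert (\<lambda>_. True) T)"
  have "range \<tau> = insert (\<lambda>_. True) T" unfolding \<tau>_def using T(1) by (intro range_from_nat_into) auto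
  then have \<tau>_range: "\<exists>n. \<sigma> = \<tau> n" if "\<sigma> \<in> T" for \<sigma> using that by (metis insertI2 imageE)
  have \<tau>: "dense_task A (\<tau> n)" for n
  proof -
    have "\<tau> n \<in> insert (\<lambda>_. True) T" using \<open>range \<tau> = _\<close> by blast
    then show ?thesis using T(2) unfolding dense_task_def by auto
  qed
  have "\<exists>U. \<forall>n. (opn (U n) \<and> large A (U n)) \<and> (U (Suc n) \<subseteq> U n \<and> \<tau> n (U (Suc n)))"
  proof (rule dependent_nat_choice)
    have "seqs M \<inter> A j \<noteq> {}" for j using A(1)[of j] A(2)[of j] by blast
    then show "\<exists>U. opn U \<and> large A U" unfolding large_def using opn_seqs by (intro exI[of _ "seqs M"]) simp
    show "\<exists>V. (opn V \<and> large A V) \<and> V \<subseteq> U \<and> \<tau> n V" if "opn U \<and> large A U" for U n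
      using \<tau>[of n] that unfolding dense_task_def by blast
  qed
  then obtain U where U: "\<And>n. large A (U n)" "\<And>n. U (Suc n) \<subseteq> U n" "\<And>n. \<tau> n (U (Suc n))" by blast
  have mono: "U n \<subseteq> U m" if "m \<le> n" for m n using U(2) that by (rule lift_Suc_antimono_le)
  have "\<exists>r. \<forall>n. U n \<inter> A (r n) \<noteq> {} \<and> r n < r (Suc n)"
  proof (rule dependent_nat_choice)
    show "\<exists>j. U 0 \<inter> A j \<noteq> {}" using U(1)[of 0] unfolding large_def by (rule INFM_E) blast
    show "\<exists>k. U (Suc n) \<inter> A k \<noteq> {} \<and> j < k" for j n
      using U(1)[of "Suc n"] unfolding large_def INFM_nat by blast
  qed
  then obtain r :: "nat \<Rightarrow> nat" where r: "\<And>n. U n \<inter> A (r n) \<noteq> {}" "\<And>n. r n < r (Suc n)" by blast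
  then have "\<forall>n. \<exists>x. x \<in> U n \<inter> A (r n)" by blast
  then obtain s where s: "\<And>n. s n \<in> U n \<inter> A (r n)" by metis
  show ?thesis
  proof (rule that[of r s])
    show "strict_mono r" using r(2) by (simp add: strict_mono_Suc_iff)
    fix \<sigma> assume "\<sigma> \<in> T"
    then obtain n where n: "\<sigma> = \<tau> n" using \<tau>_range by blast
    have "s j \<in> U (Suc n)" if "Suc n \<le> j" for j using s[of j] mono[OF that] by blast
    then show "\<exists>U. \<sigma> U \<and> eventually (\<lambda>j. s j \<in> U) sequentially"
      using U(3)[of n] n unfolding eventually_sequentially by blast
  qed (use s in blast)
qed

text \<open>The formula is bounded, so its values at points of infinitely many \<open>A j\<close>
  accumulate at some \<open>c\<close>; restricting the condition to values near \<open>c\<close>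
  keeps it large.\<close>

lemma dense_task_oscillation:
  assumes A: "\<And>j. A j \<subseteq> seqs M" and \<phi>: "is_formula L \<phi>" and \<eta>: "\<eta> > 0"
  shows "dense_task A (\<lambda>U. \<exists>c. \<forall>s\<in>U. \<bar>ev \<phi> s - c\<bar> \<le> \<eta>)"
  unfolding dense_task_def
proof (intro allI impI)
  fix U assume U: "opn U \<and> large A U"
  define J where "J = {j. U \<inter> A j \<noteq> {}}"
  have J: "infinite J" using U unfolding large_def J_def by (simp add: frequently_cofinite)
  have "\<forall>j. \<exists>x. j \<in> J \<longrightarrow> x \<in> U \<inter> A j" unfolding J_def by blast
  then obtain w where w: "\<And>j. j \<in> J \<Longrightarrow> w j \<in> U \<inter> A j" by metis
  obtain B where B: "\<forall>s\<in>seqs M. \<bar>ev \<phi> s\<bar> \<le> B" using formula_bounded[OF ms \<phi>] by blast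
  define f where "f n = ev \<phi> (w (enumerate J n))" for n
  have wn: "w (enumerate J n) \<in> U \<inter> A (enumerate J n)" for n by (rule w[OF enumerate_in_set[OF J]])
  have "f n \<in> {-B..B}" for n
    using B wn[of n] A[of "enumerate J n"] unfolding f_def by (auto simp: abs_le_iff minus_le_iff)
  then obtain c q where q: "strict_mono (q :: nat \<Rightarrow> nat)" "(f \<circ> q) \<longlonglongrightarrow> c"
    using compact_Icc[of "-B" B] unfolding compact_eq_seq_compact_metric seq_compact_def by metis
  define V where "V = U \<inter> ({s \<in> seqs M. c - \<eta> < ev \<phi> s} \<inter> {s \<in> seqs M. ev \<phi> s < c + \<eta>})"
  have "eventually (\<lambda>n. c - \<eta> < f (q n) \<and> f (q n) < c + \<eta>) sequentially"
    using order_tendstoD(1)[OF q(2), of "c - \<eta>"] order_tendstoD(2)[OF q(2), of "c + \<eta>"] \<eta>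
    by (simp add: eventually_conj_iff)
  then obtain n0 where n0: "\<And>n. n \<ge> n0 \<Longrightarrow> c - \<eta> < f (q n) \<and> f (q n) < c + \<eta>"
    unfolding eventually_sequentially by blast
  have "V \<inter> A (enumerate J (q n)) \<noteq> {}" if "n \<ge> n0" for n
    using wn[of "q n"] n0[OF that] A unfolding V_def f_def by blast
  moreover have "\<exists>j>k. \<exists>n\<ge>n0. j = enumerate J (q n)" for k
  proof -
    let ?n = "max n0 (Suc k)"
    have "Suc k \<le> ?n" by simp
    also have "?n \<le> q ?n" using q(1) by (rule seq_suble)
    also have "q ?n \<le> enumerate J (q ?n)" using J by (rule le_enumerate)
    finally show ?thesis by (intro exI[of _ "enumerate J (q ?n)"]) (auto intro!: exI[of _ ?n])
  qed
  ultimately have "large A V" unfolding large_def INFM_nat by metis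
  moreover have "opn V" unfolding V_def using U opn_less[OF \<phi>] by (intro opn_Int) auto
  moreover have "\<forall>s\<in>V. \<bar>ev \<phi> s - c\<bar> \<le> \<eta>" unfolding V_def by auto
  ultimately show "\<exists>V\<subseteq>U. opn V \<and> large A V \<and> (\<exists>c. \<forall>s\<in>V. \<bar>ev \<phi> s - c\<bar> \<le> \<eta>)"
    unfolding V_def by blast
qed

text \<open>A condition depends on finitely many coordinates, so an odd coordinate beyond them can
  be overwritten by a witness without leaving the condition or \<open>A j\<close>. The bound
  \<open>N\<close> allows arbitrarily late witnesses, which later yields density of every
  tail.\<close>

lemma dense_task_henkin:
  assumes A: "\<And>j. A j \<subseteq> seqs M" and mod: "\<And>j w k x. w \<in> A j \<Longrightarrow> odd k \<Longrightarrow> x \<in> S \<Longrightarrow> w(k := x) \<in> A j"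
    and \<phi>: "is_formula L \<phi>" and \<eta>: "\<eta> > 0"
  shows "dense_task A (\<lambda>U. \<exists>k\<ge>N. \<forall>s\<in>U. ev (SupF i \<phi>) s - \<eta> \<le> ev \<phi> (s(i := s k)))"
  unfolding dense_task_def
proof (intro allI impI)
  fix U assume U: "opn U \<and> large A U"
  obtain K where K: "\<And>s t. s \<in> U \<Longrightarrow> t \<in> seqs M \<Longrightarrow> (\<And>i. i < K \<Longrightarrow> s i = t i) \<Longrightarrow> t \<in> U"
    using opn_support U by blast
  obtain K' where K': "free_vars \<phi> \<subseteq> {..<K'}" using finite_nat_iff_bounded[of "free_vars \<phi>"] by auto
  define k where "k = 2 * (K + K' + N + i) + 1"
  have k: "odd k" "k \<ge> N" "k \<noteq> i" "k \<ge> K" "k \<notin> free_vars \<phi>" using K' by (auto simp: k_def)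
  obtain \<phi>' where \<phi>': "is_formula L \<phi>'" "\<And>s. ev \<phi>' s = ev \<phi> (s \<circ> id(i := k))"
    using formula_rename[OF \<phi>] by metis
  have upd: "s \<circ> id(i := k) = s(i := s k)" for s :: "nat \<Rightarrow> 'a" by (auto simp: fun_eq_iff)
  \<comment> \<open>The defect of the witness is itself a formula, so the demand on it is an open
    condition.\<close>
  define \<psi> where "\<psi> = Conn (\<lambda>z. z 0 - z 1) [\<phi>', SupF i \<phi>]"
  have \<psi>: "is_formula L \<psi>" using \<phi> \<phi>' unfolding \<psi>_def
    by (auto intro!: continuous_on_diff continuous_on_product_coordinates)
  have ev_\<psi>: "ev \<psi> s = ev \<phi> (s(i := s k)) - ev (SupF i \<phi>) s" for s
    unfolding \<psi>_def eval_Conn by (simp add: conn_arg_def \<phi>'(2) upd)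
  define V where "V = U \<inter> {s \<in> seqs M. - \<eta> < ev \<psi> s}"
  have "V \<inter> A j \<noteq> {}" if ne: "U \<inter> A j \<noteq> {}" for j
  proof -
    obtain s where s: "s \<in> U" "s \<in> A j" using ne by blast
    then have sM: "s \<in> seqs M" using A by blast
    have "ev (SupF i \<phi>) s - \<eta> < ev (SupF i \<phi>) s" using \<eta> by simp
    then obtain x where x: "x \<in> S" "ev (SupF i \<phi>) s - \<eta> < ev \<phi> (s(i := x))"
      unfolding less_eval_SupF[OF \<phi> sM] by blast
    define s' where "s' = s(k := x)"
    have s'M: "s' \<in> seqs M" using sM x by (simp add: s'_def)
    have "s' \<in> A j" unfolding s'_def by (rule mod[OF s(2) k(1) x(1)])
    moreover have "s' \<in> U" by (rule K[OF s(1) s'M]) (use k in \<open>auto simp: s'_def\<close>)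
    moreover have "ev \<phi> (s'(i := s' k)) = ev \<phi> (s(i := x))"
      by (rule eval_cong) (use k in \<open>auto simp: s'_def\<close>)
    moreover have "ev (SupF i \<phi>) s' = ev (SupF i \<phi>) s"
      by (rule eval_cong) (use k in \<open>auto simp: s'_def\<close>)
    ultimately have "s' \<in> V \<inter> A j" using x(2) s'M unfolding V_def ev_\<psi> by simp
    then show ?thesis by blast
  qed
  then have "large A V" using U unfolding large_def by (metis (mono_tags, lifting) INFM_mono)
  moreover have "opn V" unfolding V_def using U opn_less[OF \<psi>] by (intro opn_Int) auto
  moreover have "\<forall>s\<in>V. ev (SupF i \<phi>) s - \<eta> \<le> ev \<phi> (s(i := s k))" unfolding V_def ev_\<psi> by auto
  ultimately show "\<exists>V\<subseteq>U. opn V \<and> large A V \<and> (\<exists>k\<ge>N. \<forall>s\<in>V. ev (SupF i \<phi>) s - \<eta> \<le> ev \<phi> (s(i := s k)))"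
    using k(2) unfolding V_def by blast
qed

text \<open>Deciding a countable dense set of formulas, and providing witnesses for it, up to each
  \<open>1 / Suc n\<close> is enough for all formulas by uniform approximation. The result is a
  \<open>henkin_sequence\<close>, whose limit type is realised in \<open>M\<close>.\<close>

theorem generic_realization:
  assumes A: "\<And>j. A j \<subseteq> seqs M" "\<And>j. A j \<noteq> {}"
    and mod: "\<And>j w k x. w \<in> A j \<Longrightarrow> odd k \<Longrightarrow> x \<in> S \<Longrightarrow> w(k := x) \<in> A j"
    and T: "countable T" "\<And>\<tau>. \<tau> \<in> T \<Longrightarrow> dense_task A \<tau>"
  obtains r s t where "strict_mono (r :: nat \<Rightarrow> nat)" "\<And>j. s j \<in> A (r j)" "t \<in> seqs M"
    "\<And>\<phi>. is_formula L \<phi> \<Longrightarrow> (\<lambda>j. ev \<phi> (s j)) \<longlonglongrightarrow> ev \<phi> t"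
    "\<And>x \<eta> N. x \<in> S \<Longrightarrow> \<eta> > 0 \<Longrightarrow> \<exists>k\<ge>N. d (t k) x < \<eta>"
    "\<And>\<tau>. \<tau> \<in> T \<Longrightarrow> \<exists>U. \<tau> U \<and> eventually (\<lambda>j. s j \<in> U) sequentially"
proof -
  obtain \<F> where \<F>: "countable \<F>" "\<And>\<phi>. \<phi> \<in> \<F> \<Longrightarrow> is_formula L \<phi>"
    "\<And>\<phi> \<epsilon>. is_formula L \<phi> \<Longrightarrow> \<epsilon> > 0 \<Longrightarrow> \<exists>\<psi>\<in>\<F>. near M \<phi> M \<psi> \<epsilon>"
    using countable_dense_formulas_interdef[OF ms countable_language] by blast
  define osc where "osc = (\<lambda>(\<phi>, n :: nat) U. \<exists>c. \<forall>s\<in>U. \<bar>ev \<phi> s - c\<bar> \<le> 1 / Suc n)"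
  define hk where "hk = (\<lambda>(\<phi>, i, n :: nat, N :: nat) U. \<exists>k\<ge>N. \<forall>s\<in>U. ev (SupF i \<phi>) s - 1 / Suc n \<le> ev \<phi> (s(i := s k)))"
  define T' where "T' = T \<union> osc ` (\<F> \<times> UNIV) \<union> hk ` (\<F> \<times> UNIV)"
  have cT': "countable T'" unfolding T'_def using T(1) \<F>(1)
    by (intro countable_Un countable_image countable_SIGMA countableI_type) auto
  have dT': "dense_task A \<tau>" if \<tau>: "\<tau> \<in> T'" for \<tau>
  proof -
    consider "\<tau> \<in> T" | \<phi> n where "\<phi> \<in> \<F>" "\<tau> = osc (\<phi>, n)" | \<phi> i n N where "\<phi> \<in> \<F>" "\<tau> = hk (\<phi>, i, n, N)"
      using \<tau> unfolding T'_def by auto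
    then show ?thesis
    proof cases
      case 1
      then show ?thesis by (rule T(2))
    next
      case 2
      show ?thesis unfolding 2 osc_def prod.case
        by (rule dense_task_oscillation[OF A(1) \<F>(2)[OF 2(1)]]) simp
    next
      case 3
      show ?thesis unfolding 3 hk_def prod.case
        by (rule dense_task_henkin[OF A(1) mod \<F>(2)[OF 3(1)]]) auto
    qed
  qed
  obtain r s where r: "strict_mono (r :: nat \<Rightarrow> nat)" and s: "\<And>j. s j \<in> A (r j)"
    and T': "\<And>\<tau>. \<tau> \<in> T' \<Longrightarrow> \<exists>U. \<tau> U \<and> eventually (\<lambda>j. s j \<in> U) sequentially"
    using generic_sequence[of A T', OF A cT' dT'] by blast
  have sM: "s j \<in> seqs M" for j using s A(1) by blast
  have conv: "convergent (\<lambda>j. ev \<phi> (s j))" if \<phi>: "is_formula L \<phi>" for \<phi>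
  proof -
    have "Cauchy (\<lambda>j. ev \<phi> (s j))"
    proof (rule metric_CauchyI)
      fix \<eta> :: real assume "\<eta> > 0"
      then obtain n where n: "1 / Suc n < \<eta>/4" by (meson nat_approx_posE zero_less_divide_iff zero_less_numeral)
      obtain \<psi> where \<psi>: "\<psi> \<in> \<F>" "near M \<phi> M \<psi> (1 / Suc n)" using \<F>(3)[OF \<phi>, of "1 / Suc n"] by auto
      have "osc (\<psi>, n) \<in> T'" using \<psi>(1) unfolding T'_def by blast
      then obtain U where U: "osc (\<psi>, n) U" "eventually (\<lambda>j. s j \<in> U) sequentially" using T' by blast
      then obtain c where c: "\<And>s. s \<in> U \<Longrightarrow> \<bar>ev \<psi> s - c\<bar> \<le> 1 / Suc n" unfolding osc_def by auto
      obtain J where J: "\<And>j. j \<ge> J \<Longrightarrow> s j \<in> U" using U(2) unfolding eventually_sequentially by blast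
      have *: "\<bar>ev \<phi> (s j) - c\<bar> < \<eta>/2" if "j \<ge> J" for j
      proof -
        have "\<bar>ev \<phi> (s j) - ev \<psi> (s j)\<bar> \<le> 1 / Suc n" using \<psi>(2) sM unfolding near_def by blast
        then show ?thesis using c[OF J[OF that]] n by linarith
      qed
      have "dist (ev \<phi> (s j)) (ev \<phi> (s k)) < \<eta>" if "j \<ge> J" "k \<ge> J" for j k
        using *[OF that(1)] *[OF that(2)] unfolding dist_real_def by linarith
      then show "\<exists>J. \<forall>j\<ge>J. \<forall>k\<ge>J. dist (ev \<phi> (s j)) (ev \<phi> (s k)) < \<eta>" by blast
    qed
    then show ?thesis by (rule Cauchy_convergent)
  qed
  have ev_lim: "(\<lambda>j. ev \<phi> (s j)) \<longlonglongrightarrow> lim (\<lambda>j. ev \<phi> (s j))" if "is_formula L \<phi>" for \<phi>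
    using conv[OF that] by (simp add: convergent_LIMSEQ_iff)
  have henkin: "\<exists>k\<ge>N. lim (\<lambda>j. ev (SupF i \<phi>) (s j)) - \<eta> \<le> lim (\<lambda>j. ev \<phi> ((s j)(i := s j k)))"
    if \<phi>: "is_formula L \<phi>" and \<eta>: "\<eta> > 0" for \<phi> i \<eta> N
  proof -
    \<comment> \<open>Three errors: two from replacing \<open>\<phi>\<close> by
      \<open>\<psi>\<close>, with and without the supremum, and one from the witness.\<close>
    obtain n where n: "1 / Suc n < \<eta>/3" using \<eta> by (meson nat_approx_posE zero_less_divide_iff zero_less_numeral)
    obtain \<psi> where \<psi>: "\<psi> \<in> \<F>" "near M \<phi> M \<psi> (1 / Suc n)" using \<F>(3)[OF \<phi>, of "1 / Suc n"] by auto
    have S: "near M (SupF i \<phi>) M (SupF i \<psi>) (1 / Suc n)"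
      by (rule near_SupF_InfF[OF ms ms refl \<phi> \<F>(2)[OF \<psi>(1)] \<psi>(2)])
    have "hk (\<psi>, i, n, N) \<in> T'" using \<psi>(1) unfolding T'_def by blast
    then obtain U where U: "hk (\<psi>, i, n, N) U" "eventually (\<lambda>j. s j \<in> U) sequentially" using T' by blast
    then obtain k where k: "k \<ge> N" "\<And>s. s \<in> U \<Longrightarrow> ev (SupF i \<psi>) s - 1 / Suc n \<le> ev \<psi> (s(i := s k))"
      unfolding hk_def prod.case by blast
    obtain \<phi>' where \<phi>': "is_formula L \<phi>'" "\<And>s. ev \<phi>' s = ev \<phi> (s \<circ> id(i := k))"
      using formula_rename[OF \<phi>] by metis
    have upd: "ev \<phi>' t = ev \<phi> (t(i := t k))" for t
      unfolding \<phi>'(2) by (rule eval_cong) auto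
    obtain J where J: "\<And>j. j \<ge> J \<Longrightarrow> s j \<in> U" using U(2) unfolding eventually_sequentially by blast
    have "ev (SupF i \<phi>) (s j) \<le> ev \<phi>' (s j) + \<eta>" if "j \<ge> J" for j
    proof -
      have m: "(s j)(i := s j k) \<in> seqs M" using sM by simp
      have "\<bar>ev (SupF i \<phi>) (s j) - ev (SupF i \<psi>) (s j)\<bar> \<le> 1 / Suc n" using S sM unfolding near_def by blast
      moreover have "\<bar>ev \<phi> ((s j)(i := s j k)) - ev \<psi> ((s j)(i := s j k))\<bar> \<le> 1 / Suc n"
        using \<psi>(2) m unfolding near_def by blast
      ultimately show ?thesis using k(2)[OF J[OF that]] n unfolding upd by linarith
    qed
    then have "lim (\<lambda>j. ev (SupF i \<phi>) (s j)) \<le> lim (\<lambda>j. ev \<phi>' (s j)) + \<eta>"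
      by (intro LIMSEQ_le[OF ev_lim tendsto_add[OF ev_lim tendsto_const]])
        (use \<phi> \<phi>' in \<open>auto simp del: eval.simps\<close>)
    then show ?thesis using k(1) unfolding upd by (intro exI[of _ k]) linarith
  qed
  interpret hs: henkin_sequence L M s
    by unfold_locales (use ms sM conv henkin in blast)+
  obtain t where t: "t \<in> seqs M" "\<And>x \<eta>. x \<in> S \<Longrightarrow> \<eta> > 0 \<Longrightarrow> \<exists>k. d (t k) x < \<eta>"
    "\<And>\<phi>. is_formula L \<phi> \<Longrightarrow> (\<lambda>j. ev \<phi> (s j)) \<longlonglongrightarrow> ev \<phi> t"
    using hs.realized[OF cat] by blast
  have "\<exists>k\<ge>N. d (t k) x < \<eta>" if x: "x \<in> S" and \<eta>: "\<eta> > 0" for x \<eta> N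
  proof -
    have h: "\<eta>/2 > 0" using \<eta> by simp
    then obtain i where i: "d (t i) x < \<eta>/2" using t(2) x by blast
    \<comment> \<open>A late witness for the supremum of \<open>- d y (t i)\<close> over
      \<open>y\<close> is an index beyond \<open>N\<close> whose point is close to
      \<open>t i\<close>. The bound variable \<open>Suc i\<close> is merely one different from
      \<open>i\<close>.\<close>
    define \<phi> :: "'r formula" where "\<phi> = neg (Dist (Suc i) i)"
    have \<phi>: "is_formula L \<phi>" by (simp add: \<phi>_def)
    have up: "0 \<le> ev (SupF (Suc i) \<phi>) (s j)" for j
      using eval_SupF_upper[OF ms \<phi> sM[of j], of "s j i" "Suc i"] sM by (simp add: \<phi>_def)
    obtain k where k: "k \<ge> N"
      "lim (\<lambda>j. ev (SupF (Suc i) \<phi>) (s j)) - \<eta>/2 \<le> lim (\<lambda>j. ev \<phi> ((s j)(Suc i := s j k)))"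
      using henkin[OF \<phi> h] by blast
    have "(\<lambda>j. ev (neg (Dist k i)) (s j)) \<longlonglongrightarrow> ev (neg (Dist k i)) t" by (rule t(3)) simp
    then have "lim (\<lambda>j. ev \<phi> ((s j)(Suc i := s j k))) = - d (t k) (t i)"
      unfolding \<phi>_def by (intro limI) simp
    moreover have "0 \<le> lim (\<lambda>j. ev (SupF (Suc i) \<phi>) (s j))"
      by (rule LIMSEQ_le_const[OF ev_lim]) (use \<phi> up in auto)
    moreover have "d (t k) x \<le> d (t k) (t i) + d (t i) x" using t(1) x by (intro mdist_triangle) auto
    ultimately show ?thesis using k i by (intro exI[of _ k]) simp
  qed
  then show ?thesis using that[OF r s t(1) t(3)] T' unfolding T'_def by blast
qed

end

section \<open>Isolated types\<close>

lemma mcomplete_of_LIMSEQ: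
  assumes "mcomplete_of X" "\<And>n. x n \<in> mspace X"
    and "\<And>\<eta>. \<eta> > 0 \<Longrightarrow> \<exists>N. \<forall>n m. N \<le> n \<and> N \<le> m \<longrightarrow> mdist X (x n) (x m) < \<eta>"
  obtains l where "l \<in> mspace X" "\<And>\<eta>. \<eta> > 0 \<Longrightarrow> eventually (\<lambda>n. mdist X (x n) l < \<eta>) sequentially"
proof -
  interpret Metric_space "mspace X" "mdist X" by simp
  have "MCauchy x" unfolding MCauchy_def using assms(2,3) by blast
  then obtain l where l: "limitin mtopology x l sequentially"
    using assms(1) unfolding mcomplete_of_def mcomplete_def by blast
  then have "l \<in> mspace X" "\<And>\<eta>. \<eta> > 0 \<Longrightarrow> eventually (\<lambda>n. mdist X (x n) l < \<eta>) sequentially"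
    unfolding limitin_metric by (auto elim: eventually_mono)
  then show ?thesis using that by blast
qed

text \<open>The start \<open>n0\<close> matters for back-and-forth, where a coordinate is controlled
  only from the stage at which it is chosen. The factor 2 sums the geometric tail.\<close>

lemma geometric_limit:
  assumes X: "mcomplete_of X" and x: "\<And>n. x n \<in> mspace X"
    and step: "\<And>n. n \<ge> n0 \<Longrightarrow> mdist X (x (Suc n)) (x n) \<le> C * (1/2)^n"
  obtains l where "l \<in> mspace X" "\<And>n. n \<ge> n0 \<Longrightarrow> mdist X l (x n) \<le> 2 * C * (1/2)^n"
    "\<And>\<eta>. \<eta> > 0 \<Longrightarrow> eventually (\<lambda>n. mdist X (x n) l < \<eta>) sequentially"
proof -
  have "0 \<le> C * (1/2)^n0" using step[of n0] mdist_nonneg[of X] by (meson order_trans order_refl)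
  then have C: "C \<ge> 0" using mult_le_cancel_right_pos[of "(1/2)^n0" 0 C] by simp
  have dist: "mdist X (x (n + k)) (x n) \<le> 2 * C * (1/2)^n" if n: "n \<ge> n0" for n k
  proof -
    have "mdist X (x (n + k)) (x n) \<le> 2 * C * ((1/2)^n - (1/2)^(n + k))"
    proof (induction k)
      case (Suc k)
      have "mdist X (x (n + Suc k)) (x n) \<le> mdist X (x (Suc (n + k))) (x (n + k)) + mdist X (x (n + k)) (x n)"
        using mdist_triangle[OF x[of "Suc (n + k)"] x[of "n + k"] x[of n]] by simp
      also have "\<dots> \<le> C * (1/2)^(n + k) + 2 * C * ((1/2)^n - (1/2)^(n + k))"
        using step[of "n + k"] n Suc by linarith
      also have "\<dots> = 2 * C * ((1/2)^n - (1/2)^(n + Suc k))" by (simp add: algebra_simps)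
      finally show ?case .
    qed (use x in simp)
    also have "\<dots> \<le> 2 * C * (1/2)^n" using C by (intro mult_left_mono) auto
    finally show ?thesis .
  qed
  have small: "\<exists>N\<ge>n0. 2 * C * (1/2)^N < \<eta>" if "\<eta> > 0" for \<eta>
  proof -
    have "(\<lambda>N. 2 * C * (1/2)^N) \<longlonglongrightarrow> 2 * C * 0" by (intro tendsto_intros LIMSEQ_realpow_zero) auto
    then have "eventually (\<lambda>N. 2 * C * (1/2)^N < \<eta>) sequentially"
      using that by (intro order_tendstoD(2)) auto
    then obtain N where "\<forall>n\<ge>N. 2 * C * (1/2)^n < \<eta>" unfolding eventually_sequentially by blast
    then show ?thesis by (intro exI[of _ "max N n0"]) simp
  qed
  have cauchy: "\<exists>N. \<forall>n m. N \<le> n \<and> N \<le> m \<longrightarrow> mdist X (x n) (x m) < \<eta>" if \<eta>: "\<eta> > 0" for \<eta>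
  proof -
    obtain N where N: "N \<ge> n0" "2 * C * (1/2)^N < \<eta>/2" using small[of "\<eta>/2"] \<eta> by auto
    have *: "mdist X (x n) (x N) < \<eta>/2" if "n \<ge> N" for n
      using dist[OF N(1), of "n - N"] N(2) that by simp
    have "mdist X (x n) (x m) < \<eta>" if "n \<ge> N" "m \<ge> N" for n m
    proof -
      have "mdist X (x n) (x m) \<le> mdist X (x n) (x N) + mdist X (x N) (x m)" by (rule mdist_triangle[OF x x x])
      then show ?thesis using *[OF that(1)] *[OF that(2)] mdist_commute[of X "x N" "x m"] by linarith
    qed
    then show ?thesis by blast
  qed
  obtain l where l: "l \<in> mspace X" "\<And>\<eta>. \<eta> > 0 \<Longrightarrow> eventually (\<lambda>n. mdist X (x n) l < \<eta>) sequentially"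
    using mcomplete_of_LIMSEQ[OF X x cauchy] by blast
  have "mdist X l (x n) \<le> 2 * C * (1/2)^n" if n: "n \<ge> n0" for n
  proof (rule field_le_epsilon)
    fix \<eta> :: real assume "\<eta> > 0"
    then obtain N where "\<And>m. m \<ge> N \<Longrightarrow> mdist X (x m) l < \<eta>"
      using l(2) unfolding eventually_sequentially by blast
    then have "mdist X (x (n + N)) l < \<eta>" by simp
    moreover have "mdist X l (x n) \<le> mdist X l (x (n + N)) + mdist X (x (n + N)) (x n)"
      by (rule mdist_triangle[OF l(1) x x])
    ultimately show "mdist X l (x n) \<le> 2 * C * (1/2)^n + \<eta>"
      using dist[OF n, of N] mdist_commute[of X l] by (smt (verit))
  qed
  then show ?thesis using that l by blast
qed

text \<open>Domain and image lie in a finite set, in which their complements have equal size.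
  Permutations are wanted in \<open>distance_omitting\<close>, where conditions are transported
  along renamings in both directions.\<close>

lemma extend_to_permutation:
  fixes f :: "nat \<Rightarrow> nat"
  assumes f: "inj_on f {..<m}"
  shows "\<exists>\<sigma>. bij \<sigma> \<and> (\<forall>i<m. \<sigma> i = f i)"
proof -
  define E where "E = {..<m} \<union> f ` {..<m}"
  have E: "finite E" "{..<m} \<subseteq> E" "f ` {..<m} \<subseteq> E" by (auto simp: E_def)
  have "card (E - {..<m}) = card (E - f ` {..<m})"
    using E card_image[OF f] by (simp add: card_Diff_subset)
  then obtain h where h: "bij_betw h (E - {..<m}) (E - f ` {..<m})"
    using E(1) by (metis finite_Diff finite_same_card_bij)
  define \<sigma> where "\<sigma> i = (if i < m then f i else if i \<in> E then h i else i)" for i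
  have "bij_betw \<sigma> {..<m} (f ` {..<m})"
    using f by (subst bij_betw_cong[of _ _ f]) (auto simp: \<sigma>_def bij_betw_def)
  moreover have "bij_betw \<sigma> (E - {..<m}) (E - f ` {..<m})"
    using h by (subst bij_betw_cong[of _ _ h]) (auto simp: \<sigma>_def)
  ultimately have "bij_betw \<sigma> ({..<m} \<union> (E - {..<m})) (f ` {..<m} \<union> (E - f ` {..<m}))"
    by (rule bij_betw_combine) auto
  then have "bij_betw \<sigma> E E" using E by (simp add: Un_absorb1)
  moreover have "bij_betw \<sigma> (- E) (- E)"
    using E(2) by (subst bij_betw_cong[of _ _ id]) (auto simp: \<sigma>_def)
  ultimately have "bij_betw \<sigma> (E \<union> - E) (E \<union> - E)" by (rule bij_betw_combine) auto
  then show ?thesis by (intro exI[of _ \<sigma>]) (simp add: \<sigma>_def Compl_partition)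
qed

context sep_cat
begin

text \<open>The distance between the types of the first \<open>m\<close> entries of \<open>y\<close> and \<open>x\<close> is at most \<open>\<epsilon>\<close>;
  it is attained only in a saturated model, hence the approximation of \<open>x\<close> in its type.\<close>

definition tclose :: "nat \<Rightarrow> real \<Rightarrow> (nat \<Rightarrow> 'a) \<Rightarrow> (nat \<Rightarrow> 'a) \<Rightarrow> bool" where
  "tclose m \<epsilon> y x \<longleftrightarrow> (\<forall>U. opn U \<and> x \<in> U \<longrightarrow> (\<exists>u\<in>U. close m \<epsilon> u y))"

text \<open>The definition treats \<open>x\<close> through its neighbourhoods but \<open>y\<close>
  as a point, hence the small loss. If some neighbourhood of \<open>y\<close> had no point close to
  \<open>x\<close>, then \<open>opn_separate\<close> would give a neighbourhood of \<open>x\<close>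
  without points close to \<open>y\<close>.\<close>

lemma tclose_sym:
  assumes "x \<in> seqs M" "y \<in> seqs M" "tclose m \<epsilon> y x" "\<epsilon> < \<epsilon>'"
  shows "tclose m \<epsilon>' x y"
  unfolding tclose_def
proof (intro allI impI, rule ccontr)
  fix U assume U: "opn U \<and> y \<in> U" and no: "\<not> (\<exists>u\<in>U. close m \<epsilon>' u x)"
  obtain Q where Q: "opn Q" "\<And>v. v \<in> seqs M \<Longrightarrow> \<not> (\<exists>u\<in>U. close m \<epsilon>' u v) \<Longrightarrow> v \<in> Q"
    "\<And>v. v \<in> Q \<Longrightarrow> \<not> close m \<epsilon> v y"
    using opn_separate[of U y \<epsilon> \<epsilon>' m] U assms(4) by blast
  then have "x \<in> Q" using assms(1) no by blast
  then show False using assms(3) Q(1,3) unfolding tclose_def by blast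
qed

text \<open>An omitting types argument: the ball around \<open>x\<close> is nowhere dense in the
  sense of \<open>far\<close>, so a generic sequence avoids it at every tuple singled out by a
  permutation. Transporting a condition along \<open>\<sigma>\<close> brings that tuple to the first
  coordinates, where \<open>far\<close> applies.\<close>

lemma distance_omitting:
  assumes x: "x \<in> seqs M" and \<epsilon>: "\<epsilon> > 0" and T: "countable PS" "\<And>\<sigma>. \<sigma> \<in> PS \<Longrightarrow> bij \<sigma>"
    and far: "\<And>U. opn U \<Longrightarrow> U \<noteq> {} \<Longrightarrow> \<exists>V y. opn V \<and> y \<in> U \<inter> V \<and> (\<forall>v\<in>V. \<not> close m \<epsilon> v x)"
  obtains t where "t \<in> seqs M" "\<And>b \<eta> N. b \<in> S \<Longrightarrow> \<eta> > 0 \<Longrightarrow> \<exists>k\<ge>N. d (t k) b < \<eta>"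
    "\<And>\<sigma>. \<sigma> \<in> PS \<Longrightarrow> \<not> close m \<epsilon> (t \<circ> \<sigma>) x"
proof -
  \<comment> \<open>A closed condition \<open>0 \<le> ev \<phi>\<close> that implies avoidance is
    demanded, because it passes to the limit \<open>t\<close>.\<close>
  define omit where "omit \<sigma> U \<longleftrightarrow> (\<exists>\<phi>. is_formula L \<phi> \<and> (\<forall>s\<in>U. 0 \<le> ev \<phi> s) \<and>
      (\<forall>v\<in>seqs M. 0 \<le> ev \<phi> v \<longrightarrow> \<not> close m \<epsilon> (v \<circ> \<sigma>) x))" for \<sigma> and U
  let ?A = "\<lambda>j :: nat. seqs M"
  have large: "large ?A U \<longleftrightarrow> U \<noteq> {}" if "opn U" for U
    using opn_subset[OF that] unfolding large_def by (auto simp: INFM_const)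
  have dense: "dense_task ?A (omit \<sigma>)" if \<sigma>: "\<sigma> \<in> PS" for \<sigma>
    unfolding dense_task_def
  proof (intro allI impI)
    fix U assume U: "opn U \<and> large ?A U"
    have b: "\<sigma> \<circ> inv_into UNIV \<sigma> = id" "inv_into UNIV \<sigma> \<circ> \<sigma> = id"
      using T(2)[OF \<sigma>] by (auto simp: bij_is_surj bij_is_inj surj_iff[symmetric] inj_iff[symmetric])
    obtain u where u: "u \<in> U" using U large by blast
    define Q where "Q = {s \<in> seqs M. s \<circ> inv_into UNIV \<sigma> \<in> U}"
    have uM: "u \<in> seqs M" using u U opn_subset by blast
    have "u \<circ> \<sigma> \<in> Q" using u b seqs_comp[OF uM] by (simp add: Q_def comp_assoc)
    moreover have "opn Q" using U unfolding Q_def by (intro opn_comp) auto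
    ultimately obtain V y where V: "opn V" "y \<in> Q" "y \<in> V" "\<forall>v\<in>V. \<not> close m \<epsilon> v x" using far by blast
    define w where "w = y \<circ> inv_into UNIV \<sigma>"
    have w: "w \<in> U" "w \<circ> \<sigma> = y" using V(2) b by (simp_all add: w_def Q_def comp_assoc)
    then have wM: "w \<in> seqs M" using U opn_subset by blast
    define V' where "V' = {s \<in> seqs M. s \<circ> \<sigma> \<in> V}"
    have "opn V'" "w \<in> V'" using V w wM by (auto simp: V'_def intro: opn_comp)
    then obtain \<phi> where \<phi>: "is_formula L \<phi>" "0 < ev \<phi> w" "\<And>v. v \<in> seqs M \<Longrightarrow> 0 \<le> ev \<phi> v \<Longrightarrow> v \<in> V'"
      using opn_regular by blast
    define U' where "U' = U \<inter> {s \<in> seqs M. 0 < ev \<phi> s}"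
    have U': "opn U'" unfolding U'_def using U opn_less[OF \<phi>(1)] by (intro opn_Int) auto
    have "w \<in> U'" using w wM \<phi> by (simp add: U'_def)
    moreover have "omit \<sigma> U'" unfolding omit_def
      by (rule exI[of _ \<phi>]) (use \<phi> V in \<open>auto simp: U'_def V'_def\<close>)
    ultimately show "\<exists>V\<subseteq>U. opn V \<and> large ?A V \<and> omit \<sigma> V"
      using U' large by (intro exI[of _ U']) (auto simp: U'_def)
  qed
  have ne: "seqs M \<noteq> {}" using x by blast
  have dense': "dense_task ?A \<tau>" if "\<tau> \<in> omit ` PS" for \<tau> using that dense by blast
  show ?thesis
  proof (rule generic_realization[of ?A, OF order_refl ne seqs_upd countable_image[OF T(1), of omit] dense'])
    fix s t and r :: "nat \<Rightarrow> nat"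
    assume t: "t \<in> seqs M"
      "\<And>\<phi>. is_formula L \<phi> \<Longrightarrow> (\<lambda>j. ev \<phi> (s j)) \<longlonglongrightarrow> ev \<phi> t"
      "\<And>x \<eta> N. x \<in> S \<Longrightarrow> \<eta> > 0 \<Longrightarrow> \<exists>k\<ge>N. d (t k) x < \<eta>"
      and om: "\<And>\<tau>. \<tau> \<in> omit ` PS \<Longrightarrow> \<exists>U. \<tau> U \<and> eventually (\<lambda>j. s j \<in> U) sequentially"
  have "\<not> close m \<epsilon> (t \<circ> \<sigma>) x" if \<sigma>: "\<sigma> \<in> PS" for \<sigma>
  proof -
    obtain U where U: "omit \<sigma> U" "eventually (\<lambda>j. s j \<in> U) sequentially" using om \<sigma> by blast
    then obtain \<phi> where \<phi>: "is_formula L \<phi>" "\<forall>s\<in>U. 0 \<le> ev \<phi> s"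
      "\<forall>v\<in>seqs M. 0 \<le> ev \<phi> v \<longrightarrow> \<not> close m \<epsilon> (v \<circ> \<sigma>) x" unfolding omit_def by blast
    have "0 \<le> ev \<phi> t"
    proof (rule tendsto_lowerbound[OF t(2)[OF \<phi>(1)]])
      show "eventually (\<lambda>j. 0 \<le> ev \<phi> (s j)) sequentially"
        using U(2) by (rule eventually_mono) (use \<phi>(2) in blast)
    qed simp
    then show ?thesis using \<phi>(3) t(1) by blast
  qed
  then show thesis using that[OF t(1,3)] by blast
  qed
qed

text \<open>If types close to that of \<open>x\<close> could be far from it in the metric, then a generic separable model
  would contain no tuple close to \<open>x\<close>, although it is isomorphic to \<open>M\<close>.\<close>

lemma types_isolated:
  assumes x: "x \<in> seqs M" and \<epsilon>: "\<epsilon> > 0"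
  obtains W where "opn W" "x \<in> W" "\<And>y. y \<in> W \<Longrightarrow> tclose m \<epsilon> y x"
proof (rule ccontr)
  note out = that
  assume "\<not> thesis"
  then have H: "\<exists>y\<in>W. \<not> tclose m \<epsilon> y x" if "opn W" "x \<in> W" for W using that out by blast
  \<comment> \<open>A condition without points within \<open>\<epsilon>/2\<close> of
    \<open>x\<close> already avoids the ball. Otherwise its thickening is a neighbourhood of
    \<open>x\<close> and contains some \<open>y\<close> whose type is far from that of
    \<open>x\<close>; a point of \<open>Q\<close> near \<open>y\<close> still lies outside the
    \<open>\<epsilon>/2\<close>-thickening of a neighbourhood of \<open>x\<close>, and separation
    applies.\<close>
  have far: "\<exists>V y. opn V \<and> y \<in> Q \<inter> V \<and> (\<forall>v\<in>V. \<not> close m (\<epsilon>/4) v x)" if Q: "opn Q" "Q \<noteq> {}" for Q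
  proof (cases "\<exists>z\<in>Q. close m (\<epsilon>/2) z x")
    case True
    define W where "W = {y \<in> seqs M. \<exists>z\<in>Q. close m (\<epsilon>/2) z y}"
    have "opn W" unfolding W_def by (rule opn_thicken[OF Q(1)])
    moreover have "x \<in> W" using True x by (simp add: W_def)
    ultimately obtain y where y: "y \<in> W" "\<not> tclose m \<epsilon> y x" using H by blast
    obtain U where U: "opn U" "x \<in> U" "\<And>u. u \<in> U \<Longrightarrow> \<not> close m \<epsilon> u y" using y(2) unfolding tclose_def by blast
    obtain z where z: "z \<in> Q" "close m (\<epsilon>/2) z y" "y \<in> seqs M" using y(1) unfolding W_def by blast
    have zM: "z \<in> seqs M" using z Q opn_subset by blast
    have no: "\<not> (\<exists>u\<in>U. close m (\<epsilon>/2) u z)"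
    proof
      assume "\<exists>u\<in>U. close m (\<epsilon>/2) u z"
      then obtain u where u: "u \<in> U" "close m (\<epsilon>/2) u z" by blast
      moreover have "u \<in> seqs M" using u U opn_subset by blast
      ultimately have "close m (\<epsilon>/2 + \<epsilon>/2) u y" using z zM by (intro close_triangle[OF u(2) z(2)])
      then show False using U(3)[OF u(1)] by simp
    qed
    have "\<epsilon>/4 < \<epsilon>/2" using \<epsilon> by simp
    then obtain V where V: "opn V" "\<And>v. v \<in> seqs M \<Longrightarrow> \<not> (\<exists>u\<in>U. close m (\<epsilon>/2) u v) \<Longrightarrow> v \<in> V"
      "\<And>v. v \<in> V \<Longrightarrow> \<not> close m (\<epsilon>/4) v x"
      using opn_separate[OF U(1,2)] by metis
    have "z \<in> V" by (rule V(2)[OF zM no])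
    then show ?thesis using V(1,3) z(1) by blast
  next
    case False
    then have "\<forall>v\<in>Q. \<not> close m (\<epsilon>/4) v x" using close_mono[of m "\<epsilon>/4" _ x "\<epsilon>/2" m] \<epsilon> by auto
    then show ?thesis using Q by blast
  qed
  \<comment> \<open>One permutation for each choice of \<open>m\<close> distinct coordinates; coding
    the choices by lists shows countability.\<close>
  define PS where "PS = (\<lambda>l. SOME \<sigma>. bij \<sigma> \<and> (\<forall>i<m. \<sigma> i = l ! i)) ` {l :: nat list. inj_on ((!) l) {..<m}}"
  have some: "bij (SOME \<sigma>. bij \<sigma> \<and> (\<forall>i<m. \<sigma> i = l ! i)) \<and> (\<forall>i<m. (SOME \<sigma>. bij \<sigma> \<and> (\<forall>i<m. \<sigma> i = l ! i)) i = l ! i)"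
    if "inj_on ((!) l) {..<m}" for l :: "nat list"
    by (rule someI_ex[OF extend_to_permutation[OF that]])
  have PS: "countable PS" "\<And>\<sigma>. \<sigma> \<in> PS \<Longrightarrow> bij \<sigma>"
    unfolding PS_def by (auto simp: some intro: countable_image countable_subset[OF subset_UNIV])
  have e4: "\<epsilon>/4 > 0" using \<epsilon> by simp
  obtain t where t: "t \<in> seqs M" "\<And>b \<eta> N. b \<in> S \<Longrightarrow> \<eta> > 0 \<Longrightarrow> \<exists>k\<ge>N. d (t k) b < \<eta>"
    "\<And>\<sigma>. \<sigma> \<in> PS \<Longrightarrow> \<not> close m (\<epsilon>/4) (t \<circ> \<sigma>) x"
    using distance_omitting[OF x e4 PS far] by metis
  \<comment> \<open>Increasing indices are distinct even where \<open>x\<close> repeats a value, as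
    a permutation requires; density of the tails of \<open>t\<close> provides them.\<close>
  have "\<exists>f. \<forall>n. d (t (f n)) (x n) < \<epsilon>/4 \<and> f n < f (Suc n)"
  proof (rule dependent_nat_choice)
    show "\<exists>k. d (t k) (x 0) < \<epsilon>/4" using t(2)[OF seqs_D[OF x] e4] by blast
    show "\<exists>k. d (t k) (x (Suc n)) < \<epsilon>/4 \<and> i < k" for i n
      using t(2)[OF seqs_D[OF x] e4, of "Suc i" "Suc n"] Suc_le_lessD by blast
  qed
  then obtain f :: "nat \<Rightarrow> nat" where f: "\<And>n. d (t (f n)) (x n) < \<epsilon>/4" "\<And>n. f n < f (Suc n)" by blast
  define l where "l = map f [0..<m]"
  have "strict_mono f" using f(2) by (simp add: strict_mono_Suc_iff)
  then have "inj f" by (rule strict_mono_imp_inj_on)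
  then have l: "inj_on ((!) l) {..<m}" by (auto simp: l_def inj_on_def)
  define \<sigma> where "\<sigma> = (SOME \<sigma>. bij \<sigma> \<and> (\<forall>i<m. \<sigma> i = l ! i))"
  have "\<sigma> \<in> PS" unfolding PS_def \<sigma>_def using l by blast
  moreover have "close m (\<epsilon>/4) (t \<circ> \<sigma>) x"
    using some[OF l] f(1) unfolding \<sigma>_def[symmetric] close_def by (simp add: l_def)
  ultimately show False using t(3) by blast
qed

end

section \<open>Automorphisms by back-and-forth\<close>

context sep_cat
begin

definition dense_seq :: "(nat \<Rightarrow> 'a) \<Rightarrow> bool" where
  "dense_seq u \<longleftrightarrow> u \<in> seqs M \<and> (\<forall>x\<in>S. \<forall>\<eta>>0. \<exists>k. d (u k) x < \<eta>)"

lemma dense_seqD: "dense_seq u \<Longrightarrow> x \<in> S \<Longrightarrow> \<eta> > 0 \<Longrightarrow> \<exists>k. d (u k) x < \<eta>"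
  by (simp add: dense_seq_def)

lemma M_complete: "mcomplete_of (universe M)"
  using ms by (simp add: metric_structure_def)

lemma d_triangle: "x \<in> S \<Longrightarrow> y \<in> S \<Longrightarrow> z \<in> S \<Longrightarrow> d x z \<le> d x y + d y z"
  by (rule mdist_triangle)

lemma d_sym: "d x y = d y x"
  by (rule mdist_commute)

lemma zero_if_small: "x \<in> S \<Longrightarrow> y \<in> S \<Longrightarrow> (\<And>\<eta>. \<eta> > 0 \<Longrightarrow> d x y \<le> \<eta>) \<Longrightarrow> x = y"
  by (metis antisym dense_ge mdist_nonneg mdist_zero)

section \<open>Automorphisms from dense sequences of equal type\<close>

lemma transfer_point:
  assumes u: "dense_seq u" and v: "v \<in> seqs M" and uv: "\<And>i j. d (u i) (u j) = d (v i) (v j)" and x: "x \<in> S"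
  obtains y where "y \<in> S" "\<And>i. d (v i) y = d (u i) x"
proof -
  have uM: "u i \<in> S" for i using u by (simp add: dense_seq_def)
  have vM: "v i \<in> S" for i using v by simp
  have "\<exists>k. \<forall>n. d (u (k n)) x < 1 / Suc n"
    by (intro choice allI dense_seqD[OF u x]) simp
  then obtain k :: "nat \<Rightarrow> nat" where k: "\<And>n. d (u (k n)) x < 1 / Suc n" by blast
  have small: "\<exists>N. \<forall>n\<ge>N. d (u (k n)) x < \<eta>" if \<eta>: "\<eta> > 0" for \<eta>
  proof -
    obtain N where N: "1 / Suc N < \<eta>" using \<eta> by (meson nat_approx_posE)
    have "d (u (k n)) x < \<eta>" if "n \<ge> N" for n
    proof -
      have "1 / Suc n \<le> 1 / Suc N" using that by (simp add: frac_le)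
      then show ?thesis using k[of n] N by linarith
    qed
    then show ?thesis by blast
  qed
  have cauchy: "\<exists>N. \<forall>n m. N \<le> n \<and> N \<le> m \<longrightarrow> d (v (k n)) (v (k m)) < \<eta>" if \<eta>: "\<eta> > 0" for \<eta>
  proof -
    obtain N where N: "\<And>n. n \<ge> N \<Longrightarrow> d (u (k n)) x < \<eta>/2" using small[of "\<eta>/2"] \<eta> by auto
    have "d (v (k n)) (v (k m)) < \<eta>" if "n \<ge> N" "m \<ge> N" for n m
      using d_triangle[OF uM[of "k n"] x uM[of "k m"]] N[OF that(1)] N[OF that(2)] d_sym[of x]
      unfolding uv[symmetric] by (smt (verit) field_sum_of_halves)
    then show ?thesis by blast
  qed
  obtain y where y: "y \<in> S" "\<And>\<eta>. \<eta> > 0 \<Longrightarrow> eventually (\<lambda>n. d (v (k n)) y < \<eta>) sequentially"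
    using mcomplete_of_LIMSEQ[OF M_complete vM cauchy] by blast
  have "\<bar>d (v i) y - d (u i) x\<bar> \<le> \<eta>" if \<eta>: "\<eta> > 0" for i \<eta>
  proof -
    have h: "\<eta>/2 > 0" using \<eta> by simp
    obtain N where N: "\<And>n. n \<ge> N \<Longrightarrow> d (u (k n)) x < \<eta>/2" using small[OF h] by blast
    obtain N' where N': "\<And>n. n \<ge> N' \<Longrightarrow> d (v (k n)) y < \<eta>/2"
      using y(2)[OF h] unfolding eventually_sequentially by blast
    define n where "n = max N N'"
    have n: "d (u (k n)) x < \<eta>/2" "d (v (k n)) y < \<eta>/2" using N N' by (auto simp: n_def)
    have "d (v i) y \<le> d (v i) (v (k n)) + d (v (k n)) y" "d (v i) (v (k n)) \<le> d (v i) y + d y (v (k n))"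
      "d (u i) x \<le> d (u i) (u (k n)) + d (u (k n)) x" "d (u i) (u (k n)) \<le> d (u i) x + d x (u (k n))"
      using uM vM x y(1) by (auto intro!: d_triangle)
    then show ?thesis using n uv[of i "k n"] d_sym[of x "u (k n)"] d_sym[of y "v (k n)"] by linarith
  qed
  then have "\<bar>d (v i) y - d (u i) x\<bar> \<le> 0" for i by (rule dense_ge)
  then show ?thesis using that y(1) by auto
qed

text \<open>If \<open>u i\<close> is close to \<open>x\<close>, then \<open>d x x'\<close> is nearly
  the distance from \<open>u i\<close> to \<open>x'\<close>, which equals that from
  \<open>v i\<close> to \<open>y'\<close>.\<close>

lemma transfer_isometry:
  assumes u: "dense_seq u" and v: "v \<in> seqs M"
    and x: "x \<in> S" "x' \<in> S" and y: "y \<in> S" "y' \<in> S"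
    and uv: "\<And>i j. d (u i) (u j) = d (v i) (v j)"
    and xy: "\<And>i. d (v i) y = d (u i) x" "\<And>i. d (v i) y' = d (u i) x'"
  shows "d y y' = d x x'"
proof -
  have uM: "u i \<in> S" for i using u by (simp add: dense_seq_def)
  have vM: "v i \<in> S" for i using v by simp
  have "\<bar>d y y' - d x x'\<bar> \<le> \<eta>" if \<eta>: "\<eta> > 0" for \<eta>
  proof -
    have h: "\<eta>/2 > 0" using \<eta> by simp
    obtain i where i: "d (u i) x < \<eta>/2" using dense_seqD[OF u x(1) h] by blast
    have "d y y' \<le> d y (v i) + d (v i) y'" "d (v i) y' \<le> d (v i) y + d y y'"
      "d x x' \<le> d x (u i) + d (u i) x'" "d (u i) x' \<le> d (u i) x + d x x'"
      using uM vM x y by (auto intro!: d_triangle)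
    then show ?thesis using i xy(1)[of i] xy(2)[of i] d_sym[of x "u i"] d_sym[of y "v i"] by linarith
  qed
  then have "\<bar>d y y' - d x x'\<bar> \<le> 0" by (rule dense_ge)
  then show ?thesis by simp
qed

text \<open>\<open>g x\<close> is the point whose distances to \<open>v\<close> are those of
  \<open>x\<close> to \<open>u\<close>: completeness gives existence, density of \<open>v\<close>
  uniqueness. Predicates are preserved because arguments can be approximated by entries of
  \<open>u\<close>, where equality of types applies.\<close>

lemma automorphism_of_dense_seqs:
  assumes u: "dense_seq u" and v: "dense_seq v"
    and types: "\<And>\<phi>. is_formula L \<phi> \<Longrightarrow> ev \<phi> u = ev \<phi> v"
  obtains g where "g \<in> carrier (Aut L M)" "\<And>i. g (u i) = v i"
proof -
  have uM: "u \<in> seqs M" and vM: "v \<in> seqs M" using u v by (auto simp: dense_seq_def)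
  have uv: "d (u i) (u j) = d (v i) (v j)" for i j using types[of "Dist i j"] by simp
  define g where "g = (\<lambda>x\<in>S. SOME y. y \<in> S \<and> (\<forall>i. d (v i) y = d (u i) x))"
  have g: "g x \<in> S" "d (v i) (g x) = d (u i) x" if x: "x \<in> S" for x i
  proof -
    have "\<exists>y. y \<in> S \<and> (\<forall>i. d (v i) y = d (u i) x)" using transfer_point[OF u vM uv x] by metis
    then have "(SOME y. y \<in> S \<and> (\<forall>i. d (v i) y = d (u i) x)) \<in> S \<and>
      (\<forall>i. d (v i) (SOME y. y \<in> S \<and> (\<forall>i. d (v i) y = d (u i) x)) = d (u i) x)" by (rule someI_ex)
    then show "g x \<in> S" "d (v i) (g x) = d (u i) x" using x by (simp_all add: g_def)
  qed
  have unique: "y = y'" if "y \<in> S" "y' \<in> S" "\<And>i. d (v i) y = d (v i) y'" for y y'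
  proof -
    have "d y y' = d y y" by (rule transfer_isometry[OF v vM that(1,1) that(1,2) refl refl]) (use that in auto)
    then show ?thesis using that mdist_zero[of y "universe M" y'] by simp
  qed
  have iso: "d (g x) (g x') = d x x'" if "x \<in> S" "x' \<in> S" for x x'
    by (rule transfer_isometry[OF u vM that]) (use g that uv in auto)
  have gu: "g (u i) = v i" for i
    by (rule unique) (use g uM vM uv in auto)
  have "inj_on g S"
  proof (rule inj_onI)
    fix x x' assume x: "x \<in> S" "x' \<in> S" "g x = g x'"
    then have "d x x' = 0" using iso[OF x(1,2)] g(1)[OF x(2)] by simp
    then show "x = x'" using mdist_zero x by metis
  qed
  moreover have "g ` S = S"
  proof
    show "S \<subseteq> g ` S"
    proof
      fix y assume y: "y \<in> S"
      obtain x where x: "x \<in> S" "\<And>i. d (u i) x = d (v i) y"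
        using transfer_point[OF v uM uv[symmetric] y] by metis
      have "g x = y" by (rule unique) (use g x y in auto)
      then show "y \<in> g ` S" using x(1) by blast
    qed
  qed (use g in auto)
  ultimately have bij: "bij_betw g S S" by (simp add: bij_betw_def)
  have interp: "interp M P (map g xs) = interp M P xs"
    if P: "P \<in> symbols L" and xs: "xs \<in> tuples (universe M) (arity L P)" for P xs
  proof -
    have "\<bar>interp M P (map g xs) - interp M P xs\<bar> \<le> \<eta>" if \<eta>: "\<eta> > 0" for \<eta>
    proof -
      have "predicate_on (universe M) (arity L P) (interp M P)" "\<eta>/2 > 0"
        using P ms \<eta> by (auto simp: metric_structure_def)
      then obtain \<delta> where \<delta>: "\<delta> > 0" "\<forall>xs\<in>tuples (universe M) (arity L P). \<forall>ys\<in>tuples (universe M) (arity L P).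
        (\<forall>i<arity L P. d (xs ! i) (ys ! i) < \<delta>) \<longrightarrow> \<bar>interp M P xs - interp M P ys\<bar> < \<eta>/2"
        unfolding predicate_on_def by meson
      have len: "length xs = arity L P" and mem: "\<And>x. x \<in> set xs \<Longrightarrow> x \<in> S" using xs by (auto simp: tuples_def)
      obtain k where k: "\<And>x. x \<in> S \<Longrightarrow> d (u (k x)) x < \<delta>" using dense_seqD[OF u _ \<delta>(1)] by metis
      define ks where "ks = map k xs"
      have t: "map u ks \<in> tuples (universe M) (arity L P)" "map v ks \<in> tuples (universe M) (arity L P)"
        "map g xs \<in> tuples (universe M) (arity L P)"
        using len mem uM vM g(1) by (auto simp: tuples_def ks_def)
      have "d (u (k (xs ! i))) (xs ! i) < \<delta>" if "i < arity L P" for i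
        using k mem len that by simp
      then have 1: "\<bar>interp M P (map u ks) - interp M P xs\<bar> < \<eta>/2"
        using \<delta>(2) t(1) xs len by (simp add: ks_def)
      have "d (v (k (xs ! i))) (g (xs ! i)) < \<delta>" if "i < arity L P" for i
        using k mem len that g(2) by simp
      then have 2: "\<bar>interp M P (map v ks) - interp M P (map g xs)\<bar> < \<eta>/2"
        using \<delta>(2) t(2,3) len by (simp add: ks_def)
      have "is_formula L (Pred P ks)" using P len by (simp add: ks_def)
      from types[OF this] have "interp M P (map u ks) = interp M P (map v ks)" by simp
      then show ?thesis using 1 2 by linarith
    qed
    then have "\<bar>interp M P (map g xs) - interp M P xs\<bar> \<le> 0" by (rule dense_ge)
    then show ?thesis by simp
  qed
  have "isomorphism L M M g" unfolding isomorphism_def using bij iso interp by blast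
  moreover have "g \<in> Bij S" using bij unfolding Bij_def by (simp add: g_def)
  ultimately have "g \<in> carrier (Aut L M)" by (simp add: Aut_def)
  then show ?thesis using that gu by blast
qed

section \<open>Back-and-forth between approximately equal types\<close>

lemma tclose_extend:
  assumes "x \<in> seqs M" "tclose m \<epsilon> y x" "\<epsilon>' > 0" "b \<in> S"
  obtains y' where "y' \<in> seqs M" "close m \<epsilon> y' y" "tclose (Suc m) \<epsilon>' y' (x(m := b))"
proof -
  have xb: "x(m := b) \<in> seqs M" using assms by simp
  obtain W where W: "opn W" "x(m := b) \<in> W" "\<And>z. z \<in> W \<Longrightarrow> tclose (Suc m) \<epsilon>' z (x(m := b))"
    using types_isolated[OF xb assms(3), of "Suc m"] by blast
  obtain \<phi> where \<phi>: "is_formula L \<phi>" "W = {s \<in> seqs M. 0 < ev \<phi> s}" using W(1) unfolding opn_def by blast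
  \<comment> \<open>The neighbourhood \<open>W\<close> of the extended tuple is projected along
    coordinate \<open>m\<close>, and a point of the projection close to \<open>y\<close> is lifted
    back into \<open>W\<close>. Thus \<open>\<epsilon>'\<close> is independent of
    \<open>\<epsilon>\<close>, which only bounds the move of the old coordinates.\<close>
  define U where "U = {s \<in> seqs M. 0 < ev (SupF m \<phi>) s}"
  have "opn U" unfolding U_def opn_def using \<phi>(1) by (intro exI[of _ "SupF m \<phi>"]) simp
  moreover have "x \<in> U" using W(2) assms(1,4) unfolding U_def mem_Collect_eq less_eval_SupF[OF \<phi>(1) assms(1)]
    by (auto simp: \<phi>(2))
  ultimately obtain u where u: "u \<in> U" "close m \<epsilon> u y" using assms(2) unfolding tclose_def by blast
  have uM: "u \<in> seqs M" using u(1) by (simp add: U_def)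
  then obtain c where c: "c \<in> S" "0 < ev \<phi> (u(m := c))"
    using u(1) unfolding U_def mem_Collect_eq less_eval_SupF[OF \<phi>(1) uM] by blast
  have "u(m := c) \<in> W" using c uM by (simp add: \<phi>(2))
  moreover have "close m \<epsilon> (u(m := c)) y" using u(2) by (simp add: close_def)
  moreover have "u(m := c) \<in> seqs M" using uM c(1) by simp
  ultimately show ?thesis using that W(3) by blast
qed

lemma dense_enumeration:
  "\<exists>b :: nat \<Rightarrow> 'a. (\<forall>k. b k \<in> S) \<and> (\<forall>x \<eta> N. x \<in> S \<longrightarrow> \<eta> > 0 \<longrightarrow> (\<exists>k\<ge>N. d (b k) x < \<eta>))"
proof -
  interpret Metric_space S d by simp
  obtain C where C: "countable C" "C \<subseteq> S" "mtopology closure_of C = S"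
    using separable unfolding separable_structure_def separable_space_def mtopology_of_def by auto
  have "C \<noteq> {}" using C(3) S_nonempty by auto
  \<comment> \<open>The second component of the pairing is discarded, so every point of
    \<open>C\<close> recurs infinitely often.\<close>
  define b where "b k = from_nat_into C (fst (prod_decode k))" for k
  have "b k \<in> S" for k using from_nat_into[OF \<open>C \<noteq> {}\<close>] C(2) unfolding b_def by blast
  moreover have "\<exists>k\<ge>N. d (b k) x < \<eta>" if x: "x \<in> S" and \<eta>: "\<eta> > 0" for x \<eta> N
  proof -
    have "x \<in> mtopology closure_of C" using C x by simp
    then obtain c where c: "c \<in> C" "c \<in> mball x \<eta>" using \<eta> unfolding metric_closure_of by blast
    obtain i where i: "from_nat_into C i = c" using from_nat_into_surj[OF C(1) c(1)] by blast
    have "b (prod_encode (i, N)) = c" by (simp add: b_def i)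
    then have "d (b (prod_encode (i, N))) x < \<eta>" using c(2) commute by auto
    then show ?thesis using le_prod_encode_2 by blast
  qed
  ultimately show ?thesis by blast
qed

text \<open>Coordinate \<open>i\<close> is controlled from the first stage with
  \<open>i < m + n\<close>, that is from \<open>Suc i - m\<close>; truncated subtraction yields 0
  for the initial coordinates. The 4 comes from moves of twice the error and a geometric
  sum.\<close>

lemma back_and_forth_limit:
  assumes w: "\<And>n. w n \<in> seqs M" and step: "\<And>n. close (m + n) (2 * \<delta> * (1/2)^n) (w (Suc n)) (w n)"
  obtains l where "l \<in> seqs M" "\<And>n i. i < m + n \<Longrightarrow> d (l i) (w n i) \<le> 4 * \<delta> * (1/2)^n"
proof -
  have "\<exists>y\<in>S. \<forall>n\<ge>Suc i - m. d y (w n i) \<le> 4 * \<delta> * (1/2)^n" for i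
  proof -
    have wi: "w n i \<in> S" for n using w by simp
    have st: "d (w (Suc n) i) (w n i) \<le> 2 * \<delta> * (1/2)^n" if "n \<ge> Suc i - m" for n
      using step[of n] that by (simp add: close_def less_imp_le)
    show ?thesis
    proof (rule geometric_limit[OF M_complete, of "\<lambda>n. w n i" "Suc i - m" "2 * \<delta>", OF wi st])
      fix y assume "y \<in> S" "\<And>n. n \<ge> Suc i - m \<Longrightarrow> d y (w n i) \<le> 2 * (2 * \<delta>) * (1/2)^n"
      then show ?thesis by (intro bexI[of _ y]) auto
    qed
  qed
  then obtain l where l: "\<And>i. l i \<in> S" "\<And>i n. n \<ge> Suc i - m \<Longrightarrow> d (l i) (w n i) \<le> 4 * \<delta> * (1/2)^n"
    by metis
  show ?thesis by (rule that[of l]) (auto intro: seqs_I l)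
qed

lemma small_power:
  fixes \<delta> \<eta> :: real
  assumes "\<eta> > 0"
  obtains N where "\<And>n. n \<ge> N \<Longrightarrow> \<delta> * (1/2)^n < \<eta>"
proof -
  have "(\<lambda>n. \<delta> * (1/2)^n) \<longlonglongrightarrow> \<delta> * 0" by (intro tendsto_intros LIMSEQ_realpow_zero) auto
  then have "eventually (\<lambda>n. \<delta> * (1/2)^n < \<eta>) sequentially" using assms by (intro order_tendstoD(2)) auto
  then show ?thesis using that unfolding eventually_sequentially by blast
qed

text \<open>Stage \<open>q k\<close> puts \<open>b k\<close> at coordinate \<open>m + q k\<close>,
  and later moves are small if \<open>k\<close> is large. Since \<open>b\<close> approaches every
  point at arbitrarily late indices, such \<open>k\<close> suffice.\<close>

lemma back_and_forth_dense:
  assumes b: "\<And>x \<eta> N. x \<in> S \<Longrightarrow> \<eta> > 0 \<Longrightarrow> \<exists>k\<ge>N. d (b k) x < \<eta>" "\<And>k. b k \<in> S"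
    and l: "l \<in> seqs M" "\<And>n i. i < m + n \<Longrightarrow> d (l i) (w n i) \<le> 4 * \<delta> * (1/2)^n"
    and w: "\<And>k. w (Suc (q k)) (m + q k) = b k" "\<And>k. k \<le> q k"
  shows "dense_seq l"
  unfolding dense_seq_def
proof (intro conjI l(1) ballI allI impI)
  fix x and \<eta> :: real assume x: "x \<in> S" and "\<eta> > 0"
  then have h: "\<eta>/2 > 0" by simp
  obtain N where N: "\<And>n. n \<ge> N \<Longrightarrow> 4 * \<delta> * (1/2)^n < \<eta>/2" using small_power[OF h] by blast
  obtain k where k: "k \<ge> N" "d (b k) x < \<eta>/2" using b(1)[OF x h] by blast
  have "N \<le> Suc (q k)" using k(1) w(2)[of k] by linarith
  then have "d (l (m + q k)) (b k) < \<eta>/2" using l(2)[of "m + q k" "Suc (q k)"] N[of "Suc (q k)"] w(1)[of k] by simp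
  moreover have "d (l (m + q k)) x \<le> d (l (m + q k)) (b k) + d (b k) x"
    using l(1) b(2) x by (intro d_triangle) auto
  ultimately have "d (l (m + q k)) x < \<eta>" using k(2) by linarith
  then show "\<exists>k. d (l k) x < \<eta>" by blast
qed

text \<open>At a late stage all free variables of \<open>\<phi>\<close> lie below
  \<open>m + n\<close> and the errors are tiny. The chain \<open>lu\<close>, \<open>u n\<close>,
  \<open>w\<close>, \<open>v n\<close>, \<open>lv\<close> costs \<open>\<eta>/4\<close> at each
  link, where \<open>w\<close> is close to \<open>u n\<close> and \<open>\<phi>\<close> has nearly
  the same value at \<open>w\<close> and \<open>v n\<close>.\<close>

lemma tclose_limit_eval:
  assumes \<phi>: "is_formula L \<phi>" and p: "\<And>n. u n \<in> seqs M" "\<And>n. v n \<in> seqs M"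
    and t: "\<And>n. tclose (m + n) (\<delta> * (1/2)^n) (u n) (v n)"
    and lu: "lu \<in> seqs M" "\<And>n i. i < m + n \<Longrightarrow> d (lu i) (u n i) \<le> 4 * \<delta> * (1/2)^n"
    and lv: "lv \<in> seqs M" "\<And>n i. i < m + n \<Longrightarrow> d (lv i) (v n i) \<le> 4 * \<delta> * (1/2)^n"
    and \<delta>: "\<delta> > 0"
  shows "ev \<phi> lu = ev \<phi> lv"
proof -
  have "\<bar>ev \<phi> lu - ev \<phi> lv\<bar> \<le> \<eta>" if "\<eta> > 0" for \<eta>
  proof -
    have h: "\<eta>/4 > 0" using that by simp
    obtain \<gamma> where \<gamma>: "\<gamma> > 0" "\<And>s s'. s \<in> seqs M \<Longrightarrow> s' \<in> seqs M \<Longrightarrow>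
      (\<And>i. i \<in> free_vars \<phi> \<Longrightarrow> d (s i) (s' i) < \<gamma>) \<Longrightarrow> \<bar>ev \<phi> s - ev \<phi> s'\<bar> < \<eta>/4"
      using formula_unif_cont[OF ms \<phi> h] by metis
    obtain N where N: "\<And>n. n \<ge> N \<Longrightarrow> 4 * \<delta> * (1/2)^n < \<gamma>" using small_power[OF \<gamma>(1)] by blast
    obtain K where K: "free_vars \<phi> \<subseteq> {..<K}" using finite_nat_iff_bounded[of "free_vars \<phi>"] by auto
    define n where "n = max N K"
    have n: "4 * \<delta> * (1/2)^n < \<gamma>" using N by (simp add: n_def)
    have fv: "i < m + n" if "i \<in> free_vars \<phi>" for i using K that by (auto simp: n_def)
    have "\<bar>ev \<phi> lu - ev \<phi> (u n)\<bar> < \<eta>/4"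
      by (rule \<gamma>(2)[OF lu(1) p(1)]) (use lu(2)[OF fv] n in force)
    moreover have "\<bar>ev \<phi> lv - ev \<phi> (v n)\<bar> < \<eta>/4"
      by (rule \<gamma>(2)[OF lv(1) p(2)]) (use lv(2)[OF fv] n in force)
    moreover have "\<exists>w. w \<in> seqs M \<and> \<bar>ev \<phi> w - ev \<phi> (v n)\<bar> < \<eta>/4 \<and> close (m + n) (\<delta> * (1/2)^n) w (u n)"
    proof -
      define U where "U = {s \<in> seqs M. ev \<phi> (v n) - \<eta>/4 < ev \<phi> s} \<inter> {s \<in> seqs M. ev \<phi> s < ev \<phi> (v n) + \<eta>/4}"
      have "opn U" unfolding U_def using opn_less[OF \<phi>] by (intro opn_Int)
      moreover have "v n \<in> U" using p(2) h by (simp add: U_def)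
      ultimately obtain w where "w \<in> U" "close (m + n) (\<delta> * (1/2)^n) w (u n)"
        using t[of n] unfolding tclose_def by blast
      moreover from this have "\<bar>ev \<phi> w - ev \<phi> (v n)\<bar> < \<eta>/4" unfolding U_def by (simp only: Int_iff mem_Collect_eq) linarith
      ultimately show ?thesis unfolding U_def by blast
    qed
    then obtain w where w: "w \<in> seqs M" "\<bar>ev \<phi> w - ev \<phi> (v n)\<bar> < \<eta>/4" "close (m + n) (\<delta> * (1/2)^n) w (u n)"
      by blast
    moreover have "\<bar>ev \<phi> w - ev \<phi> (u n)\<bar> < \<eta>/4"
    proof (rule \<gamma>(2)[OF w(1) p(1)])
      fix i assume "i \<in> free_vars \<phi>"
      then have "d (w i) (u n i) < \<delta> * (1/2)^n" using w(3) fv by (simp add: close_def)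
      moreover have "\<delta> * (1/2)^n \<le> 4 * \<delta> * (1/2)^n" using \<delta> by simp
      ultimately show "d (w i) (u n i) < \<gamma>" using n by linarith
    qed
    ultimately show ?thesis by linarith
  qed
  then have "\<bar>ev \<phi> lu - ev \<phi> lv\<bar> \<le> 0" by (rule dense_ge)
  then show ?thesis by simp
qed

text \<open>Even stages add a point of \<open>b\<close> to the second sequence and move the first,
  odd stages do the reverse, so both limits are dense. Each limit stays within
  \<open>4 * \<delta>\<close> of its start, which gives \<open>8 * \<delta>\<close>.\<close>

lemma back_and_forth:
  assumes y: "y \<in> seqs M" and x: "x \<in> seqs M" and \<delta>: "\<delta> > 0" and t: "tclose m \<delta> y x"
  obtains g where "g \<in> carrier (Aut L M)" "\<And>i. i < m \<Longrightarrow> d (g (y i)) (x i) \<le> 8 * \<delta>"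
proof -
  obtain b :: "nat \<Rightarrow> 'a" where b: "\<And>k. b k \<in> S" "\<And>x \<eta> N. x \<in> S \<Longrightarrow> \<eta> > 0 \<Longrightarrow> \<exists>k\<ge>N. d (b k) x < \<eta>"
    using dense_enumeration by blast
  define P where "P n p \<longleftrightarrow> fst p \<in> seqs M \<and> snd p \<in> seqs M \<and>
    tclose (m + n) (\<delta> * (1/2)^n) (fst p) (snd p) \<and> (n = 0 \<longrightarrow> p = (y, x))" for n and p :: "(nat \<Rightarrow> 'a) \<times> (nat \<Rightarrow> 'a)"
  define R where "R n p q \<longleftrightarrow> close (m + n) (2 * \<delta> * (1/2)^n) (fst q) (fst p) \<and>
    close (m + n) (2 * \<delta> * (1/2)^n) (snd q) (snd p) \<and>
    (if even n then snd q (m + n) = b (n div 2) else fst q (m + n) = b (n div 2))"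
    for n and p q :: "(nat \<Rightarrow> 'a) \<times> (nat \<Rightarrow> 'a)"
  have "\<exists>p. \<forall>n. P n (p n) \<and> R n (p n) (p (Suc n))"
  proof (rule dependent_nat_choice)
    show "\<exists>p. P 0 p" using x y t by (auto simp: P_def)
    fix p n assume P: "P n p"
    define u v where "u = fst p" and "v = snd p"
    define \<epsilon> where "\<epsilon> = \<delta> * (1/2)^n"
    have \<epsilon>: "\<epsilon> > 0" using \<delta> by (simp add: \<epsilon>_def)
    have uv: "u \<in> seqs M" "v \<in> seqs M" "tclose (m + n) \<epsilon> u v"
      using P by (auto simp: P_def u_def v_def \<epsilon>_def)
    let ?b = "b (n div 2)"
    have "\<exists>q. fst q \<in> seqs M \<and> snd q \<in> seqs M \<and> tclose (Suc (m + n)) (\<epsilon>/2) (fst q) (snd q) \<and>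
      close (m + n) (2 * \<epsilon>) (fst q) u \<and> close (m + n) (2 * \<epsilon>) (snd q) v \<and>
      (if even n then snd q (m + n) = ?b else fst q (m + n) = ?b)"
    proof (cases "even n")
      case True
      have "\<epsilon>/2 > 0" using \<epsilon> by simp
      then obtain u' where u': "u' \<in> seqs M" "close (m + n) \<epsilon> u' u" "tclose (Suc (m + n)) (\<epsilon>/2) u' (v(m + n := ?b))"
        using tclose_extend[OF uv(2,3) _ b(1)] by metis
      have "close (m + n) (2 * \<epsilon>) u' u" using close_mono[OF u'(2), of "2 * \<epsilon>" "m + n"] \<epsilon> by simp
      moreover have "close (m + n) (2 * \<epsilon>) (v(m + n := ?b)) v" using \<epsilon> uv(2) by (simp add: close_def)
      ultimately show ?thesis using u' b(1) uv True by (intro exI[of _ "(u', v(m + n := ?b))"]) simp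
    next
      case False
      \<comment> \<open>Exchanging the roles costs precision twice: \<open>\<epsilon>\<close>
        becomes \<open>2 * \<epsilon>\<close>, whence the bound on the moves, and
        \<open>\<epsilon>/4\<close> leaves room to return with \<open>\<epsilon>/2\<close>.\<close>
      have "\<epsilon>/4 > 0" using \<epsilon> by simp
      moreover have vu: "tclose (m + n) (2 * \<epsilon>) v u" by (rule tclose_sym[OF uv(2,1,3)]) (use \<epsilon> in simp)
      ultimately obtain v' where v': "v' \<in> seqs M" "close (m + n) (2 * \<epsilon>) v' v"
        "tclose (Suc (m + n)) (\<epsilon>/4) v' (u(m + n := ?b))"
        using tclose_extend[OF uv(1) vu _ b(1)] by metis
      have ub: "u(m + n := ?b) \<in> seqs M" using uv b by simp
      have "tclose (Suc (m + n)) (\<epsilon>/2) (u(m + n := ?b)) v'"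
        by (rule tclose_sym[OF ub v'(1,3)]) (use \<epsilon> in simp)
      moreover have "close (m + n) (2 * \<epsilon>) (u(m + n := ?b)) u" using \<epsilon> uv(1) by (simp add: close_def)
      ultimately show ?thesis using v' ub False by (intro exI[of _ "(u(m + n := ?b), v')"]) simp
    qed
    then show "\<exists>q. P (Suc n) q \<and> R n p q" unfolding P_def R_def u_def v_def \<epsilon>_def by (simp add: mult.assoc)
  qed
  then obtain p where P: "\<And>n. P n (p n)" and R: "\<And>n. R n (p n) (p (Suc n))" by blast
  define u v where "u n = fst (p n)" and "v n = snd (p n)" for n
  have uM: "u n \<in> seqs M" and vM: "v n \<in> seqs M" and tn: "tclose (m + n) (\<delta> * (1/2)^n) (u n) (v n)" for n
    using P[of n] by (auto simp: P_def u_def v_def)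
  have u0: "u 0 = y" and v0: "v 0 = x" using P[of 0] by (auto simp: P_def u_def v_def)
  have su: "close (m + n) (2 * \<delta> * (1/2)^n) (u (Suc n)) (u n)"
    and sv: "close (m + n) (2 * \<delta> * (1/2)^n) (v (Suc n)) (v n)" for n
    using R[of n] by (auto simp: R_def u_def v_def)
  have bv: "v (Suc (2 * k)) (m + 2 * k) = b k" for k
    using R[of "2 * k"] by (simp add: R_def v_def)
  have bu: "u (Suc (2 * k + 1)) (m + (2 * k + 1)) = b k" for k
    using R[of "2 * k + 1"] by (simp add: R_def u_def)
  obtain lu where lu: "lu \<in> seqs M" "\<And>n i. i < m + n \<Longrightarrow> d (lu i) (u n i) \<le> 4 * \<delta> * (1/2)^n"
    using back_and_forth_limit[of u m \<delta>, OF uM su] by blast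
  obtain lv where lv: "lv \<in> seqs M" "\<And>n i. i < m + n \<Longrightarrow> d (lv i) (v n i) \<le> 4 * \<delta> * (1/2)^n"
    using back_and_forth_limit[of v m \<delta>, OF vM sv] by blast
  have "dense_seq lu"
    by (rule back_and_forth_dense[where q = "\<lambda>k. 2 * k + 1", OF b(2,1) lu bu]) auto
  moreover have "dense_seq lv"
    by (rule back_and_forth_dense[where q = "\<lambda>k. 2 * k", OF b(2,1) lv bv]) auto
  moreover have "ev \<phi> lu = ev \<phi> lv" if "is_formula L \<phi>" for \<phi>
    by (rule tclose_limit_eval[OF that uM vM tn lu lv \<delta>])
  ultimately obtain g where g: "g \<in> carrier (Aut L M)" "\<And>i. g (lu i) = lv i"
    using automorphism_of_dense_seqs by metis
  have iso: "isomorphism L M M g" using g(1) by (simp add: Aut_def)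
  have gS: "g a \<in> S" if "a \<in> S" for a using iso that by (auto simp: isomorphism_def bij_betw_def)
  have "d (g (y i)) (x i) \<le> 8 * \<delta>" if "i < m" for i
  proof -
    have "d (lu i) (y i) \<le> 4 * \<delta>" "d (lv i) (x i) \<le> 4 * \<delta>"
      using lu(2)[of i 0] lv(2)[of i 0] that u0 v0 by auto
    moreover have "d (g (lu i)) (g (y i)) = d (lu i) (y i)"
      using iso lu(1) y by (simp add: isomorphism_def)
    moreover have "d (g (y i)) (x i) \<le> d (g (y i)) (g (lu i)) + d (lv i) (x i)"
      using d_triangle[of "g (y i)" "g (lu i)" "x i"] gS y x lu(1) lv(1) g(2) by simp
    ultimately show ?thesis using d_sym[of "g (y i)" "g (lu i)"] by linarith
  qed
  then show ?thesis using that g(1) by blast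
qed

section \<open>From types to orbits, and compactness of the orbit space\<close>

theorem orbits_isolated:
  assumes x: "x \<in> seqs M" and \<epsilon>: "\<epsilon> > 0"
  obtains W where "opn W" "x \<in> W" "\<And>y. y \<in> W \<Longrightarrow> \<exists>g\<in>carrier (Aut L M). \<forall>i<m. d (g (y i)) (x i) < \<epsilon>"
proof -
  \<comment> \<open>Back-and-forth multiplies the error by 8; a ninth makes the result
    strict.\<close>
  have e: "\<epsilon>/9 > 0" using \<epsilon> by simp
  obtain W where W: "opn W" "x \<in> W" "\<And>y. y \<in> W \<Longrightarrow> tclose m (\<epsilon>/9) y x"
    using types_isolated[OF x e] by blast
  have "\<exists>g\<in>carrier (Aut L M). \<forall>i<m. d (g (y i)) (x i) < \<epsilon>" if y: "y \<in> W" for y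
  proof -
    have "y \<in> seqs M" using y W(1) opn_subset by blast
    then obtain g where g: "g \<in> carrier (Aut L M)" "\<And>i. i < m \<Longrightarrow> d (g (y i)) (x i) \<le> 8 * (\<epsilon>/9)"
      using back_and_forth[OF _ x e W(3)[OF y]] by blast
    have "8 * (\<epsilon>/9) < \<epsilon>" using \<epsilon> by simp
    then show ?thesis using g by (meson le_less_trans)
  qed
  then show ?thesis using that W by blast
qed

text \<open>Even coordinates carry \<open>x j\<close>, odd ones stay free for witnesses, so a limit
  of types along a subsequence is realised by some \<open>z\<close>. Then
  \<open>orbits_isolated\<close> moves late members to within \<open>1 / Suc k\<close> of
  \<open>z\<close> on the first \<open>k\<close> coordinates, and a diagonal choice
  finishes.\<close>

theorem orbit_space_compact:
  assumes x: "\<And>j :: nat. x j \<in> seqs M"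
  obtains r g z where "strict_mono (r :: nat \<Rightarrow> nat)" "\<And>j. g j \<in> carrier (Aut L M)" "z \<in> seqs M"
    "\<And>i \<eta>. \<eta> > 0 \<Longrightarrow> eventually (\<lambda>j. d (g j (x (r j) i)) (z i) < \<eta>) sequentially"
proof -
  define A where "A j = {s \<in> seqs M. \<forall>i. s (2 * i) = x j i}" for j
  have A: "A j \<subseteq> seqs M" for j by (auto simp: A_def)
  have "(\<lambda>i. x j (i div 2)) \<in> A j" for j using seqs_comp'[OF x] by (simp add: A_def)
  then have ne: "A j \<noteq> {}" for j by blast
  have mod: "w(k := c) \<in> A j" if "w \<in> A j" "odd k" "c \<in> S" for j w k c
    using that by (auto simp: A_def)
  show ?thesis
  proof (rule generic_realization[of A "{}", OF A ne mod])
    fix r :: "nat \<Rightarrow> nat" and s t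
    assume r: "strict_mono r" and s: "\<And>j. s j \<in> A (r j)" and t: "t \<in> seqs M"
      and lim: "\<And>\<phi>. is_formula L \<phi> \<Longrightarrow> (\<lambda>j. ev \<phi> (s j)) \<longlonglongrightarrow> ev \<phi> t"
    define z where "z = t \<circ> (\<lambda>i. 2 * i)"
    have z: "z \<in> seqs M" using t by (simp add: z_def)
    have xs: "x (r j) = s j \<circ> (\<lambda>i. 2 * i)" for j using s[of j] by (auto simp: A_def)
    have ev: "eventually (\<lambda>j. x (r j) \<in> W) sequentially" if W: "opn W" "z \<in> W" for W
    proof -
      obtain \<phi> where \<phi>: "is_formula L \<phi>" "W = {s \<in> seqs M. 0 < ev \<phi> s}" using W(1) unfolding opn_def by blast
      obtain \<phi>' where \<phi>': "is_formula L \<phi>'" "\<And>s. ev \<phi>' s = ev \<phi> (s \<circ> (\<lambda>i. 2 * i))"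
        using formula_rename[OF \<phi>(1)] by metis
      have "0 < ev \<phi>' t" using W(2) by (simp add: \<phi>(2) \<phi>'(2) z_def)
      then have "eventually (\<lambda>j. 0 < ev \<phi>' (s j)) sequentially" by (rule order_tendstoD(1)[OF lim[OF \<phi>'(1)]])
      then show ?thesis by (rule eventually_mono) (use x xs[symmetric] in \<open>simp add: \<phi>(2) \<phi>'(2)\<close>)
    qed
    have "\<exists>q. \<forall>k. (\<exists>g\<in>carrier (Aut L M). \<forall>i<k. d (g (x (r (q k)) i)) (z i) < 1 / Suc k) \<and> q k < q (Suc k)"
    proof (rule dependent_nat_choice)
      have *: "\<exists>j>n. \<exists>g\<in>carrier (Aut L M). \<forall>i<k. d (g (x (r j) i)) (z i) < 1 / Suc k" for n k
      proof -
        have "1 / real (Suc k) > 0" by simp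
        then obtain W where W: "opn W" "z \<in> W"
          "\<And>y. y \<in> W \<Longrightarrow> \<exists>g\<in>carrier (Aut L M). \<forall>i<k. d (g (y i)) (z i) < 1 / Suc k"
          using orbits_isolated[OF z, of "1 / Suc k" k] by blast
        obtain N where "\<And>j. j \<ge> N \<Longrightarrow> x (r j) \<in> W" using ev[OF W(1,2)] unfolding eventually_sequentially by blast
        then have "x (r (max N (Suc n))) \<in> W" by simp
        then show ?thesis using W(3) by (intro exI[of _ "max N (Suc n)"]) auto
      qed
      show "\<exists>j. \<exists>g\<in>carrier (Aut L M). \<forall>i<0. d (g (x (r j) i)) (z i) < 1 / Suc 0" using * by blast
      show "\<exists>j. (\<exists>g\<in>carrier (Aut L M). \<forall>i<Suc k. d (g (x (r j) i)) (z i) < 1 / Suc (Suc k)) \<and> n < j" for n k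
        using *[of n "Suc k"] by blast
    qed
    then obtain q where q: "\<And>k. \<exists>g\<in>carrier (Aut L M). \<forall>i<k. d (g (x (r (q k)) i)) (z i) < 1 / Suc k"
      "\<And>k. q k < q (Suc k)" by blast
    then obtain g where g: "\<And>k. g k \<in> carrier (Aut L M)" "\<And>k i. i < k \<Longrightarrow> d (g k (x (r (q k)) i)) (z i) < 1 / Suc k"
      by metis
    show thesis
    proof (rule that[of "r \<circ> q" g z])
      show "strict_mono (r \<circ> q)" using r q(2) by (intro strict_mono_o) (simp_all add: strict_mono_Suc_iff)
      fix i and \<eta> :: real assume "\<eta> > 0"
      then obtain N where N: "1 / Suc N < \<eta>" by (meson nat_approx_posE)
      have "d (g k (x ((r \<circ> q) k) i)) (z i) < \<eta>" if "k \<ge> max N (Suc i)" for k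
      proof -
        have "1 / Suc k \<le> 1 / Suc N" using that by (simp add: frac_le)
        then show ?thesis using g(2)[of i k] that N by simp
      qed
      then show "eventually (\<lambda>k. d (g k (x ((r \<circ> q) k) i)) (z i) < \<eta>) sequentially"
        unfolding eventually_sequentially by blast
    qed (use g z in auto)
  qed simp_all
qed

end

section \<open>The automorphism group\<close>

context sep_cat
begin

abbreviation "G \<equiv> Aut L M"

lemma Aut_iff: "g \<in> carrier G \<longleftrightarrow> g \<in> Bij S \<and> isomorphism L M M g"
  by (simp add: Aut_def)

lemma Aut_mem [simp]: "g \<in> carrier G \<Longrightarrow> x \<in> S \<Longrightarrow> g x \<in> S"
  unfolding Aut_iff isomorphism_def bij_betw_def by blast

lemma Aut_dist [simp]: "g \<in> carrier G \<Longrightarrow> x \<in> S \<Longrightarrow> y \<in> S \<Longrightarrow> d (g x) (g y) = d x y"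
  unfolding Aut_iff isomorphism_def by blast

text \<open>Elements of \<open>Bij\<close> are extensional, so compositions and inverses get
  restricted to \<open>S\<close>; being an isomorphism depends only on the values there.\<close>

lemma isomorphism_cong:
  assumes "\<And>x. x \<in> S \<Longrightarrow> f x = g x" "isomorphism L M M f"
  shows "isomorphism L M M g"
proof -
  have "map g xs = map f xs" if "xs \<in> tuples (universe M) k" for xs k
    using that assms(1) by (auto simp: tuples_def)
  then show ?thesis using assms unfolding isomorphism_def
    by (simp del: map_eq_conv cong: bij_betw_cong)
qed

definition ainv :: "('a \<Rightarrow> 'a) \<Rightarrow> 'a \<Rightarrow> 'a" where
  "ainv g = restrict (inv_into S g) S"

lemma Aut_compose: "g \<in> carrier G \<Longrightarrow> h \<in> carrier G \<Longrightarrow> compose S g h \<in> carrier G"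
  using isomorphism_cong[OF _ isomorphism_comp[of L M M h M g], of "compose S g h"]
  by (simp add: Aut_iff compose_Bij compose_eq)

lemma Aut_id: "(\<lambda>x\<in>S. x) \<in> carrier G"
  unfolding Aut_iff
  by (rule conjI[OF id_Bij isomorphism_cong[of id]]) (auto simp: isomorphism_def bij_betw_def)

lemma Aut_ainv: "g \<in> carrier G \<Longrightarrow> ainv g \<in> carrier G"
  using isomorphism_cong[OF _ isomorphism_inv[of L M M g], of "ainv g"]
  by (simp add: Aut_iff ainv_def restrict_inv_into_Bij)

lemma ainv_left [simp]: "g \<in> carrier G \<Longrightarrow> x \<in> S \<Longrightarrow> ainv g (g x) = x"
  unfolding Aut_iff isomorphism_def by (auto simp: ainv_def bij_betw_def)

lemma ainv_right [simp]: "g \<in> carrier G \<Longrightarrow> x \<in> S \<Longrightarrow> g (ainv g x) = x"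
  unfolding Aut_iff isomorphism_def by (auto simp: ainv_def bij_betw_def f_inv_into_f)

lemma Aut_mult: "g \<in> carrier G \<Longrightarrow> h \<in> carrier G \<Longrightarrow> g \<otimes>\<^bsub>G\<^esub> h = compose S g h"
  by (simp add: Aut_def BijGroup_def)

lemma Aut_one: "\<one>\<^bsub>G\<^esub> = (\<lambda>x\<in>S. x)"
  by (simp add: Aut_def BijGroup_def)

lemma Aut_ext: "g \<in> carrier G \<Longrightarrow> h \<in> carrier G \<Longrightarrow> (\<And>x. x \<in> S \<Longrightarrow> g x = h x) \<Longrightarrow> g = h"
  unfolding Aut_iff by (metis Bij_imp_extensional extensionalityI)

lemma Aut_group: "group G"
proof (rule groupI)
  fix g h k assume *: "g \<in> carrier G" "h \<in> carrier G" "k \<in> carrier G"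
  show "g \<otimes>\<^bsub>G\<^esub> h \<in> carrier G" using * by (simp add: Aut_mult Aut_compose)
  show "(g \<otimes>\<^bsub>G\<^esub> h) \<otimes>\<^bsub>G\<^esub> k = g \<otimes>\<^bsub>G\<^esub> (h \<otimes>\<^bsub>G\<^esub> k)"
    using * by (intro Aut_ext) (auto simp: Aut_mult Aut_compose compose_eq)
next
  show "\<one>\<^bsub>G\<^esub> \<in> carrier G" by (simp add: Aut_one Aut_id)
next
  fix g assume *: "g \<in> carrier G"
  show "\<one>\<^bsub>G\<^esub> \<otimes>\<^bsub>G\<^esub> g = g"
    using * by (intro Aut_ext) (auto simp: Aut_one Aut_mult Aut_compose Aut_id compose_eq)
  show "\<exists>h\<in>carrier G. h \<otimes>\<^bsub>G\<^esub> g = \<one>\<^bsub>G\<^esub>"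
    using * by (intro bexI[of _ "ainv g"] Aut_ext) (auto simp: Aut_one Aut_mult Aut_compose Aut_id Aut_ainv compose_eq)
qed

lemma Aut_inv: "g \<in> carrier G \<Longrightarrow> inv\<^bsub>G\<^esub> g = ainv g"
  by (rule group.inv_equality[OF Aut_group])
    (auto simp: Aut_one Aut_mult Aut_compose Aut_id Aut_ainv compose_eq intro!: Aut_ext)

lemma Aut_eval:
  assumes "g \<in> carrier G" "is_formula L \<phi>" "s \<in> seqs M"
  shows "ev \<phi> (\<lambda>i. g (s i)) = ev \<phi> s"
  using eval_isomorphism[of L M M g \<phi> s] assms unfolding Aut_iff by (simp add: seqs_def o_def)

text \<open>A pointwise limit of surjective isometries may fail to be onto; convergence of the
  inverses prevents this. Controlling the points of a dense sequence, each from some stage on, is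
  enough by \<open>automorphism_of_dense_seqs\<close>.\<close>

lemma Aut_limit:
  assumes h: "\<And>n. h n \<in> carrier G" and b: "dense_seq b"
    and hb: "\<And>i n. i < n \<Longrightarrow> d (h (Suc n) (b i)) (h n (b i)) \<le> C * (1/2)^n"
    and hb': "\<And>i n. i < n \<Longrightarrow> d (ainv (h (Suc n)) (b i)) (ainv (h n) (b i)) \<le> C * (1/2)^n"
  obtains g where "g \<in> carrier G"
    "\<And>x \<eta>. x \<in> S \<Longrightarrow> \<eta> > 0 \<Longrightarrow> eventually (\<lambda>n. d (h n x) (g x) < \<eta>) sequentially"
proof -
  have bM: "b \<in> seqs M" and bS: "b i \<in> S" for i using b by (auto simp: dense_seq_def)
  have "\<exists>y\<in>S. \<forall>\<eta>>0. eventually (\<lambda>n. d (h n (b i)) y < \<eta>) sequentially" for i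
    by (rule geometric_limit[OF M_complete, of "\<lambda>n. h n (b i)" "Suc i" C]) (use h bS hb in auto)
  then obtain v where v: "\<And>i. v i \<in> S" "\<And>i \<eta>. \<eta> > 0 \<Longrightarrow> eventually (\<lambda>n. d (h n (b i)) (v i) < \<eta>) sequentially"
    by metis
  have "\<exists>y\<in>S. \<forall>\<eta>>0. eventually (\<lambda>n. d (ainv (h n) (b i)) y < \<eta>) sequentially" for i
    by (rule geometric_limit[OF M_complete, of "\<lambda>n. ainv (h n) (b i)" "Suc i" C]) (use h Aut_ainv bS hb' in auto)
  then obtain w where w: "\<And>i. w i \<in> S" "\<And>i \<eta>. \<eta> > 0 \<Longrightarrow> eventually (\<lambda>n. d (ainv (h n) (b i)) (w i) < \<eta>) sequentially"
    by metis
  have vM: "v \<in> seqs M" using v by (intro seqs_I)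
  have "\<exists>k. d (v k) x < \<eta>" if x: "x \<in> S" and \<eta>: "\<eta> > 0" for x \<eta>
  proof -
    have e: "\<eta>/4 > 0" using \<eta> by simp
    obtain i where i: "d (b i) x < \<eta>/4" using dense_seqD[OF b x e] by blast
    \<comment> \<open>\<open>w i\<close> is the expected preimage of \<open>b i\<close>; a
      \<open>b k\<close> near it is mapped near \<open>b i\<close>.\<close>
    obtain k where k: "d (b k) (w i) < \<eta>/4" using dense_seqD[OF b w(1) e] by blast
    have "eventually (\<lambda>n. d (h n (b k)) (v k) < \<eta>/4 \<and> d (ainv (h n) (b i)) (w i) < \<eta>/4) sequentially"
      using v(2)[OF e] w(2)[OF e] by (intro eventually_conj)
    then obtain n where n: "d (h n (b k)) (v k) < \<eta>/4" "d (ainv (h n) (b i)) (w i) < \<eta>/4"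
      using eventually_happens'[OF sequentially_bot] by blast
    have iS: "ainv (h n) (b i) \<in> S" using Aut_ainv[OF h] bS by simp
    have "d (h n (b k)) (b i) = d (b k) (ainv (h n) (b i))"
      using Aut_dist[OF h[of n] bS[of k] iS] ainv_right[OF h[of n] bS[of i]] by simp
    moreover have "d (b k) (ainv (h n) (b i)) \<le> d (b k) (w i) + d (w i) (ainv (h n) (b i))"
      using bS w(1) iS by (intro d_triangle)
    moreover have "d (v k) x \<le> d (v k) (b i) + d (b i) x" "d (v k) (b i) \<le> d (v k) (h n (b k)) + d (h n (b k)) (b i)"
      using v(1) bS x Aut_mem[OF h bS] by (auto intro!: d_triangle)
    ultimately have "d (v k) x < \<eta>"
      using i k n d_sym[of "v k" "h n (b k)"] d_sym[of "w i" "ainv (h n) (b i)"] by linarith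
    then show ?thesis by blast
  qed
  then have "dense_seq v" using vM by (simp add: dense_seq_def)
  moreover have "ev \<phi> b = ev \<phi> v" if \<phi>: "is_formula L \<phi>" for \<phi>
  proof -
    have "\<bar>ev \<phi> b - ev \<phi> v\<bar> \<le> \<eta>" if \<eta>: "\<eta> > 0" for \<eta>
    proof -
      obtain \<gamma> where \<gamma>: "\<gamma> > 0" "\<And>s s'. s \<in> seqs M \<Longrightarrow> s' \<in> seqs M \<Longrightarrow>
        (\<And>i. i \<in> free_vars \<phi> \<Longrightarrow> d (s i) (s' i) < \<gamma>) \<Longrightarrow> \<bar>ev \<phi> s - ev \<phi> s'\<bar> < \<eta>"
        using formula_unif_cont[OF ms \<phi> \<eta>] by metis
      have "eventually (\<lambda>n. \<forall>i\<in>free_vars \<phi>. d (h n (b i)) (v i) < \<gamma>) sequentially"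
        by (intro eventually_ball_finite ballI v(2) \<gamma>(1)) simp
      then obtain n where n: "\<forall>i\<in>free_vars \<phi>. d (h n (b i)) (v i) < \<gamma>"
        using eventually_happens'[OF sequentially_bot] by blast
      have "\<bar>ev \<phi> (\<lambda>i. h n (b i)) - ev \<phi> v\<bar> < \<eta>"
        by (rule \<gamma>(2)) (use n vM h bS in \<open>auto intro: seqs_I\<close>)
      then show ?thesis using Aut_eval[OF h \<phi> bM] by simp
    qed
    then have "\<bar>ev \<phi> b - ev \<phi> v\<bar> \<le> 0" by (rule dense_ge)
    then show ?thesis by simp
  qed
  ultimately obtain g where g: "g \<in> carrier G" "\<And>i. g (b i) = v i"
    using automorphism_of_dense_seqs[OF b] by metis
  have "eventually (\<lambda>n. d (h n x) (g x) < \<eta>) sequentially" if x: "x \<in> S" and \<eta>: "\<eta> > 0" for x \<eta>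
  proof -
    have e: "\<eta>/3 > 0" using \<eta> by simp
    obtain i where i: "d (b i) x < \<eta>/3" using dense_seqD[OF b x e] by blast
    show ?thesis using v(2)[OF e, of i]
    proof (rule eventually_mono)
      fix n assume n: "d (h n (b i)) (v i) < \<eta>/3"
      have "d (h n x) (g x) \<le> d (h n x) (h n (b i)) + d (h n (b i)) (g x)"
        "d (h n (b i)) (g x) \<le> d (h n (b i)) (g (b i)) + d (g (b i)) (g x)"
        using h g(1) bS x by (auto intro!: d_triangle simp del: Aut_dist)
      moreover have "d (h n x) (h n (b i)) = d (b i) x" "d (g (b i)) (g x) = d (b i) x"
        using h g(1) bS x d_sym by auto
      ultimately show "d (h n x) (g x) < \<eta>" using n i unfolding g(2) by linarith
    qed
  qed
  then show ?thesis using that g(1) by blast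
qed

end

section \<open>Closed orbits\<close>

locale closed_orbit = sep_cat L M
  for L :: "'r language" and M :: "('a, 'r) mstructure" +
  fixes n :: enat and a :: "nat \<Rightarrow> 'a" and D :: "(nat \<Rightarrow> 'a) metric"
  assumes compat: "compatible_power_metric (universe M) n D"
    and invariant: "invariant_metric (Aut L M) (diag_action (universe M) n) D"
    and a: "a \<in> power_space (universe M) n"
    and closed: "closedin (mtopology_of D) (orbit (Aut L M) (diag_action (universe M) n) a)"
begin

abbreviation "P \<equiv> power_space (universe M) n"
abbreviation "I \<equiv> indices n"
abbreviation "act \<equiv> diag_action (universe M) n"
abbreviation "Ga \<equiv> orbit (Aut L M) (diag_action (universe M) n) a"
abbreviation "\<rho> \<equiv> mdist D"

lemma mspace_D [simp]: "mspace D = P"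
  using compat by (simp add: compatible_power_metric_def)

lemma P_mem [simp]: "x \<in> P \<Longrightarrow> i \<in> I \<Longrightarrow> x i \<in> S"
  by (auto simp: power_space_def)

lemma P_ext: "x \<in> P \<Longrightarrow> y \<in> P \<Longrightarrow> (\<And>i. i \<in> I \<Longrightarrow> x i = y i) \<Longrightarrow> x = y"
  unfolding power_space_def by (rule PiE_ext)

lemma act_apply [simp]: "x \<in> P \<Longrightarrow> i \<in> I \<Longrightarrow> act g x i = g (x i)"
  by (simp add: diag_action_def)

lemma act_mem [simp]: "g \<in> carrier G \<Longrightarrow> x \<in> P \<Longrightarrow> act g x \<in> P"
  by (auto simp: diag_action_def power_space_def PiE_iff)

lemma act_compose: "g \<in> carrier G \<Longrightarrow> h \<in> carrier G \<Longrightarrow> x \<in> P \<Longrightarrow> act (compose S g h) x = act g (act h x)"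
  by (rule P_ext) (auto simp: Aut_compose compose_eq)

lemma act_id: "x \<in> P \<Longrightarrow> act (\<lambda>x\<in>S. x) x = x"
  by (rule P_ext) (auto simp: Aut_id)

lemma act_ainv [simp]:
  "g \<in> carrier G \<Longrightarrow> x \<in> P \<Longrightarrow> act (ainv g) (act g x) = x"
  "g \<in> carrier G \<Longrightarrow> x \<in> P \<Longrightarrow> act g (act (ainv g) x) = x"
  by (rule P_ext; simp add: Aut_ainv)+

lemma act_dist [simp]: "g \<in> carrier G \<Longrightarrow> x \<in> P \<Longrightarrow> y \<in> P \<Longrightarrow> \<rho> (act g x) (act g y) = \<rho> x y"
  using invariant unfolding invariant_metric_def by simp

lemma Ga_iff: "x \<in> Ga \<longleftrightarrow> (\<exists>g\<in>carrier G. x = act g a)"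
  by (auto simp: orbit_def)

lemma Ga_P: "x \<in> Ga \<Longrightarrow> x \<in> P"
  using a by (auto simp: Ga_iff)

lemma act_Ga: "g \<in> carrier G \<Longrightarrow> x \<in> Ga \<Longrightarrow> act g x \<in> Ga"
  unfolding Ga_iff using a act_compose Aut_compose by metis

lemma Ga_transitive:
  assumes "x \<in> Ga" "y \<in> Ga"
  obtains g where "g \<in> carrier G" "act g x = y"
proof -
  obtain h k where hk: "h \<in> carrier G" "x = act h a" "k \<in> carrier G" "y = act k a"
    using assms unfolding Ga_iff by blast
  show ?thesis
    by (rule that[of "compose S k (ainv h)"]) (use hk a in \<open>simp_all add: Aut_compose Aut_ainv act_compose\<close>)
qed

lemma \<rho>_triangle: "x \<in> P \<Longrightarrow> y \<in> P \<Longrightarrow> z \<in> P \<Longrightarrow> \<rho> x z \<le> \<rho> x y + \<rho> y z"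
  using mdist_triangle[of x D y z] by simp

lemma \<rho>_limit:
  assumes x: "\<And>m. x m \<in> P" and y: "y \<in> P" and \<eta>: "\<eta> > 0"
    and lim: "\<And>i \<eta>. i \<in> I \<Longrightarrow> \<eta> > 0 \<Longrightarrow> eventually (\<lambda>m. d (x m i) (y i) < \<eta>) sequentially"
  shows "eventually (\<lambda>m :: nat. \<rho> (x m) y < \<eta>) sequentially"
proof -
  obtain F \<delta> where F: "finite F" "F \<subseteq> I" "\<delta> > 0"
    "\<forall>x\<in>P. \<forall>y\<in>P. (\<forall>i\<in>F. d (x i) (y i) < \<delta>) \<longrightarrow> \<rho> x y < \<eta>"
    using compat \<eta> unfolding compatible_power_metric_def by meson
  have "eventually (\<lambda>m. \<forall>i\<in>F. d (x m i) (y i) < \<delta>) sequentially"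
    using F by (intro eventually_ball_finite ballI lim) auto
  then show ?thesis by (rule eventually_mono) (use F(4) x y in blast)
qed

lemma coordinate_modulus:
  assumes "i \<in> I" "\<eta> > 0"
  obtains \<delta> where "\<delta> > 0" "\<And>x y. x \<in> P \<Longrightarrow> y \<in> P \<Longrightarrow> \<rho> x y < \<delta> \<Longrightarrow> d (x i) (y i) < \<eta>"
  using compat assms unfolding compatible_power_metric_def by meson

lemma Ga_limit:
  assumes x: "\<And>m. x m \<in> Ga" and y: "y \<in> P"
    and lim: "\<And>\<eta>. \<eta> > 0 \<Longrightarrow> eventually (\<lambda>m :: nat. \<rho> (x m) y < \<eta>) sequentially"
  shows "y \<in> Ga"
proof -
  interpret Metric_space P \<rho> using Metric_space_mspace_mdist[of D] by simp
  have cl: "closedin mtopology Ga" using closed by (simp add: mtopology_of_def)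
  have "limitin mtopology x y sequentially"
    unfolding limitin_metric using y x Ga_P lim by (auto elim: eventually_mono)
  then show ?thesis by (rule limitin_closedin[OF _ cl]) (use x in auto)
qed

section \<open>Completeness of the orbit and Effros' argument\<close>

lemma Ga_metric_space: "Metric_space Ga \<rho>"
proof -
  interpret Metric_space P \<rho> using Metric_space_mspace_mdist[of D] by simp
  show ?thesis by (rule subspace) (use Ga_P in blast)
qed

text \<open>Since \<open>D\<close> has the product uniformity, Cauchy sequences converge in each
  coordinate; closedness keeps the limit in the orbit.\<close>

lemma Ga_complete: "Metric_space.mcomplete Ga \<rho>"
proof -
  interpret X: Metric_space Ga \<rho> by (rule Ga_metric_space)
  show ?thesis unfolding X.mcomplete_def
  proof (intro allI impI)
    fix \<sigma> assume c: "X.MCauchy \<sigma>"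
    then have \<sigma>: "\<sigma> m \<in> Ga" for m by (auto simp: X.MCauchy_def)
    then have \<sigma>P: "\<sigma> m \<in> P" for m using Ga_P by blast
    have "\<exists>l\<in>S. \<forall>\<eta>>0. eventually (\<lambda>m. d (\<sigma> m i) l < \<eta>) sequentially" if i: "i \<in> I" for i
    proof (rule mcomplete_of_LIMSEQ[OF M_complete, of "\<lambda>m. \<sigma> m i"])
      show "\<sigma> m i \<in> S" for m using \<sigma>P i by simp
      fix \<eta> :: real assume "\<eta> > 0"
      then obtain \<delta> where \<delta>: "\<delta> > 0" "\<And>x y. x \<in> P \<Longrightarrow> y \<in> P \<Longrightarrow> \<rho> x y < \<delta> \<Longrightarrow> d (x i) (y i) < \<eta>"
        using coordinate_modulus[OF i] by blast
      obtain N where "\<And>k m. N \<le> k \<Longrightarrow> N \<le> m \<Longrightarrow> \<rho> (\<sigma> k) (\<sigma> m) < \<delta>"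
        using c \<delta>(1) unfolding X.MCauchy_def by blast
      then show "\<exists>N. \<forall>k m. N \<le> k \<and> N \<le> m \<longrightarrow> d (\<sigma> k i) (\<sigma> m i) < \<eta>" using \<delta>(2) \<sigma>P by blast
    qed blast
    then obtain l where l: "\<And>i. i \<in> I \<Longrightarrow> l i \<in> S"
      "\<And>i \<eta>. i \<in> I \<Longrightarrow> \<eta> > 0 \<Longrightarrow> eventually (\<lambda>m. d (\<sigma> m i) (l i) < \<eta>) sequentially" by metis
    define y where "y = restrict l I"
    have y: "y \<in> P" using l(1) by (auto simp: y_def power_space_def)
    have lim: "eventually (\<lambda>m. \<rho> (\<sigma> m) y < \<eta>) sequentially" if "\<eta> > 0" for \<eta>
      by (rule \<rho>_limit[OF \<sigma>P y that]) (use l(2) in \<open>auto simp: y_def\<close>)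
    have "y \<in> Ga" by (rule Ga_limit[OF \<sigma> y lim])
    then have "limitin X.mtopology \<sigma> y sequentially"
      unfolding X.limitin_metric using \<sigma> lim by (auto elim: eventually_mono)
    then show "\<exists>y. limitin X.mtopology \<sigma> y sequentially" by (intro exI)
  qed
qed

text \<open>Translates of \<open>{act g x | g. g \<in> V}\<close> by a countable set cover the orbit, so by the Baire
  category theorem the closure of one of them, hence of this set itself, has interior points.\<close>

lemma almost_open:
  assumes x: "x \<in> Ga" and F: "finite F" "F \<subseteq> S" and \<epsilon>: "\<epsilon> > 0"
  obtains \<delta> where "\<delta> > 0" "\<And>y \<eta>. y \<in> Ga \<Longrightarrow> \<rho> x y < \<delta> \<Longrightarrow> \<eta> > 0 \<Longrightarrow>
    \<exists>g\<in>carrier G. (\<forall>c\<in>F. d (g c) c < \<epsilon>) \<and> \<rho> (act g x) y < \<eta>"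
proof -
  interpret X: Metric_space Ga \<rho> by (rule Ga_metric_space)
  obtain b :: "nat \<Rightarrow> 'a" where b: "\<And>k. b k \<in> S" "\<And>x \<eta> N. x \<in> S \<Longrightarrow> \<eta> > 0 \<Longrightarrow> \<exists>k\<ge>N. d (b k) x < \<eta>"
    using dense_enumeration by blast
  \<comment> \<open>Countably many \<open>k\<close> suffice to cover the group. If \<open>g\<close>
    and \<open>h\<close> belong to the same \<open>k\<close>, then \<open>h\<close> followed by the
    inverse of \<open>g\<close> moves each point of \<open>F\<close> by less than
    \<open>\<epsilon>\<close>.\<close>
  define E where "E k = {act g x | g. g \<in> carrier G \<and> (\<forall>c\<in>F. d (g c) (b (k c)) < \<epsilon>/2)}" for k
  define K where "K = (\<Pi>\<^sub>E c\<in>F. (UNIV :: nat set))"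
  have E: "E k \<subseteq> Ga" for k using x act_Ga by (auto simp: E_def)
  have "countable K" unfolding K_def using F(1) by (intro countable_PiE) auto
  then have ctb: "countable ((\<lambda>k. X.mtopology closure_of E k) ` K)" by (rule countable_image)
  have "Ga \<subseteq> \<Union> ((\<lambda>k. X.mtopology closure_of E k) ` K)"
  proof
    fix y assume y: "y \<in> Ga"
    obtain g where g: "g \<in> carrier G" "act g x = y" using Ga_transitive[OF x y] by blast
    have e: "\<epsilon>/2 > 0" using \<epsilon> by simp
    have "\<exists>k. d (g c) (b k) < \<epsilon>/2" if "c \<in> F" for c
    proof -
      have "g c \<in> S" using g(1) that F(2) by auto
      then obtain k where "d (b k) (g c) < \<epsilon>/2" using b(2)[OF _ e] by blast
      then show ?thesis using d_sym by metis
    qed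
    then obtain k where k: "\<And>c. c \<in> F \<Longrightarrow> d (g c) (b (k c)) < \<epsilon>/2" by metis
    have "y \<in> E (restrict k F)" using g k unfolding E_def by auto
    moreover have "E (restrict k F) \<subseteq> X.mtopology closure_of E (restrict k F)"
      using E by (intro closure_of_subset) simp
    moreover have "restrict k F \<in> K" by (simp add: K_def)
    ultimately show "y \<in> \<Union> ((\<lambda>k. X.mtopology closure_of E k) ` K)" by blast
  qed
  moreover have "X.mtopology closure_of E k \<subseteq> Ga" for k
    using closure_of_subset_topspace[of X.mtopology "E k"] by simp
  ultimately have "\<Union> ((\<lambda>k. X.mtopology closure_of E k) ` K) = topspace X.mtopology" by auto
  then have "X.mtopology interior_of \<Union> ((\<lambda>k. X.mtopology closure_of E k) ` K) = Ga"
    using interior_of_topspace[of X.mtopology] by simp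
  then have "X.mtopology interior_of \<Union> ((\<lambda>k. X.mtopology closure_of E k) ` K) \<noteq> {}"
    using x by auto
  then obtain T where "T \<in> (\<lambda>k. X.mtopology closure_of E k) ` K"
      "\<not> (closedin X.mtopology T \<and> X.mtopology interior_of T = {})"
    using X.metric_Baire_category_alt[OF Ga_complete ctb] by blast
  then obtain k z where z: "z \<in> X.mtopology interior_of (X.mtopology closure_of E k)" by auto
  then have zG: "z \<in> Ga" using interior_of_subset_topspace by fastforce
  obtain r where r: "r > 0" "X.mball z r \<subseteq> X.mtopology closure_of E k"
    using z unfolding X.metric_interior_of by blast
  have near: "\<exists>w\<in>E k. \<rho> y w < \<eta>" if "y \<in> X.mtopology closure_of E k" "\<eta> > 0" for y \<eta>
    using that unfolding X.metric_closure_of by force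
  have "z \<in> X.mtopology closure_of E k" using r zG by auto
  \<comment> \<open>The interior point \<open>z\<close> lies only in the closure; an actual image
    \<open>act g x\<close> near it lets \<open>g\<close> carry a ball around \<open>x\<close> into
    the ball around \<open>z\<close>.\<close>
  then obtain y0 where y0: "y0 \<in> E k" "\<rho> z y0 < r/2" using near[of z "r/2"] r(1) by auto
  obtain g where g: "g \<in> carrier G" "y0 = act g x" "\<And>c. c \<in> F \<Longrightarrow> d (g c) (b (k c)) < \<epsilon>/2"
    using y0(1) unfolding E_def by blast
  show ?thesis
  proof (rule that[of "r/2"])
    show "r/2 > 0" using r by simp
    fix y \<eta> assume y: "y \<in> Ga" "\<rho> x y < r/2" and \<eta>: "(\<eta> :: real) > 0"
    have gy: "act g y \<in> Ga" using act_Ga g y by simp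
    have "\<rho> z (act g y) \<le> \<rho> z y0 + \<rho> y0 (act g y)"
      using zG y0 E gy Ga_P by (intro \<rho>_triangle) auto
    also have "\<rho> y0 (act g y) = \<rho> x y" using g x y Ga_P by simp
    finally have "act g y \<in> X.mball z r" using y0(2) y(2) zG gy by simp
    then obtain w where w: "w \<in> E k" "\<rho> (act g y) w < \<eta>" using near[of "act g y" \<eta>] r(2) \<eta> by blast
    obtain h where h: "h \<in> carrier G" "w = act h x" "\<And>c. c \<in> F \<Longrightarrow> d (h c) (b (k c)) < \<epsilon>/2"
      using w(1) unfolding E_def by blast
    \<comment> \<open>Both maps bring \<open>F\<close> near the same points \<open>b (k c)\<close>;
      composing with the inverse of \<open>g\<close> also takes the approximation of
      \<open>act g y\<close> back to one of \<open>y\<close>.\<close>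
    define g' where "g' = compose S (ainv g) h"
    have g': "g' \<in> carrier G" using g h by (simp add: g'_def Aut_compose Aut_ainv)
    have "d (g' c) c < \<epsilon>" if c: "c \<in> F" for c
    proof -
      have cS: "c \<in> S" using c F(2) by blast
      have "d (g' c) c = d (g (g' c)) (g c)" using g(1) g' cS by simp
      also have "g (g' c) = h c" using g(1) h(1) cS by (simp add: g'_def compose_eq)
      also have "d (h c) (g c) \<le> d (h c) (b (k c)) + d (b (k c)) (g c)"
        using g(1) h(1) cS b(1) by (intro d_triangle) auto
      finally show ?thesis using g(3)[OF c] h(3)[OF c] d_sym[of "b (k c)" "g c"] by linarith
    qed
    moreover have "\<rho> (act g' x) y < \<eta>"
    proof -
      have "\<rho> (act g' x) y = \<rho> (act g (act g' x)) (act g y)" using g(1) g' x y Ga_P by simp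
      also have "act g (act g' x) = w" using g(1) h x Ga_P by (simp add: g'_def act_compose Aut_ainv)
      finally show ?thesis using w(2) mdist_commute[of D w] by simp
    qed
    ultimately show "\<exists>g\<in>carrier G. (\<forall>c\<in>F. d (g c) c < \<epsilon>) \<and> \<rho> (act g x) y < \<eta>" using g' by blast
  qed
qed

lemma ainv_compose:
  assumes "g \<in> carrier G" "h \<in> carrier G" "x \<in> S"
  shows "ainv (compose S g h) x = ainv h (ainv g x)"
proof -
  have gh: "compose S g h \<in> carrier G" using assms by (simp add: Aut_compose)
  have y: "ainv h (ainv g x) \<in> S" using assms by (simp add: Aut_ainv)
  have "compose S g h (ainv h (ainv g x)) = x" using assms y by (simp add: compose_eq Aut_ainv)
  then show ?thesis using ainv_left[OF gh y] by simp
qed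

text \<open>Both points are moved in turn: the neighbourhood that controls the next move of one point is
  fixed before the other point is brought close to it.\<close>

lemma micro_transitive_at:
  assumes x: "x \<in> Ga" and F: "finite F" "F \<subseteq> S" and \<epsilon>: "\<epsilon> > 0"
  obtains \<delta> where "\<delta> > 0" "\<And>y. y \<in> Ga \<Longrightarrow> \<rho> x y < \<delta> \<Longrightarrow>
    \<exists>g\<in>carrier G. (\<forall>c\<in>F. d (g c) c < \<epsilon>) \<and> act g x = y"
proof -
  obtain b :: "nat \<Rightarrow> 'a" where b: "\<And>k. b k \<in> S" "\<And>x \<eta> N. x \<in> S \<Longrightarrow> \<eta> > 0 \<Longrightarrow> \<exists>k\<ge>N. d (b k) x < \<eta>"
    using dense_enumeration by blast
  have "\<exists>k. d (b k) z < \<eta>" if "z \<in> S" "\<eta> > 0" for z \<eta> using b(2)[OF that, of 0] by blast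
  then have bd: "dense_seq b" unfolding dense_seq_def using b(1) by (auto intro: seqs_I)
  \<comment> \<open>Each of the two limits displaces points of \<open>F\<close> by at most
    \<open>2 * \<epsilon>'\<close>, hence the quotient by at most \<open>4 * \<epsilon>'\<close>,
    which is below \<open>\<epsilon>\<close>.\<close>
  define \<epsilon>' where "\<epsilon>' = \<epsilon>/5"
  have \<epsilon>': "\<epsilon>' > 0" using \<epsilon> by (simp add: \<epsilon>'_def)
  define \<tau> where "\<tau> n = \<epsilon>' * (1/2)^n" for n :: nat
  have \<tau>: "\<tau> n > 0" for n using \<epsilon>' by (simp add: \<tau>_def)
  \<comment> \<open>Points that the next factor may hardly move: the current images of
    \<open>F\<close>, to bound the total displacement of \<open>F\<close>; the \<open>b i\<close>,
    to make the inverses converge; their images, to make the products converge.\<close>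
  define Z where "Z n u = u ` F \<union> b ` {..<n} \<union> u ` b ` {..<n}" for n :: nat and u :: "'a \<Rightarrow> 'a"
  have Z: "finite (Z n u)" "Z n u \<subseteq> S" if "u \<in> carrier G" for n u
    using F b(1) that by (auto simp: Z_def)
  define V where "V n u = {v \<in> carrier G. \<forall>z\<in>Z n u. d (v z) z < \<tau> n}" for n u
  have almost: "\<exists>\<delta>>0. \<forall>q\<in>Ga. \<rho> p q < \<delta> \<longrightarrow> (\<forall>\<eta>>0. \<exists>v\<in>V n u. \<rho> (act v p) q < \<eta>)"
    if p: "p \<in> Ga" and u: "u \<in> carrier G" for n p u
  proof -
    obtain \<delta> where "\<delta> > 0" "\<And>y \<eta>. y \<in> Ga \<Longrightarrow> \<rho> p y < \<delta> \<Longrightarrow> \<eta> > 0 \<Longrightarrow>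
      \<exists>g\<in>carrier G. (\<forall>c\<in>Z n u. d (g c) c < \<tau> n) \<and> \<rho> (act g p) y < \<eta>"
      using almost_open[OF p Z(1)[OF u] Z(2)[OF u] \<tau>] by metis
    then show ?thesis unfolding V_def by (intro exI[of _ \<delta>]) blast
  qed
  obtain \<delta> where \<delta>: "\<delta> > 0" "\<forall>q\<in>Ga. \<rho> x q < \<delta> \<longrightarrow> (\<forall>\<eta>>0. \<exists>v\<in>V 0 (\<lambda>x\<in>S. x). \<rho> (act v x) q < \<eta>)"
    using almost[OF x Aut_id] by blast
  have "\<exists>g\<in>carrier G. (\<forall>c\<in>F. d (g c) c < \<epsilon>) \<and> act g x = y" if y: "y \<in> Ga" "\<rho> x y < \<delta>" for y
  proof -
    have xP: "x \<in> P" and yP: "y \<in> P" using x y Ga_P by auto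
    \<comment> \<open>The third clause puts \<open>act (snd p) y\<close> into the closure of the
      translates of \<open>act (fst p) x\<close> by \<open>V n (fst p)\<close>, which prepares the
      next move of the first point. For the second point such control is set up within each
      stage.\<close>
    define Inv where "Inv n p \<longleftrightarrow> fst p \<in> carrier G \<and> snd p \<in> carrier G \<and>
      (\<forall>\<eta>>0. \<exists>v\<in>V n (fst p). \<rho> (act v (act (fst p) x)) (act (snd p) y) < \<eta>) \<and>
      (n = 0 \<longrightarrow> p = (\<lambda>x\<in>S. x, \<lambda>x\<in>S. x))" for n p
    define R where "R n p q \<longleftrightarrow> (\<exists>v\<in>V n (fst p). fst q = compose S v (fst p)) \<and>
      (\<exists>v\<in>V n (snd p). snd q = compose S v (snd p)) \<and> \<rho> (act (fst q) x) (act (snd q) y) < \<tau> n" for n p q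
    have "\<exists>p. \<forall>n. Inv n (p n) \<and> R n (p n) (p (Suc n))"
    proof (rule dependent_nat_choice)
      show "\<exists>p. Inv 0 p"
        by (rule exI[of _ "(\<lambda>x\<in>S. x, \<lambda>x\<in>S. x)"]) (use Aut_id \<delta>(2) y xP yP in \<open>simp add: Inv_def act_id\<close>)
      fix p n assume I: "Inv n p"
      define u w where "u = fst p" and "w = snd p"
      have uw: "u \<in> carrier G" "w \<in> carrier G"
        "\<And>\<eta>. \<eta> > 0 \<Longrightarrow> \<exists>v\<in>V n u. \<rho> (act v (act u x)) (act w y) < \<eta>"
        using I by (auto simp: Inv_def u_def w_def)
      have wy: "act w y \<in> Ga" using uw y by (simp add: act_Ga)
      obtain \<delta>1 where \<delta>1: "\<delta>1 > 0"
        "\<forall>q\<in>Ga. \<rho> (act w y) q < \<delta>1 \<longrightarrow> (\<forall>\<eta>>0. \<exists>v\<in>V n w. \<rho> (act v (act w y)) q < \<eta>)"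
        using almost[OF wy uw(2)] by blast
      obtain v where v: "v \<in> V n u" "\<rho> (act v (act u x)) (act w y) < \<delta>1"
        using uw(3)[OF \<delta>1(1)] by blast
      define u' where "u' = compose S v u"
      have vG: "v \<in> carrier G" using v(1) by (simp add: V_def)
      have u'G: "u' \<in> carrier G" using vG uw(1) by (simp add: u'_def Aut_compose)
      have u'x: "act u' x \<in> Ga" "act u' x = act v (act u x)"
        using u'G x vG uw(1) xP by (simp_all add: act_Ga u'_def act_compose)
      obtain \<delta>2 where \<delta>2: "\<delta>2 > 0"
        "\<forall>q\<in>Ga. \<rho> (act u' x) q < \<delta>2 \<longrightarrow> (\<forall>\<eta>>0. \<exists>v\<in>V (Suc n) u'. \<rho> (act v (act u' x)) q < \<eta>)"
        using almost[OF u'x(1) u'G] by blast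
      have "\<rho> (act w y) (act u' x) < \<delta>1" using v(2) u'x(2) mdist_commute[of D] by simp
      moreover have "min \<delta>2 (\<tau> n) > 0" using \<delta>2(1) \<tau> by simp
      ultimately obtain v' where v': "v' \<in> V n w" "\<rho> (act v' (act w y)) (act u' x) < min \<delta>2 (\<tau> n)"
        using \<delta>1(2) u'x(1) by meson
      define w' where "w' = compose S v' w"
      have v'G: "v' \<in> carrier G" using v'(1) by (simp add: V_def)
      have w'G: "w' \<in> carrier G" using v'G uw(2) by (simp add: w'_def Aut_compose)
      have w'y: "act w' y \<in> Ga" "act w' y = act v' (act w y)"
        using w'G y v'G uw(2) yP by (simp_all add: act_Ga w'_def act_compose)
      have close: "\<rho> (act u' x) (act w' y) < \<delta>2" "\<rho> (act u' x) (act w' y) < \<tau> n"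
        using v'(2) w'y(2) mdist_commute[of D] by simp_all
      have "Inv (Suc n) (u', w')" using u'G w'G \<delta>2(2) w'y(1) close(1) by (simp add: Inv_def)
      moreover have "R n p (u', w')" using v v' close(2)
        by (auto simp: R_def u_def[symmetric] w_def[symmetric] u'_def w'_def)
      ultimately show "\<exists>q. Inv (Suc n) q \<and> R n p q" by blast
    qed
    then obtain p where Inv: "\<And>n. Inv n (p n)" and R: "\<And>n. R n (p n) (p (Suc n))" by blast
    have limit: "\<exists>g\<in>carrier G. (\<forall>z\<in>S. \<forall>\<eta>>0. eventually (\<lambda>n. d (h n z) (g z) < \<eta>) sequentially) \<and>
        (\<forall>c\<in>F. d (g c) c \<le> 2 * \<epsilon>')"
      if h: "\<And>n. h n \<in> carrier G" and h0: "h 0 = (\<lambda>x\<in>S. x)"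
        and step: "\<And>n. \<exists>v\<in>V n (h n). h (Suc n) = compose S v (h n)" for h
    proof -
      have "d (h (Suc n) (b i)) (h n (b i)) \<le> \<epsilon>' * (1/2)^n \<and>
        d (ainv (h (Suc n)) (b i)) (ainv (h n) (b i)) \<le> \<epsilon>' * (1/2)^n" if "i < n" for i n
      proof -
        obtain v where v: "v \<in> V n (h n)" "h (Suc n) = compose S v (h n)" using step by blast
        then have vG: "v \<in> carrier G" by (simp add: V_def)
        have z: "b i \<in> Z n (h n)" "h n (b i) \<in> Z n (h n)" using that by (auto simp: Z_def)
        then have "d (v (b i)) (b i) < \<tau> n" "d (v (h n (b i))) (h n (b i)) < \<tau> n"
          using v(1) by (auto simp: V_def)
        \<comment> \<open>The inverse of \<open>h n\<close> is applied last on both sides and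
          cancels as an isometry; the inverse of \<open>v\<close> moves \<open>b i\<close> exactly
          as far as \<open>v\<close> does.\<close>
        moreover have "d (ainv (h (Suc n)) (b i)) (ainv (h n) (b i)) = d (v (b i)) (b i)"
        proof -
          have "d (ainv (h (Suc n)) (b i)) (ainv (h n) (b i)) = d (ainv (h n) (ainv v (b i))) (ainv (h n) (b i))"
            unfolding v(2) using vG h b(1) by (simp add: ainv_compose)
          also have "\<dots> = d (ainv v (b i)) (b i)" using Aut_ainv[OF h] Aut_ainv[OF vG] b(1) by simp
          also have "\<dots> = d (v (ainv v (b i))) (v (b i))" using vG Aut_ainv[OF vG] b(1) by (subst Aut_dist) auto
          also have "\<dots> = d (v (b i)) (b i)" using vG b(1) d_sym by simp
          finally show ?thesis .
        qed
        moreover have "h (Suc n) (b i) = v (h n (b i))" using b(1) by (simp add: v(2) compose_eq)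
        ultimately show ?thesis by (simp add: \<tau>_def)
      qed
      then obtain g where g: "g \<in> carrier G"
        "\<And>x \<eta>. x \<in> S \<Longrightarrow> \<eta> > 0 \<Longrightarrow> eventually (\<lambda>n. d (h n x) (g x) < \<eta>) sequentially"
        using Aut_limit[of h b \<epsilon>', OF h bd] by blast
      have "d (g c) c \<le> 2 * \<epsilon>'" if c: "c \<in> F" for c
      proof (rule field_le_epsilon)
        fix \<eta> :: real assume "\<eta> > 0"
        have cS: "c \<in> S" using c F(2) by blast
        \<comment> \<open>The partial sums of \<open>\<tau>\<close>, in closed form for the
          induction.\<close>
        have bound: "d (h n c) c \<le> 2 * \<epsilon>' * (1 - (1/2)^n)" for n
        proof (induction n)
          case 0
          then show ?case using cS by (simp add: h0)
        next
          case (Suc n)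
          obtain v where v: "v \<in> V n (h n)" "h (Suc n) = compose S v (h n)" using step by blast
          have "h n c \<in> Z n (h n)" using c by (auto simp: Z_def)
          then have "d (v (h n c)) (h n c) < \<tau> n" using v(1) by (auto simp: V_def)
          moreover have "h (Suc n) c = v (h n c)" using cS by (simp add: v(2) compose_eq)
          moreover have "d (h (Suc n) c) c \<le> d (h (Suc n) c) (h n c) + d (h n c) c"
            using h cS by (intro d_triangle) auto
          moreover have "2 * \<epsilon>' * (1 - (1/2)^Suc n) = \<epsilon>' * (1/2)^n + 2 * \<epsilon>' * (1 - (1/2)^n)"
            by (simp add: algebra_simps)
          ultimately show ?case using Suc.IH by (simp add: \<tau>_def)
        qed
        have "2 * \<epsilon>' * (1 - (1/2)^n) \<le> 2 * \<epsilon>'" for n using \<epsilon>' by simp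
        then have bound': "d (h n c) c \<le> 2 * \<epsilon>'" for n using bound order_trans by blast
        obtain n where "d (h n c) (g c) < \<eta>"
          using eventually_happens'[OF sequentially_bot g(2)[OF cS \<open>\<eta> > 0\<close>]] by blast
        moreover have "d (g c) c \<le> d (g c) (h n c) + d (h n c) c" using g(1) h cS by (intro d_triangle) auto
        ultimately show "d (g c) c \<le> 2 * \<epsilon>' + \<eta>" using bound'[of n] d_sym[of "g c" "h n c"] by linarith
      qed
      then show ?thesis using g by blast
    qed
    have pG: "fst (p n) \<in> carrier G" "snd (p n) \<in> carrier G" for n using Inv[of n] by (auto simp: Inv_def)
    have p0: "fst (p 0) = (\<lambda>x\<in>S. x)" "snd (p 0) = (\<lambda>x\<in>S. x)" using Inv[of 0] by (auto simp: Inv_def)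
    have step: "\<exists>v\<in>V n (fst (p n)). fst (p (Suc n)) = compose S v (fst (p n))"
      "\<exists>v\<in>V n (snd (p n)). snd (p (Suc n)) = compose S v (snd (p n))" for n
      using R[of n] by (auto simp: R_def)
    obtain u where u: "u \<in> carrier G" "\<And>c. c \<in> F \<Longrightarrow> d (u c) c \<le> 2 * \<epsilon>'"
      "\<And>z \<eta>. z \<in> S \<Longrightarrow> \<eta> > 0 \<Longrightarrow> eventually (\<lambda>n. d (fst (p n) z) (u z) < \<eta>) sequentially"
      using limit[of "\<lambda>n. fst (p n)", OF pG(1) p0(1) step(1)] by blast
    obtain w where w: "w \<in> carrier G" "\<And>c. c \<in> F \<Longrightarrow> d (w c) c \<le> 2 * \<epsilon>'"
      "\<And>z \<eta>. z \<in> S \<Longrightarrow> \<eta> > 0 \<Longrightarrow> eventually (\<lambda>n. d (snd (p n) z) (w z) < \<eta>) sequentially"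
      using limit[of "\<lambda>n. snd (p n)", OF pG(2) p0(2) step(2)] by blast
    \<comment> \<open>At stage \<open>n\<close> the two moving points are within
      \<open>\<tau> n\<close>, so their limits agree in every coordinate.\<close>
    have "act u x = act w y"
    proof (rule P_ext)
      show "act u x \<in> P" "act w y \<in> P" using u w xP yP by auto
      fix i assume i: "i \<in> I"
      have "u (x i) = w (y i)"
      proof (rule zero_if_small)
        show xi: "u (x i) \<in> S" and yi: "w (y i) \<in> S" using u w xP yP i by auto
        fix \<eta> :: real assume "\<eta> > 0"
        then have e: "\<eta>/3 > 0" by simp
        obtain \<gamma> where \<gamma>: "\<gamma> > 0" "\<And>x y. x \<in> P \<Longrightarrow> y \<in> P \<Longrightarrow> \<rho> x y < \<gamma> \<Longrightarrow> d (x i) (y i) < \<eta>/3"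
          using coordinate_modulus[OF i e] by blast
        obtain N where N: "\<And>n. n \<ge> N \<Longrightarrow> \<tau> n < \<gamma>" unfolding \<tau>_def using small_power[OF \<gamma>(1)] by blast
        obtain N1 where N1: "\<And>n. n \<ge> N1 \<Longrightarrow> d (fst (p n) (x i)) (u (x i)) < \<eta>/3"
          using u(3)[OF P_mem[OF xP i] e] unfolding eventually_sequentially by blast
        obtain N2 where N2: "\<And>n. n \<ge> N2 \<Longrightarrow> d (snd (p n) (y i)) (w (y i)) < \<eta>/3"
          using w(3)[OF P_mem[OF yP i] e] unfolding eventually_sequentially by blast
        define n where "n = max N (max N1 N2)"
        have "\<rho> (act (fst (p (Suc n))) x) (act (snd (p (Suc n))) y) < \<tau> n" using R[of n] by (simp add: R_def)
        also have "\<tau> n < \<gamma>" by (rule N) (simp add: n_def)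
        finally have "d (act (fst (p (Suc n))) x i) (act (snd (p (Suc n))) y i) < \<eta>/3"
          by (intro \<gamma>(2) act_mem pG xP yP)
        then have "d (fst (p (Suc n)) (x i)) (snd (p (Suc n)) (y i)) < \<eta>/3" using xP yP i by simp
        moreover have "d (fst (p (Suc n)) (x i)) (u (x i)) < \<eta>/3" by (rule N1) (simp add: n_def)
        moreover have "d (snd (p (Suc n)) (y i)) (w (y i)) < \<eta>/3" by (rule N2) (simp add: n_def)
        moreover have "d (u (x i)) (w (y i)) \<le> d (u (x i)) (fst (p (Suc n)) (x i)) + d (fst (p (Suc n)) (x i)) (w (y i))"
          "d (fst (p (Suc n)) (x i)) (w (y i)) \<le>
            d (fst (p (Suc n)) (x i)) (snd (p (Suc n)) (y i)) + d (snd (p (Suc n)) (y i)) (w (y i))"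
          using xi yi Aut_mem[OF pG(1) P_mem[OF xP i]] Aut_mem[OF pG(2) P_mem[OF yP i]]
          by (auto intro!: d_triangle)
        ultimately show "d (u (x i)) (w (y i)) \<le> \<eta>"
          using d_sym[of "u (x i)" "fst (p (Suc n)) (x i)"] by linarith
      qed
      then show "act u x i = act w y i" using xP yP i by simp
    qed
    define g where "g = compose S (ainv w) u"
    have g: "g \<in> carrier G" using u w by (simp add: g_def Aut_compose Aut_ainv)
    have "act g x = y" using \<open>act u x = act w y\<close> u w xP yP by (simp add: g_def act_compose Aut_ainv)
    moreover have "d (g c) c < \<epsilon>" if c: "c \<in> F" for c
    proof -
      have cS: "c \<in> S" using c F(2) by blast
      have "d (g c) c = d (w (g c)) (w c)" using w(1) g cS by simp
      also have "w (g c) = u c" using u w(1) cS by (simp add: g_def compose_eq)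
      also have "d (u c) (w c) \<le> d (u c) c + d c (w c)" using u(1) w(1) cS by (intro d_triangle) auto
      finally have "d (g c) c \<le> 4 * \<epsilon>'" using u(2)[OF c] w(2)[OF c] d_sym[of c "w c"] by linarith
      then show ?thesis using \<epsilon> by (simp add: \<epsilon>'_def)
    qed
    ultimately show ?thesis using g by blast
  qed
  then show ?thesis using that \<delta>(1) by blast
qed

text \<open>The automorphisms \<open>g j\<close> themselves need not converge, only the images of
  chosen points do. Hence \<open>F\<close> is listed as a tuple and translated together with
  \<open>x j\<close>.\<close>

lemma uniform_micro_transitivity:
  assumes F: "finite F" "F \<subseteq> S" and \<epsilon>: "\<epsilon> > 0"
  obtains \<delta> where "\<delta> > 0" "\<And>x y. x \<in> Ga \<Longrightarrow> y \<in> Ga \<Longrightarrow> \<rho> x y < \<delta> \<Longrightarrow>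
    \<exists>g\<in>carrier G. (\<forall>c\<in>F. d (g c) c < \<epsilon>) \<and> act g x = y"
proof (rule ccontr)
  note out = that
  assume no: "\<not> thesis"
  define good where "good x y \<longleftrightarrow> (\<exists>g\<in>carrier G. (\<forall>c\<in>F. d (g c) c < \<epsilon>) \<and> act g x = y)" for x y
  have "\<exists>x y. x \<in> Ga \<and> y \<in> Ga \<and> \<rho> x y < 1 / Suc j \<and> \<not> good x y" for j :: nat
  proof (rule ccontr)
    assume "\<nexists>x y. x \<in> Ga \<and> y \<in> Ga \<and> \<rho> x y < 1 / Suc j \<and> \<not> good x y"
    then have "good x y" if "x \<in> Ga" "y \<in> Ga" "\<rho> x y < 1 / Suc j" for x y using that by blast
    then have thesis unfolding good_def by (intro out[of "1 / Suc j"]) simp_all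
    then show False using no by blast
  qed
  then obtain x y where xy: "\<And>j :: nat. x j \<in> Ga" "\<And>j. y j \<in> Ga" "\<And>j. \<rho> (x j) (y j) < 1 / Suc j" "\<And>j. \<not> good (x j) (y j)"
    by metis
  then have xP: "x j \<in> P" and yP: "y j \<in> P" for j using Ga_P by auto
  obtain l where l: "set l = F" using finite_list[OF F(1)] by blast
  obtain pt where pt: "pt \<in> S" using S_nonempty by blast
  define f where "f i = (if i < length l then l ! i else pt)" for i
  have f: "f i \<in> S" for i using l F(2) pt by (auto simp: f_def)
  have F_f: "\<exists>i<length l. c = f i" if "c \<in> F" for c using that l unfolding f_def by (metis in_set_conv_nth)
  \<comment> \<open>Even coordinates carry the tuple in the orbit, odd ones the elements of
    \<open>F\<close>; the point \<open>pt\<close> fills the remaining positions, for instance when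
    \<open>n\<close> is finite.\<close>
  define s where "s j i = (if even i then if i div 2 \<in> I then x j (i div 2) else pt else f (i div 2))" for j i
  have sM: "s j \<in> seqs M" for j by (intro seqs_I) (simp add: s_def xP f pt)
  obtain r g z where r: "strict_mono (r :: nat \<Rightarrow> nat)" and g: "\<And>j. g j \<in> carrier G" and z: "z \<in> seqs M"
    and lim: "\<And>i \<eta>. \<eta> > 0 \<Longrightarrow> eventually (\<lambda>j. d (g j (s (r j) i)) (z i) < \<eta>) sequentially"
    using orbit_space_compact[of s, OF sM] by blast
  define x' where "x' = (\<lambda>i\<in>I. z (2 * i))"
  define c where "c i = z (2 * i + 1)" for i
  have x'P: "x' \<in> P" using z by (simp add: x'_def power_space_def)
  have cS: "c i \<in> S" for i using z by (simp add: c_def)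
  have limx: "eventually (\<lambda>j. \<rho> (act (g j) (x (r j))) x' < \<eta>) sequentially" if "\<eta> > 0" for \<eta>
  proof (rule \<rho>_limit[OF _ x'P that])
    show "act (g j) (x (r j)) \<in> P" for j using g xP by simp
    fix i and \<eta> :: real assume "i \<in> I" "\<eta> > 0"
    then show "eventually (\<lambda>j. d (act (g j) (x (r j)) i) (x' i) < \<eta>) sequentially"
      using lim[of \<eta> "2 * i"] xP by (simp add: s_def x'_def)
  qed
  have x'G: "x' \<in> Ga" by (rule Ga_limit[OF act_Ga[OF g xy(1)] x'P limx])
  have e4: "\<epsilon>/4 > 0" using \<epsilon> by simp
  have cF: "finite (c ` {..<length l})" "c ` {..<length l} \<subseteq> S" using cS by auto
  obtain \<delta> where \<delta>: "\<delta> > 0" "\<And>y. y \<in> Ga \<Longrightarrow> \<rho> x' y < \<delta> \<Longrightarrow>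
    \<exists>g\<in>carrier G. (\<forall>c\<in>c ` {..<length l}. d (g c) c < \<epsilon>/4) \<and> act g x' = y"
    using micro_transitive_at[OF x'G cF e4] by blast
  have d2: "\<delta>/2 > 0" using \<delta>(1) by simp
  have "eventually (\<lambda>j. \<forall>i\<in>{..<length l}. d (g j (f i)) (c i) < \<epsilon>/4) sequentially"
  proof (intro eventually_ball_finite ballI)
    show "eventually (\<lambda>j. d (g j (f i)) (c i) < \<epsilon>/4) sequentially" for i
      using lim[OF e4, of "2 * i + 1"] by (simp add: s_def c_def)
  qed simp
  then have "eventually (\<lambda>j. (\<forall>i\<in>{..<length l}. d (g j (f i)) (c i) < \<epsilon>/4) \<and> \<rho> (act (g j) (x (r j))) x' < \<delta>/2) sequentially"
    using limx[OF d2] by (rule eventually_conj)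
  then obtain N where N: "\<And>j. j \<ge> N \<Longrightarrow> (\<forall>i\<in>{..<length l}. d (g j (f i)) (c i) < \<epsilon>/4) \<and> \<rho> (act (g j) (x (r j))) x' < \<delta>/2"
    unfolding eventually_sequentially by blast
  obtain N' where N': "1 / Suc N' < \<delta>/2" using d2 by (meson nat_approx_posE)
  define j where "j = max N N'"
  have gj: "\<And>i. i < length l \<Longrightarrow> d (g j (f i)) (c i) < \<epsilon>/4" "\<rho> (act (g j) (x (r j))) x' < \<delta>/2"
    using N[of j] by (auto simp: j_def)
  have "N' \<le> r j" using seq_suble[OF r, of j] by (simp add: j_def)
  then have "1 / Suc (r j) \<le> 1 / Suc N'" by (simp add: frac_le)
  then have rj: "\<rho> (x (r j)) (y (r j)) < \<delta>/2" using xy(3)[of "r j"] N' by linarith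
  have xG: "act (g j) (x (r j)) \<in> Ga" and yG: "act (g j) (y (r j)) \<in> Ga" using g xy by (simp_all add: act_Ga)
  have "\<rho> x' (act (g j) (x (r j))) < \<delta>" using gj(2) \<delta>(1) mdist_commute[of D x'] by simp
  then obtain h where h: "h \<in> carrier G" "\<And>i. i < length l \<Longrightarrow> d (h (c i)) (c i) < \<epsilon>/4" "act h x' = act (g j) (x (r j))"
    using \<delta>(2)[OF xG] by blast
  have "\<rho> x' (act (g j) (y (r j))) \<le> \<rho> x' (act (g j) (x (r j))) + \<rho> (act (g j) (x (r j))) (act (g j) (y (r j)))"
    using x'P xG yG Ga_P by (intro \<rho>_triangle) auto
  also have "\<rho> (act (g j) (x (r j))) (act (g j) (y (r j))) = \<rho> (x (r j)) (y (r j))" using g xP yP by simp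
  finally have "\<rho> x' (act (g j) (y (r j))) < \<delta>" using gj(2) rj mdist_commute[of D x'] by simp
  then obtain k where k: "k \<in> carrier G" "\<And>i. i < length l \<Longrightarrow> d (k (c i)) (c i) < \<epsilon>/4" "act k x' = act (g j) (y (r j))"
    using \<delta>(2)[OF yG] by blast
  \<comment> \<open>\<open>h\<close> and \<open>k\<close> reach both translated points from the same
    \<open>x'\<close>; their quotient is conjugated back by \<open>g j\<close>. An element of
    \<open>F\<close> is displaced by four terms below \<open>\<epsilon>/4\<close>: the moves of
    \<open>c i\<close> under \<open>h\<close> and \<open>k\<close>, and twice the distance of its
    image under \<open>g j\<close> to \<open>c i\<close>.\<close>
  define q where "q = compose S (ainv (g j)) (compose S k (compose S (ainv h) (g j)))"
  have q: "q \<in> carrier G" using g h k by (simp add: q_def Aut_compose Aut_ainv)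
  have "act q (x (r j)) = act (ainv (g j)) (act k (act (ainv h) (act (g j) (x (r j)))))"
    using g h k xP by (simp add: q_def Aut_compose Aut_ainv act_compose)
  also have "\<dots> = act (ainv (g j)) (act k x')" using h(1) x'P unfolding h(3)[symmetric] by simp
  also have "\<dots> = y (r j)" using g yP by (simp add: k(3))
  finally have "act q (x (r j)) = y (r j)" .
  moreover have "d (q b) b < \<epsilon>" if b: "b \<in> F" for b
  proof -
    obtain i where i: "i < length l" "b = f i" using F_f[OF b] by blast
    have bS: "b \<in> S" using f i by simp
    define e where "e = g j b"
    have eS: "e \<in> S" "ainv h e \<in> S" using g h bS by (simp_all add: e_def Aut_ainv)
    have "d (q b) b = d (g j (q b)) (g j b)" using g q bS by simp
    also have "g j (q b) = k (ainv h e)"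
      using g h k bS by (simp add: q_def compose_eq Aut_compose Aut_ainv e_def)
    also have "d (k (ainv h e)) (g j b) \<le> d (k (ainv h e)) (k (c i)) + d (k (c i)) e"
      unfolding e_def[symmetric] using k(1) cS eS by (intro d_triangle) auto
    also have "d (k (ainv h e)) (k (c i)) = d (h (ainv h e)) (h (c i))"
      using Aut_dist[OF k(1) eS(2) cS] Aut_dist[OF h(1) eS(2) cS] by (simp only:)
    also have "h (ainv h e) = e" using h(1) eS by simp
    finally have "d (q b) b \<le> d e (h (c i)) + d (k (c i)) e" .
    moreover have "d e (h (c i)) \<le> d e (c i) + d (c i) (h (c i))" "d (k (c i)) e \<le> d (k (c i)) (c i) + d (c i) e"
      using eS cS h(1) k(1) by (auto intro!: d_triangle)
    moreover have "d e (c i) < \<epsilon>/4" using gj(1)[OF i(1)] by (simp add: e_def i(2))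
    ultimately show ?thesis
      using h(2)[OF i(1)] k(2)[OF i(1)] d_sym[of "c i" e] d_sym[of "c i" "h (c i)"] by linarith
  qed
  ultimately have "good (x (r j)) (y (r j))" unfolding good_def using q by blast
  then show False using xy(4) by blast
qed

end

section \<open>Topology of the automorphism group\<close>

context sep_cat
begin

abbreviation "TG \<equiv> Aut_topology L M"

lemma topspace_TG [simp]: "topspace TG = carrier G"
proof -
  have "carrier G \<subseteq> (\<Pi>\<^sub>E x\<in>S. S)"
    unfolding Aut_iff subset_iff by (auto simp: Bij_def bij_betw_def extensional_def PiE_iff)
  then show ?thesis by (auto simp: Aut_topology_def)
qed

lemma openin_TG_nbhd:
  assumes g: "g \<in> carrier G" and F: "finite F" "F \<subseteq> S"
  shows "openin TG {h \<in> carrier G. \<forall>c\<in>F. d (h c) (g c) < \<epsilon>}"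
proof -
  interpret Metric_space S d by simp
  have one: "openin TG {h \<in> carrier G. d (h c) (g c) < \<epsilon>}" if c: "c \<in> S" for c
  proof -
    have "continuous_map TG mtopology (\<lambda>h. h c)"
      unfolding Aut_topology_def mtopology_of_def
      by (intro continuous_map_from_subtopology continuous_map_product_projection c)
    then have "openin TG {h \<in> topspace TG. h c \<in> mball (g c) \<epsilon>}"
      by (rule openin_continuous_map_preimage) simp
    moreover have "{h \<in> topspace TG. h c \<in> mball (g c) \<epsilon>} = {h \<in> carrier G. d (h c) (g c) < \<epsilon>}"
      using g c d_sym by auto
    ultimately show ?thesis by simp
  qed
  show ?thesis using F
  proof (induction F)
    case empty
    then show ?case using openin_topspace[of TG] by simp
  next
    case (insert c F)
    then have "openin TG ({h \<in> carrier G. d (h c) (g c) < \<epsilon>} \<inter> {h \<in> carrier G. \<forall>c\<in>F. d (h c) (g c) < \<epsilon>})"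
      using one by (intro openin_Int) auto
    moreover have "{h \<in> carrier G. d (h c) (g c) < \<epsilon>} \<inter> {h \<in> carrier G. \<forall>c\<in>F. d (h c) (g c) < \<epsilon>} =
      {h \<in> carrier G. \<forall>c\<in>insert c F. d (h c) (g c) < \<epsilon>}" by auto
    ultimately show ?case by simp
  qed
qed

text \<open>The topology is induced from a product, so estimates at single points of
  \<open>S\<close> suffice.\<close>

lemma continuous_map_into_TG:
  assumes f: "\<And>x. x \<in> topspace X \<Longrightarrow> f x \<in> carrier G"
    and cont: "\<And>x c \<epsilon>. x \<in> topspace X \<Longrightarrow> c \<in> S \<Longrightarrow> \<epsilon> > 0 \<Longrightarrow>
      \<exists>U. openin X U \<and> x \<in> U \<and> (\<forall>y\<in>U. d (f x c) (f y c) < \<epsilon>)"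
  shows "continuous_map X TG f"
proof -
  interpret Metric_space S d by simp
  have ext: "f x \<in> extensional S" if "x \<in> topspace X" for x
    using f[OF that] unfolding Aut_iff by (auto simp: Bij_def)
  have "continuous_map X mtopology (\<lambda>x. f x c)" if c: "c \<in> S" for c
    unfolding continuous_map_to_metric
  proof (intro ballI allI impI)
    fix x and \<epsilon> :: real assume x: "x \<in> topspace X" and \<epsilon>: "\<epsilon> > 0"
    obtain U where U: "openin X U" "x \<in> U" "\<And>y. y \<in> U \<Longrightarrow> d (f x c) (f y c) < \<epsilon>"
      using cont[OF x c \<epsilon>] by blast
    have "f y c \<in> mball (f x c) \<epsilon>" if "y \<in> U" for y
      using U(3)[OF that] f c x that openin_subset[OF U(1)] by auto
    then show "\<exists>U. openin X U \<and> x \<in> U \<and> (\<forall>y\<in>U. f y c \<in> mball (f x c) \<epsilon>)" using U by blast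
  qed
  then show ?thesis
    unfolding Aut_topology_def continuous_map_in_subtopology continuous_map_componentwise mtopology_of_def
    by (intro conjI image_subsetI ballI ext f) (simp_all add: image_subset_iff ext f)
qed

lemma topological_group_Aut: "topological_group G TG"
  unfolding topological_group_def
proof (intro conjI Aut_group topspace_TG)
  show "continuous_map (prod_topology TG TG) TG (\<lambda>(g, h). g \<otimes>\<^bsub>G\<^esub> h)"
  proof (rule continuous_map_into_TG)
    fix p assume p: "p \<in> topspace (prod_topology TG TG)"
    then show "(case p of (g, h) \<Rightarrow> g \<otimes>\<^bsub>G\<^esub> h) \<in> carrier G" by (auto simp: Aut_mult Aut_compose)
    fix c and \<epsilon> :: real assume c: "c \<in> S" and \<epsilon>: "\<epsilon> > 0"
    obtain g h where gh: "p = (g, h)" "g \<in> carrier G" "h \<in> carrier G" using p by auto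
    \<comment> \<open>Controlling \<open>g'\<close> at the single point \<open>h c\<close> is
      enough, because \<open>g'\<close> is an isometry and keeps \<open>h' c\<close> close to
      \<open>h c\<close>.\<close>
    define U where "U = {g' \<in> carrier G. \<forall>c\<in>{h c}. d (g' c) (g c) < \<epsilon>/2} \<times> {h' \<in> carrier G. \<forall>c\<in>{c}. d (h' c) (h c) < \<epsilon>/2}"
    have "openin (prod_topology TG TG) U" unfolding U_def
      by (intro openin_prod_Times_iff[THEN iffD2] disjI2 conjI openin_TG_nbhd) (use gh c in auto)
    moreover have "p \<in> U" using gh c \<epsilon> by (simp add: U_def)
    moreover have "d ((case p of (g, h) \<Rightarrow> g \<otimes>\<^bsub>G\<^esub> h) c) ((case q of (g, h) \<Rightarrow> g \<otimes>\<^bsub>G\<^esub> h) c) < \<epsilon>" if "q \<in> U" for q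
    proof -
      obtain g' h' where q: "q = (g', h')" "g' \<in> carrier G" "h' \<in> carrier G"
        "d (g' (h c)) (g (h c)) < \<epsilon>/2" "d (h' c) (h c) < \<epsilon>/2" using \<open>q \<in> U\<close> by (auto simp: U_def)
      have "d (g (h c)) (g' (h' c)) \<le> d (g (h c)) (g' (h c)) + d (g' (h c)) (g' (h' c))"
        using gh q c by (intro d_triangle) auto
      also have "d (g' (h c)) (g' (h' c)) = d (h c) (h' c)" using gh q c by simp
      finally have "d (g (h c)) (g' (h' c)) < \<epsilon>"
        using q(4,5) d_sym[of "g (h c)" "g' (h c)"] d_sym[of "h c" "h' c"] by linarith
      then show ?thesis using gh q c by (simp add: Aut_mult compose_eq)
    qed
    ultimately show "\<exists>U. openin (prod_topology TG TG) U \<and> p \<in> U \<and> (\<forall>q\<in>U. d ((case p of (g, h) \<Rightarrow> g \<otimes>\<^bsub>G\<^esub> h) c) ((case q of (g, h) \<Rightarrow> g \<otimes>\<^bsub>G\<^esub> h) c) < \<epsilon>)"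
      by blast
  qed
  show "continuous_map TG TG (\<lambda>g. inv\<^bsub>G\<^esub> g)"
  proof (rule continuous_map_into_TG)
    fix g assume "g \<in> topspace TG"
    then have g: "g \<in> carrier G" by simp
    then show "inv\<^bsub>G\<^esub> g \<in> carrier G" by (simp add: Aut_inv Aut_ainv)
    fix c and \<epsilon> :: real assume c: "c \<in> S" and \<epsilon>: "\<epsilon> > 0"
    have gc: "ainv g c \<in> S" using g c by (simp add: Aut_ainv)
    \<comment> \<open>Controlling \<open>h\<close> at the preimage of \<open>c\<close> under
      \<open>g\<close> controls the inverse of \<open>h\<close> at \<open>c\<close>, again by
      isometry.\<close>
    define U where "U = {h \<in> carrier G. \<forall>b\<in>{ainv g c}. d (h b) (g b) < \<epsilon>}"
    have "openin TG U" unfolding U_def using g gc by (intro openin_TG_nbhd) auto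
    moreover have "g \<in> U" using g c gc \<epsilon> by (simp add: U_def)
    moreover have "d ((inv\<^bsub>G\<^esub> g) c) ((inv\<^bsub>G\<^esub> h) c) < \<epsilon>" if "h \<in> U" for h
    proof -
      have h: "h \<in> carrier G" "d (h (ainv g c)) c < \<epsilon>" using that g c by (auto simp: U_def)
      have "ainv h c \<in> S" using h c by (simp add: Aut_ainv)
      then have "d (ainv g c) (ainv h c) = d (h (ainv g c)) (h (ainv h c))" using Aut_dist[OF h(1) gc] by simp
      then show ?thesis using h g c by (simp add: Aut_inv)
    qed
    ultimately show "\<exists>U. openin TG U \<and> g \<in> U \<and> (\<forall>h\<in>U. d ((inv\<^bsub>G\<^esub> g) c) ((inv\<^bsub>G\<^esub> h) c) < \<epsilon>)" by blast
  qed
qed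

text \<open>A basic open set of the product restricts finitely many coordinates \<open>i\<close>,
  and each restriction contains a ball around \<open>i\<close>, the value of the identity
  there.\<close>

lemma nbhd_of_identity_Aut:
  assumes "nbhd_of_identity G TG U"
  obtains F \<epsilon> where "finite F" "F \<subseteq> S" "\<epsilon> > 0" "\<And>g. g \<in> carrier G \<Longrightarrow> (\<And>c. c \<in> F \<Longrightarrow> d (g c) c < \<epsilon>) \<Longrightarrow> g \<in> U"
proof -
  interpret Metric_space S d by simp
  obtain V where V: "openin TG V" "\<one>\<^bsub>G\<^esub> \<in> V" "V \<subseteq> U" using assms unfolding nbhd_of_identity_def by blast
  then obtain W where W: "openin (product_topology (\<lambda>_. mtopology) S) W" "V = W \<inter> carrier G"
    unfolding Aut_topology_def openin_subtopology mtopology_of_def by blast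
  have "\<one>\<^bsub>G\<^esub> \<in> W" using V W by blast
  have "\<exists>B. finite {i \<in> S. B i \<noteq> topspace mtopology} \<and> (\<forall>i\<in>S. openin mtopology (B i)) \<and>
      \<one>\<^bsub>G\<^esub> \<in> (\<Pi>\<^sub>E i\<in>S. B i) \<and> (\<Pi>\<^sub>E i\<in>S. B i) \<subseteq> W"
    using W(1) \<open>\<one>\<^bsub>G\<^esub> \<in> W\<close> unfolding openin_product_topology_alt by (rule bspec)
  then obtain B where B: "finite {i \<in> S. B i \<noteq> topspace mtopology}" "\<And>i. i \<in> S \<Longrightarrow> openin mtopology (B i)"
    "\<one>\<^bsub>G\<^esub> \<in> (\<Pi>\<^sub>E i\<in>S. B i)" "(\<Pi>\<^sub>E i\<in>S. B i) \<subseteq> W"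
    by (elim exE conjE) simp
  define F where "F = {i \<in> S. B i \<noteq> topspace mtopology}"
  have "\<exists>r>0. mball i r \<subseteq> B i" if "i \<in> F" for i
  proof -
    have i: "i \<in> S" using that by (simp add: F_def)
    then have "i \<in> B i" using B(3) by (auto simp: Aut_one PiE_iff)
    then show ?thesis using B(2)[OF i] unfolding openin_mtopology by blast
  qed
  then obtain r where r: "\<And>i. i \<in> F \<Longrightarrow> r i > 0" "\<And>i. i \<in> F \<Longrightarrow> mball i (r i) \<subseteq> B i" by metis
  \<comment> \<open>The element 1 keeps the minimum meaningful when \<open>F\<close> is
    empty.\<close>
  define \<epsilon> where "\<epsilon> = Min (insert 1 (r ` F))"
  have F: "finite F" "F \<subseteq> S" using B(1) by (auto simp: F_def)
  have \<epsilon>: "\<epsilon> > 0" "\<And>i. i \<in> F \<Longrightarrow> \<epsilon> \<le> r i" using F(1) r(1) by (auto simp: \<epsilon>_def)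
  have "g \<in> U" if g: "g \<in> carrier G" and c: "\<And>c. c \<in> F \<Longrightarrow> d (g c) c < \<epsilon>" for g
  proof -
    have "g i \<in> B i" if i: "i \<in> S" for i
    proof (cases "i \<in> F")
      case True
      have "d i (g i) < r i" using c[OF True] \<epsilon>(2)[OF True] d_sym[of i] by simp
      then show ?thesis using r(2)[OF True] i g by auto
    next
      case False
      then show ?thesis using i g by (simp add: F_def)
    qed
    moreover have "g \<in> extensional S" using g unfolding Aut_iff by (auto simp: Bij_def)
    ultimately have "g \<in> (\<Pi>\<^sub>E i\<in>S. B i)" by (simp add: PiE_iff)
    then show ?thesis using B(4) W(2) V(3) g by blast
  qed
  then show ?thesis using that F \<epsilon>(1) by blast
qed

end

context closed_orbit
begin

section \<open>The continuous action on the closed orbit\<close>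

abbreviation "X \<equiv> submetric D Ga"
abbreviation "\<phi> \<equiv> (\<lambda>g. restrict (act g) Ga)"

lemma mspace_X: "mspace X = Ga"
  using Ga_P by (auto simp: mspace_submetric)

lemma group_action_Ga: "group_action G Ga \<phi>"
proof -
  have bij: "\<phi> g \<in> Bij Ga" if g: "g \<in> carrier G" for g
  proof -
    have "bij_betw (act g) Ga Ga"
      by (rule bij_betwI[where g = "act (ainv g)"])
        (use g act_Ga Aut_ainv[OF g] Ga_P in auto)
    then show ?thesis by (simp add: Bij_def cong: bij_betw_cong)
  qed
  have "\<phi> (g \<otimes>\<^bsub>G\<^esub> h) = \<phi> g \<otimes>\<^bsub>BijGroup Ga\<^esub> \<phi> h" if gh: "g \<in> carrier G" "h \<in> carrier G" for g h
  proof
    fix x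
    show "\<phi> (g \<otimes>\<^bsub>G\<^esub> h) x = (\<phi> g \<otimes>\<^bsub>BijGroup Ga\<^esub> \<phi> h) x"
    proof (cases "x \<in> Ga")
      case True
      then show ?thesis using gh bij act_Ga[OF gh(2) True] Ga_P[OF True]
        by (simp add: BijGroup_def Aut_mult act_compose compose_eq)
    next
      case False
      then show ?thesis using gh bij by (simp add: BijGroup_def compose_def)
    qed
  qed
  then have "\<phi> \<in> hom G (BijGroup Ga)" using bij by (auto simp: hom_def BijGroup_def)
  then show ?thesis
    unfolding group_action_def group_hom_def group_hom_axioms_def using Aut_group group_BijGroup by blast
qed

lemma continuous_action_Ga: "continuous_action G TG X \<phi>"
  unfolding continuous_action_def
proof (intro conjI topological_group_Aut)
  show "group_action G (mspace X) \<phi>" unfolding mspace_X by (rule group_action_Ga)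
  interpret XX: Metric_space Ga \<rho> by (rule Ga_metric_space)
  have mt: "mtopology_of X = XX.mtopology" unfolding mtopology_of_def mspace_X by (simp add: mdist_submetric)
  show "continuous_map (prod_topology TG (mtopology_of X)) (mtopology_of X) (\<lambda>(g, x). \<phi> g x)"
    unfolding mt XX.continuous_map_to_metric
  proof (intro ballI allI impI)
    fix p and \<epsilon> :: real assume p: "p \<in> topspace (prod_topology TG XX.mtopology)" and \<epsilon>: "\<epsilon> > 0"
    obtain g x where gx: "p = (g, x)" "g \<in> carrier G" "x \<in> Ga" using p by auto
    have xP: "x \<in> P" using gx Ga_P by blast
    have e: "\<epsilon>/2 > 0" using \<epsilon> by simp
    obtain F \<delta> where F: "finite F" "F \<subseteq> I" "\<delta> > 0"
      "\<forall>x\<in>P. \<forall>y\<in>P. (\<forall>i\<in>F. d (x i) (y i) < \<delta>) \<longrightarrow> \<rho> x y < \<epsilon>/2"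
      using compat e unfolding compatible_power_metric_def by meson
    \<comment> \<open>Finitely many coordinates of \<open>x\<close> constrain \<open>h\<close>; the
      variation of the tuple is absorbed by invariance of the metric.\<close>
    define U where "U = {h \<in> carrier G. \<forall>c\<in>x ` F. d (h c) (g c) < \<delta>} \<times> XX.mball x (\<epsilon>/2)"
    have "openin (prod_topology TG XX.mtopology) U" unfolding U_def
      by (intro openin_prod_Times_iff[THEN iffD2] disjI2 conjI openin_TG_nbhd XX.openin_mball)
        (use gx F(1,2) xP in auto)
    moreover have "p \<in> U" using gx xP F(2,3) e by (auto simp: U_def)
    moreover have "(case q of (g, x) \<Rightarrow> \<phi> g x) \<in> XX.mball (case p of (g, x) \<Rightarrow> \<phi> g x) \<epsilon>" if "q \<in> U" for q
    proof -
      obtain h y where q: "q = (h, y)" "h \<in> carrier G" "\<And>i. i \<in> F \<Longrightarrow> d (h (x i)) (g (x i)) < \<delta>"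
        "y \<in> Ga" "\<rho> x y < \<epsilon>/2" using \<open>q \<in> U\<close> by (auto simp: U_def)
      have yP: "y \<in> P" using q Ga_P by blast
      have "d (act g x i) (act h x i) < \<delta>" if "i \<in> F" for i
        using q(3)[OF that] F(2) that xP d_sym[of "g (x i)"] by auto
      then have "\<rho> (act g x) (act h x) < \<epsilon>/2" using F(4) gx(2) q(2) xP by simp
      moreover have "\<rho> (act g x) (act h y) \<le> \<rho> (act g x) (act h x) + \<rho> (act h x) (act h y)"
        using gx q xP yP by (intro \<rho>_triangle) auto
      moreover have "\<rho> (act h x) (act h y) = \<rho> x y" using q xP yP by simp
      ultimately have "\<rho> (act g x) (act h y) < \<epsilon>" using q(5) by linarith
      then show ?thesis using gx q act_Ga by simp
    qed
    ultimately show "\<exists>U. openin (prod_topology TG XX.mtopology) U \<and> p \<in> U \<and>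
        (\<forall>q\<in>U. (case q of (g, x) \<Rightarrow> \<phi> g x) \<in> XX.mball (case p of (g, x) \<Rightarrow> \<phi> g x) \<epsilon>)" by blast
  qed
qed

theorem uniformly_micro_transitive_Ga: "uniformly_micro_transitive G TG X \<phi>"
  unfolding uniformly_micro_transitive_def
proof (intro conjI continuous_action_Ga allI impI)
  fix U assume "nbhd_of_identity G TG U"
  then obtain F \<epsilon> where F: "finite F" "F \<subseteq> S" "\<epsilon> > 0"
    and U: "\<And>g. g \<in> carrier G \<Longrightarrow> (\<And>c. c \<in> F \<Longrightarrow> d (g c) c < \<epsilon>) \<Longrightarrow> g \<in> U"
    using nbhd_of_identity_Aut by blast
  obtain \<delta> where \<delta>: "\<delta> > 0" "\<And>x y. x \<in> Ga \<Longrightarrow> y \<in> Ga \<Longrightarrow> \<rho> x y < \<delta> \<Longrightarrow>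
    \<exists>g\<in>carrier G. (\<forall>c\<in>F. d (g c) c < \<epsilon>) \<and> act g x = y"
    using uniform_micro_transitivity[OF F] by blast
  have "y \<in> {\<phi> g x | g. g \<in> U}" if x: "x \<in> Ga" and y: "y \<in> mball_of X x \<delta>" for x y
  proof -
    have "y \<in> Ga" "\<rho> x y < \<delta>" using y x unfolding in_mball_of mspace_X by (auto simp: mdist_submetric)
    then obtain g where g: "g \<in> carrier G" "\<And>c. c \<in> F \<Longrightarrow> d (g c) c < \<epsilon>" "act g x = y"
      using \<delta>(2)[OF x] by blast
    then have "g \<in> U" "\<phi> g x = y" using U x by auto
    then show ?thesis by blast
  qed
  then show "\<exists>\<delta>>0. \<forall>x\<in>mspace X. mball_of X x \<delta> \<inter> orbit G \<phi> x \<subseteq> {\<phi> g x | g. g \<in> U}"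
    unfolding mspace_X using \<delta>(1) by blast
qed

end

theorem proposition5p8:
  fixes L :: "'r language" and M :: "('a, 'r) mstructure"
    and n :: enat and a :: "nat \<Rightarrow> 'a" and D :: "(nat \<Rightarrow> 'a) metric"
  defines "G \<equiv> Aut L M"
    and "diag \<equiv> diag_action (universe M) n"
  defines "Ga \<equiv> orbit G diag a"
  assumes "separably_categorical L M"
    and "countable_language_up_to_interdef L M"
    and "compatible_power_metric (universe M) n D"
    and "invariant_metric G diag D"
    and "a \<in> power_space (universe M) n"
    and "closedin (mtopology_of D) Ga"
  shows "uniformly_micro_transitive G (Aut_topology L M) (submetric D Ga)
           (\<lambda>g. restrict (diag g) Ga)"
proof -
  interpret closed_orbit L M n a D
    by unfold_locales (use assms in \<open>simp_all add: G_def diag_def Ga_def\<close>)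
  show ?thesis unfolding G_def diag_def Ga_def by (rule uniformly_micro_transitive_Ga)
qed

end
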